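(* Let $d\ge2$, $m\in\mathbb{N}$. Let $\{\mathsf{B}_n(t):n\in\mathbb{N}_0\}$ be stationary covariance matrix functions on $\mathbb{T}$ with $\sum_{n=0}^\infty\mathsf{B}_n(0)P_n^{(\alpha,\beta)}(1)$ convergent. Let $\{\mathbf{V}_n(t):n\in\mathbb{N}_0\}$ be a sequence of independent $m$-variate wide-sense stationary stochastic processes on $\mathbb{T}$ with $\mathsf{E}[\mathbf{V}_n(t)]=\mathbf{0}$ and $\operatorname{cov}(\mathbf{V}_n(t_1),\mathbf{V}_n(t_2))=a_n^2\mathsf{B}_n(t_1-t_2)$, $n\in\mathbb{N}_0$, and let $\mathbf{U}$ be a random element uniformly distributed on $\mathbb{M}^d$, independent of $\{\mathbf{V}_n(t)\}$. Then the series \[ \mathbf{Z}(\mathbf{x};t)=\sum_{n=0}^\infty\mathbf{V}_n(t)P_n^{(\alpha,\beta)}(\cos\rho(\mathbf{x},\mathbf{U})),\qquad\mathbf{x}\in\mathbb{M}^d,\ t\in\mathbb{T}, \] converges in mean square and defines an $m$-variate random field that is isotropic and mean square continuous on $\mathbb{M}^d$, stationary on $\mathbb{T}$, has mean $\mathbf{0}$, and has covariance matrix function \[ \operatorname{cov}(\mathbf{Z}(\mathbf{x}_1;t_1),\mathbf{Z}(\mathbf{x}_2;t_2))=\sum_{n=0}^\infty\mathsf{B}_n(t_1-t_2)P_n^{(\alpha,\beta)}(\cos\rho(\mathbf{x}_1,\mathbf{x}_2)),\qquad \mathbf{x}_1,\mathbf{x}_2\in\mathbb{M}^d,\ t_1,t_2\in\mathbb{T}.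 \]
   Context: A compact connected two-point homogeneous space $\mathbb{M}^d$ of real dimension $d$ is one of: the sphere $\mathbb{S}^d$, the real projective space $\mathbb{P}^d(\mathbb{R})$, the complex projective space $\mathbb{P}^d(\mathbb{C})$ ($d$ even, $d\ge4$), the quaternionic projective space $\mathbb{P}^d(\mathbb{H})$ ($d=8,12,\dots$), or the octonionic projective plane $\mathbb{P}^{16}(\mathbb{O})$. Each is a Riemannian manifold all of whose geodesics are closed; the metric is normalized so that every closed geodesic has length $2\pi$ (as for the unit sphere $\mathbb{S}^d\subset\mathbb{R}^{d+1}$ with $\rho(\mathbf{x}_1,\mathbf{x}_2)=\arccos(\mathbf{x}_1^\top\mathbf{x}_2)$). $\rho$ denotes the induced geodesic distance, $\mu$ the canonical Riemannian volume measure, $\omega_d=\mu(\mathbb{M}^d)$. The parameters $(\alpha,\beta)$ are: for $\mathbb{S}^d$, $\alpha=\beta=\frac{d-2}{2}$; for $\mathbb{P}^d(\mathbb{R})$, $\alpha=\frac{d-2}{2}$, $\beta=-\frac12$; for $\mathbb{P}^d(\mathbb{C})$, $\alpha=\frac{d-2}{2}$, $\beta=0$; for $\mathbb{P}^d(\mathbb{H})$, $\alpha=\frac{d-2}{2}$, $\beta=1$; for $\mathbb{P}^{16}(\mathbb{O})$, $\alpha=7$, $\beta=3$. $P_n^{(\alpha,\beta)}$ is the Jacobi polynomial of degree $n$ in the standard normalization $P_n^{(\alpha,\beta)}(1)=\frac{\Gamma(n+\alpha+1)}{\Gamma(n+1)\Gamma(\alpha+1)}$. The constants are $a_n=\left(\frac{\Gamma(\beta+1)(2n+\alpha+\beta+1)\Gamma(n+\alpha+\beta+1)}{\Gamma(\alpha+\beta+2)\Gamma(n+\beta+1)}\right)^{1/2}$.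 A random element $\mathbf{U}$ of $\mathbb{M}^d$ is uniformly distributed if its law is invariant under all isometries of $\mathbb{M}^d$; equivalently its law is $\mu/\omega_d$. The temporal domain $\mathbb{T}$ is either $\mathbb{R}$ or $\mathbb{Z}$. A stationary covariance matrix function on $\mathbb{T}$ is an $m\times m$ matrix function $\mathsf{B}(t)$ such that $\mathsf{B}(t_1-t_2)=\operatorname{cov}(\mathbf{V}(t_1),\mathbf{V}(t_2))$ for some $m$-variate second-order wide-sense stationary process $\mathbf{V}$ on $\mathbb{T}$. An $m$-variate random field on $\mathbb{M}^d\times\mathbb{T}$ is isotropic over $\mathbb{M}^d$ and stationary over $\mathbb{T}$ if its mean is constant and $\operatorname{cov}(\mathbf{Z}(\mathbf{x}_1;t_1),\mathbf{Z}(\mathbf{x}_2;t_2))=\mathsf{E}[(\mathbf{Z}(\mathbf{x}_1;t_1)-\mathsf{E}\mathbf{Z}(\mathbf{x}_1;t_1))(\mathbf{Z}(\mathbf{x}_2;t_2)-\mathsf{E}\mathbf{Z}(\mathbf{x}_2;t_2))^\top]$ depends only on $\rho(\mathbf{x}_1,\mathbf{x}_2)$ and $t_1-t_2$; it is mean square continuous on $\mathbb{M}^d$ if for each $t$ and each component $k$, $\mathsf{E}|Z_k(\mathbf{x}_1;t)-Z_k(\mathbf{x}_2;t)|^2\to0$ as $\rho(\mathbf{x}_1,\mathbf{x}_2)\to0$. A series of matrices converges if each entry converges. *)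

theory Defs
  imports "HOL-Probability.Probability"
begin

text \<open>Standard normalisation: P_n^(a,b)(x) = sum_s C(n+a, n-s) C(n+b, s) ((x-1)/2)^s ((x+1)/2)^(n-s),
  so that P_n^(a,b)(1) = Gamma(n+a+1)/(Gamma(n+1) Gamma(a+1)).\<close>
definition jacobiP :: "nat \<Rightarrow> real \<Rightarrow> real \<Rightarrow> real \<Rightarrow> real" where
  "jacobiP n a b x = (\<Sum>s\<le>n. ((real n + a) gchoose (n - s)) * ((real n + b) gchoose s)
        * ((x - 1) / 2) ^ s * ((x + 1) / 2) ^ (n - s))"

definition jacobi_a :: "real \<Rightarrow> real \<Rightarrow> nat \<Rightarrow> real" where
  "jacobi_a a b n = sqrt ((Gamma (b + 1) * (2 * real n + a + b + 1) * Gamma (real n + a + b + 1))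
        / (Gamma (a + b + 2) * Gamma (real n + b + 1)))"

text \<open>Cayley--Dickson doubling: (a,b)(c,d) = (ac - d* b, d a + b c*), (a,b)* = (a*, -b).\<close>
type_synonym quat = "complex \<times> complex"
type_synonym oct = "quat \<times> quat"

definition qconj :: "quat \<Rightarrow> quat" where "qconj q = (cnj (fst q), - snd q)"
definition qmult :: "quat \<Rightarrow> quat \<Rightarrow> quat" where
  "qmult p q = (fst p * fst q - cnj (snd q) * snd p, snd q * fst p + snd p * cnj (fst q))"
definition qplus :: "quat \<Rightarrow> quat \<Rightarrow> quat" where "qplus p q = (fst p + fst q, snd p + snd q)"
definition qminus :: "quat \<Rightarrow> quat \<Rightarrow> quat" where "qminus p q = (fst p - fst q, snd p - snd q)"
definition qzero :: quat where "qzero = (0, 0)"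

definition oconj :: "oct \<Rightarrow> oct" where "oconj x = (qconj (fst x), qminus qzero (snd x))"
definition omult :: "oct \<Rightarrow> oct \<Rightarrow> oct" where
  "omult x y = (qminus (qmult (fst x) (fst y)) (qmult (qconj (snd y)) (snd x)),
               qplus (qmult (snd y) (fst x)) (qmult (snd x) (qconj (fst y))))"
definition oplus :: "oct \<Rightarrow> oct \<Rightarrow> oct" where "oplus x y = (qplus (fst x) (fst y), qplus (snd x) (snd y))"
definition ozero :: oct where "ozero = (qzero, qzero)"
definition oone :: oct where "oone = ((1, 0), qzero)"
definition ore :: "oct \<Rightarrow> real" where "ore x = Re (fst (fst x))"

text \<open>The real division algebra of real dimension k (1, 2, 4, 8) inside the octonions:
  R, C, H, O.\<close>
definition in_alg :: "nat \<Rightarrow> oct \<Rightarrow> bool" where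
  "in_alg k x =
     (if k = 1 then snd x = qzero \<and> snd (fst x) = 0 \<and> Im (fst (fst x)) = 0
      else if k = 2 then snd x = qzero \<and> snd (fst x) = 0
      else if k = 4 then snd x = qzero
      else True)"

definition sphere_set :: "nat \<Rightarrow> (nat \<Rightarrow> real) set" where
  "sphere_set d = {x. (\<forall>i>d. x i = 0) \<and> (\<Sum>i\<le>d. (x i)^2) = 1}"

definition sphere_dist :: "nat \<Rightarrow> (nat \<Rightarrow> real) \<Rightarrow> (nat \<Rightarrow> real) \<Rightarrow> real" where
  "sphere_dist d x y = arccos (\<Sum>i\<le>d. x i * y i)"

definition omat_mult :: "nat \<Rightarrow> (nat \<Rightarrow> nat \<Rightarrow> oct) \<Rightarrow> (nat \<Rightarrow> nat \<Rightarrow> oct) \<Rightarrow> (nat \<Rightarrow> nat \<Rightarrow> oct)" where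
  "omat_mult N X Y = (\<lambda>i j. if i < N \<and> j < N
        then foldr (\<lambda>l acc. oplus (omult (X i l) (Y l j)) acc) [0..<N] ozero else ozero)"

text \<open>Projective space over the algebra of real dimension k with N homogeneous coordinates,
  realised (Freudenthal) as the set of Hermitian N x N idempotent matrices of trace 1.\<close>
definition proj_set :: "nat \<Rightarrow> nat \<Rightarrow> (nat \<Rightarrow> nat \<Rightarrow> oct) set" where
  "proj_set k N = {X. (\<forall>i j. (i \<ge> N \<or> j \<ge> N) \<longrightarrow> X i j = ozero)
        \<and> (\<forall>i j. in_alg k (X i j))
        \<and> (\<forall>i j. X j i = oconj (X i j))
        \<and> omat_mult N X X = X
        \<and> (\<Sum>i<N. ore (X i i)) = 1}"

text \<open>Geodesic distance normalised so that closed geodesics have length 2 pi: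
  cos rho(X,Y) = 2 Re tr(XY) - 1.\<close>
definition proj_dist :: "nat \<Rightarrow> (nat \<Rightarrow> nat \<Rightarrow> oct) \<Rightarrow> (nat \<Rightarrow> nat \<Rightarrow> oct) \<Rightarrow> real" where
  "proj_dist N X Y = arccos (2 * (\<Sum>i<N. \<Sum>j<N. ore (omult (X i j) (Y j i))) - 1)"

definition isometric_onto :: "'p set \<Rightarrow> ('p \<Rightarrow> 'p \<Rightarrow> real) \<Rightarrow> 'q set \<Rightarrow> ('q \<Rightarrow> 'q \<Rightarrow> real) \<Rightarrow> ('p \<Rightarrow> 'q) \<Rightarrow> bool" where
  "isometric_onto M rho M' rho' f \<longleftrightarrow> bij_betw f M M' \<and> (\<forall>x\<in>M. \<forall>y\<in>M. rho' (f x) (f y) = rho x y)"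

text \<open>(M, rho) is (isometric to) the compact connected two-point homogeneous space M^d with
  Jacobi parameters (alpha, beta).\<close>
definition cpths :: "nat \<Rightarrow> 'p set \<Rightarrow> ('p \<Rightarrow> 'p \<Rightarrow> real) \<Rightarrow> real \<Rightarrow> real \<Rightarrow> bool" where
  "cpths d M rho alpha beta \<longleftrightarrow>
     (alpha = (real d - 2) / 2 \<and> beta = (real d - 2) / 2 \<and>
        (\<exists>f. isometric_onto M rho (sphere_set d) (sphere_dist d) f))
   \<or> (alpha = (real d - 2) / 2 \<and> beta = - 1 / 2 \<and>
        (\<exists>f. isometric_onto M rho (proj_set 1 (d + 1)) (proj_dist (d + 1)) f))
   \<or> (even d \<and> d \<ge> 4 \<and> alpha = (real d - 2) / 2 \<and> beta = 0 \<and>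
        (\<exists>f. isometric_onto M rho (proj_set 2 (d div 2 + 1)) (proj_dist (d div 2 + 1)) f))
   \<or> (4 dvd d \<and> d \<ge> 8 \<and> alpha = (real d - 2) / 2 \<and> beta = 1 \<and>
        (\<exists>f. isometric_onto M rho (proj_set 4 (d div 4 + 1)) (proj_dist (d div 4 + 1)) f))
   \<or> (d = 16 \<and> alpha = 7 \<and> beta = 3 \<and>
        (\<exists>f. isometric_onto M rho (proj_set 8 3) (proj_dist 3) f))"

definition Msig :: "'p set \<Rightarrow> ('p \<Rightarrow> 'p \<Rightarrow> real) \<Rightarrow> 'p measure" where
  "Msig M rho = sigma M {{y \<in> M. rho x y < r} | x r. x \<in> M}"

definition uniform_on :: "'w measure \<Rightarrow> 'p set \<Rightarrow> ('p \<Rightarrow> 'p \<Rightarrow> real) \<Rightarrow> ('w \<Rightarrow> 'p) \<Rightarrow> bool" where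
  "uniform_on P M rho U \<longleftrightarrow> U \<in> measurable P (Msig M rho) \<and>
     (\<forall>g. isometric_onto M rho M rho g \<longrightarrow>
          distr P (Msig M rho) (\<lambda>w. g (U w)) = distr P (Msig M rho) U)"

definition covar :: "'w measure \<Rightarrow> ('w \<Rightarrow> real) \<Rightarrow> ('w \<Rightarrow> real) \<Rightarrow> real" where
  "covar P X Y = (\<integral>w. (X w - (\<integral>v. X v \<partial>P)) * (Y w - (\<integral>v. Y v \<partial>P)) \<partial>P)"

text \<open>B is a stationary covariance matrix function on T: there is an m-variate second-order
  wide-sense stationary process W on T (on some probability space; w.l.o.g. on the path
  space) with B(t1 - t2) = cov(W(t1), W(t2)).  Components are indexed by k < m.\<close>
definition stat_cov_fun :: "real set \<Rightarrow> nat \<Rightarrow> (real \<Rightarrow> nat \<Rightarrow> nat \<Rightarrow> real) \<Rightarrow> bool" where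
  "stat_cov_fun T m B \<longleftrightarrow>
     (\<exists>(Q :: (real \<Rightarrow> nat \<Rightarrow> real) measure) (W :: real \<Rightarrow> (real \<Rightarrow> nat \<Rightarrow> real) \<Rightarrow> nat \<Rightarrow> real) mu.
        prob_space Q \<and>
        (\<forall>t\<in>T. \<forall>k<m. (\<lambda>w. W t w k) \<in> borel_measurable Q \<and> integrable Q (\<lambda>w. (W t w k)^2)
                 \<and> (\<integral>w. W t w k \<partial>Q) = mu k) \<and>
        (\<forall>t1\<in>T. \<forall>t2\<in>T. \<forall>k<m. \<forall>l<m.
            covar Q (\<lambda>w. W t1 w k) (\<lambda>w. W t2 w l) = B (t1 - t2) k l))"

end

theory Submission
  imports Defs
begin

text \<open>After the change of variable \<open>u = (1 + cos \<rho>) / 2\<close> every space is the set of rank one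
  idempotents of a simple Euclidean Jordan algebra and \<open>u\<close> is the trace form. For uniform \<open>U\<close> the
  function \<open>u (x, U)\<close> has the moments of a Beta distribution: invariance under the rotation along a
  geodesic, together with averaging over an orthonormal frame at \<open>x\<close>, gives the moment recursion.
  By two-point homogeneity \<open>E [f (u (x, U)) q (u (y, U))]\<close> is a polynomial in \<open>u (x, y)\<close> of degree
  at most \<open>degree q\<close>, and by Fubini the operators so defined are self-adjoint; hence they
  are diagonal in the orthogonal polynomials of the Beta distribution, which are the Jacobi polynomials.
  This yields \<open>E [P_n (cos \<rho> (x, U)) P_n (cos \<rho> (y, U))] = P_n (cos \<rho> (x, y)) / a_n^2\<close>. Since the
  \<open>V_n\<close> are independent and centred, the terms of the series are orthogonal in \<open>L^2\<close> with summable
  norms, so the series converges and its covariance is the sum of those of its terms.\<close>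


section \<open>Jacobi polynomials and Beta moments\<close>

text \<open>The space is known only as a metric space isometric to a model, with the sigma-algebra
  generated by balls and a law invariant under isometries; no density of the distance is at hand.
  Hence the Beta law, with parameters \<open>kap / 2\<close> = \<beta> + 1 and
  \<open>card I / 2\<close> = \<alpha> + 1, enters only through its moments, as a linear functional
  on polynomials, and the orthogonality of the Jacobi polynomials becomes an identity between
  Pochhammer symbols. The constant in the reproducing formula is found on the diagonal, where it is
  the squared norm of P_n divided by P_n(1); Gamma function algebra turns this quotient into 1 /
  a_n^2. Fubini needs \<open>ip\<close> to be jointly measurable for a product of ball
  sigma-algebras. A finite expansion of \<open>ip\<close> into products of measurable functions is
  therefore part of the geometric interface. The heaviest part of that interface is the normal form
  of a pair of points. Over the octonions matrix conjugation by a diagonal unitary matrix is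
  obstructed by the lack of associativity; only real reflections and maps of Moufang type remain,
  and these suffice for 3 by 3 matrices.\<close>

lemma alternating_sum_pochhammer:
  assumes "j \<le> n"
  shows "(\<Sum>s\<le>n. (-1) ^ s * real (n choose s) * pochhammer (c - real s) j) = (if j = n then fact n else 0)"
proof -
  have diff: "pochhammer x (Suc j) - pochhammer (x - 1) (Suc j) = real (Suc j) * pochhammer x j" for x :: real and j
    using pochhammer_rec[of "x - 1" j] pochhammer_rec'[of x j] by (simp add: algebra_simps)
  have pascal: "(\<Sum>s\<le>Suc n. (-1) ^ s * real (Suc n choose s) * f s)
      = (\<Sum>s\<le>n. (-1) ^ s * real (n choose s) * (f s - f (Suc s)))" for n and f :: "nat \<Rightarrow> real"
  proof -
    have "(\<Sum>s\<le>Suc n. (-1) ^ s * real (Suc n choose s) * f s)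
        = f 0 + (\<Sum>s\<le>n. (-1) ^ Suc s * real (Suc n choose Suc s) * f (Suc s))"
      by (subst sum.atMost_Suc_shift) simp
    also have "\<dots> = (f 0 + (\<Sum>s\<le>n. (-1) ^ Suc s * real (n choose Suc s) * f (Suc s)))
        - (\<Sum>s\<le>n. (-1) ^ s * real (n choose s) * f (Suc s))"
      by (simp add: algebra_simps sum.distrib sum_negf sum_subtractf)
    also have "f 0 + (\<Sum>s\<le>n. (-1) ^ Suc s * real (n choose Suc s) * f (Suc s))
        = (\<Sum>s\<le>Suc n. (-1) ^ s * real (n choose s) * f s)"
      by (subst sum.atMost_Suc_shift) simp
    also have "\<dots> = (\<Sum>s\<le>n. (-1) ^ s * real (n choose s) * f s)" by simp
    finally show ?thesis by (simp add: algebra_simps sum_subtractf)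
  qed
  \<comment> \<open>The sum is an n-fold finite difference of a polynomial of degree j in s. Each
    induction step spends one difference (\<open>pascal\<close>) to lower the Pochhammer symbol by
    one factor (\<open>diff\<close>).\<close>
  have "(j < n \<longrightarrow> (\<Sum>s\<le>n. (-1) ^ s * real (n choose s) * pochhammer (c - real s) j) = 0) \<and>
        (j = n \<longrightarrow> (\<Sum>s\<le>n. (-1) ^ s * real (n choose s) * pochhammer (c - real s) j) = fact n)"
  proof (induction n arbitrary: j)
    case 0 then show ?case by simp
  next
    case (Suc n)
    show ?case
    proof (cases j)
      case 0 then show ?thesis using pascal[of n "\<lambda>s. pochhammer (c - real s) j"] by simp
    next
      case (Suc i)
      have "(\<Sum>s\<le>Suc n. (-1) ^ s * real (Suc n choose s) * pochhammer (c - real s) j)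
          = real (Suc i) * (\<Sum>s\<le>n. (-1) ^ s * real (n choose s) * pochhammer (c - real s) i)"
        unfolding pascal sum_distrib_left
      proof (rule sum.cong[OF refl])
        fix s
        have "pochhammer (c - real s) j - pochhammer (c - real (Suc s)) j = real (Suc i) * pochhammer (c - real s) i"
          using diff[of "c - real s" i] by (simp add: Suc algebra_simps)
        then show "(-1) ^ s * real (n choose s) * (pochhammer (c - real s) j - pochhammer (c - real (Suc s)) j)
           = real (Suc i) * ((-1) ^ s * real (n choose s) * pochhammer (c - real s) i)" by simp
      qed
      then show ?thesis using Suc.IH[of i] Suc by (auto simp: fact_Suc)
    qed
  qed
  then show ?thesis using assms by auto
qed

text \<open>The variable is u = (1 + x) / 2, so that (x - 1) / 2 = -(1 - u). Powers of u times
  powers of 1 - u are exactly the functions whose Beta averages have a closed form.\<close>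

definition jacobi_poly :: "nat \<Rightarrow> real \<Rightarrow> real \<Rightarrow> real poly" where
  "jacobi_poly n \<alpha> \<beta> = (\<Sum>s\<le>n. smult (((real n + \<alpha>) gchoose (n - s)) * ((real n + \<beta>) gchoose s) * (-1) ^ s)
       (monom 1 (n - s) * [:1, -1:] ^ s))"

lemma poly_jacobi_poly: "poly (jacobi_poly n \<alpha> \<beta>) u = jacobiP n \<alpha> \<beta> (2 * u - 1)"
proof -
  have pow: "(-1) ^ s * ((1 - u) ^ s * x) = (u - 1) ^ s * x" for s x
    using power_mult_distrib[of "-1" "1 - u" s] by (simp flip: mult.assoc)
  show ?thesis
    unfolding jacobi_poly_def jacobiP_def poly_sum
    by (simp add: poly_monom diff_divide_distrib) (simp only: mult.assoc mult.commute[of "u ^ _"] pow)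
qed

lemma degree_jacobi_poly: "degree (jacobi_poly n \<alpha> \<beta>) \<le> n"
  unfolding jacobi_poly_def
proof (rule degree_sum_le)
  fix s assume "s \<in> {..n}"
  have "degree (monom 1 (n - s) * [:1, -1::real:] ^ s) \<le> degree (monom (1::real) (n - s)) + degree ([:1, -1::real:] ^ s)"
    by (rule degree_mult_le)
  also have "\<dots> \<le> (n - s) + s"
    using degree_power_le[of "[:1, -1::real:]" s] by (intro add_mono) (auto simp: degree_monom_eq)
  finally show "degree (smult (((real n + \<alpha>) gchoose (n - s)) * ((real n + \<beta>) gchoose s) * (-1) ^ s)
       (monom 1 (n - s) * [:1, -1:] ^ s)) \<le> n"
    using \<open>s \<in> {..n}\<close> degree_smult_le order_trans by fastforce
qed simp

text \<open>The signs cancel against the leading coefficients of the powers of 1 - u; the remaining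
  products of binomials are summed by Vandermonde's convolution.\<close>

lemma coeff_jacobi_poly: "coeff (jacobi_poly n \<alpha> \<beta>) n = (2 * real n + \<alpha> + \<beta>) gchoose n"
proof -
  have c: "coeff ([:1, -1::real:] ^ s) s = (-1) ^ s" for s
    using lead_coeff_power[of "[:1, -1::real:]" s] degree_power_eq[of "[:1, -1::real:]" s] by simp
  have "coeff (jacobi_poly n \<alpha> \<beta>) n
     = (\<Sum>s\<le>n. ((real n + \<alpha>) gchoose (n - s)) * ((real n + \<beta>) gchoose s))"
    unfolding jacobi_poly_def coeff_sum
  proof (rule sum.cong[OF refl])
    fix s assume "s \<in> {..n}"
    then show "coeff (smult (((real n + \<alpha>) gchoose (n - s)) * ((real n + \<beta>) gchoose s) * (-1) ^ s)
         (monom 1 (n - s) * [:1, -1:] ^ s)) n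
      = ((real n + \<alpha>) gchoose (n - s)) * ((real n + \<beta>) gchoose s)"
      by (simp add: coeff_monom_mult c power_mult_distrib[symmetric] flip: power_add)
  qed
  also have "\<dots> = ((real n + \<beta>) + (real n + \<alpha>)) gchoose n"
    using gbinomial_Vandermonde[of "real n + \<beta>" "real n + \<alpha>" n] by (simp add: mult.commute atMost_atLeast0)
  finally show ?thesis by (simp add: algebra_simps)
qed

text \<open>Averaging against the weight u^(b - 1) * (1 - u)^(a - 1), described by its moments
  alone. In Jacobi notation \<alpha> = a - 1 and \<beta> = b - 1.\<close>

locale beta_functional =
  fixes E :: "real poly \<Rightarrow> real" and a b :: real
  assumes E_add: "E (p + q) = E p + E q"
    and E_smult: "E (smult c p) = c * E p"
    and E_monom: "E (monom 1 j) = pochhammer b j / pochhammer (a + b) j"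
    and a_pos: "a > 0" and b_pos: "b > 0"
begin

lemma E_0: "E 0 = 0" using E_smult[of 0 0] by simp

lemma E_sum: "E (sum f A) = (\<Sum>i\<in>A. E (f i))"
  by (induction A rule: infinite_finite_induct) (auto simp: E_0 E_add)

lemma poch_nz: "x > 0 \<Longrightarrow> pochhammer (x::real) n \<noteq> 0"
  using pochhammer_pos[of x n] by simp

text \<open>Mixed moments of the Beta law; the induction rests on (1 - u)^(s + 1) = (1 - u)^s - u *
  (1 - u)^s.\<close>

lemma E_beta: "E (monom 1 i * [:1, -1:] ^ s) = pochhammer b i * pochhammer a s / pochhammer (a + b) (i + s)"
proof (induction s arbitrary: i)
  case 0 then show ?case by (simp add: E_monom)
next
  case (Suc s)
  have "monom 1 i * [:1, -1:] ^ Suc s = monom 1 i * [:1, -1:] ^ s + smult (-1) (monom 1 (Suc i) * [:1, -1::real:] ^ s)"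
    by (simp add: monom_Suc algebra_simps)
  then have "E (monom 1 i * [:1, -1:] ^ Suc s)
    = pochhammer b i * pochhammer a s / pochhammer (a + b) (i + s)
      - pochhammer b (Suc i) * pochhammer a s / pochhammer (a + b) (Suc i + s)"
    by (simp only: E_add E_smult Suc mult_minus1 diff_conv_add_uminus)
  also have "\<dots> = pochhammer b i * pochhammer a (Suc s) / pochhammer (a + b) (i + Suc s)"
  proof -
    have "pochhammer (a + b) (i + s) \<noteq> 0" "a + b + (real i + real s) \<noteq> 0"
      using poch_nz[of "a + b" "i + s"] a_pos b_pos by (auto simp: add_pos_nonneg)
    moreover have "y * x / p - y * (b + i) * x / (p * (a + b + (i + s))) = y * (x * (a + s)) / (p * (a + b + (i + s)))"
      if "p \<noteq> 0" "a + b + (i + s) \<noteq> 0" for x y p i s :: real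
      using that by (simp add: divide_simps) (simp add: algebra_simps)
    ultimately show ?thesis by (simp add: pochhammer_Suc)
  qed
  finally show ?case .
qed

abbreviation JP where "JP n \<equiv> jacobi_poly n (a - 1) (b - 1)"

text \<open>Here and in \<open>gchoose_b\<close> the binomials are written with denominators that
  cancel against the Pochhammer symbols of the mixed moments.\<close>

lemma gchoose_a: "s \<le> n \<Longrightarrow> (real n + (a - 1)) gchoose (n - s) = pochhammer a n / (pochhammer a s * fact (n - s))"
proof -
  assume "s \<le> n"
  have "(real n + (a - 1)) gchoose (n - s) = pochhammer (a + real s) (n - s) / fact (n - s)"
    using \<open>s \<le> n\<close> by (simp add: gbinomial_pochhammer' of_nat_diff algebra_simps)
  moreover have "pochhammer a n = pochhammer a s * pochhammer (a + real s) (n - s)"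
    using pochhammer_product[OF \<open>s \<le> n\<close>, of a] by simp
  ultimately show ?thesis using poch_nz[OF a_pos, of s] by simp
qed

lemma gchoose_b: "s \<le> n \<Longrightarrow> (real n + (b - 1)) gchoose s = pochhammer b n / (pochhammer b (n - s) * fact s)"
proof -
  assume s: "s \<le> n"
  have "(real n + (b - 1)) gchoose s = pochhammer (b + real (n - s)) s / fact s"
    using s by (simp add: gbinomial_pochhammer' of_nat_diff algebra_simps)
  moreover have "pochhammer b n = pochhammer b (n - s) * pochhammer (b + real (n - s)) s"
    using pochhammer_product[of "n - s" n b] s by simp
  ultimately show ?thesis using poch_nz[OF b_pos, of "n - s"] by simp
qed

text \<open>After the cancellation s occurs only in an alternating binomial and in one Pochhammer
  symbol of degree j. The resulting finite difference replaces Rodrigues' formula and integration by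
  parts.\<close>

lemma E_jacobi_monom:
  "E (JP n * monom 1 j) = pochhammer a n * pochhammer b n / (fact n * pochhammer (a + b) (n + j))
      * (\<Sum>s\<le>n. (-1) ^ s * real (n choose s) * pochhammer ((b + real n) - real s) j)"
proof -
  have "E (JP n * monom 1 j) = (\<Sum>s\<le>n. ((real n + (a - 1)) gchoose (n - s)) * ((real n + (b - 1)) gchoose s) * (-1) ^ s
       * E (monom 1 (n - s + j) * [:1, -1:] ^ s))"
    unfolding jacobi_poly_def sum_distrib_right E_sum
  proof (intro sum.cong refl)
    fix s assume "s \<in> {..n}"
    have "monom 1 (n - s) * [:1, -1:] ^ s * monom 1 j = (monom 1 (n - s) * monom 1 j) * [:1, -1::real:] ^ s"
      by (simp only: ac_simps)
    also have "\<dots> = monom 1 (n - s + j) * [:1, -1::real:] ^ s" by (simp add: mult_monom)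
    finally have "monom 1 (n - s) * [:1, -1:] ^ s * monom 1 j = monom 1 (n - s + j) * [:1, -1::real:] ^ s" .
    then show "E (smult ((real n + (a - 1) gchoose n - s) * (real n + (b - 1) gchoose s) * (- 1) ^ s)
          (monom 1 (n - s) * [:1, - 1:] ^ s) * monom 1 j) =
      (real n + (a - 1) gchoose n - s) * (real n + (b - 1) gchoose s) * (- 1) ^ s * E (monom 1 (n - s + j) * [:1, - 1:] ^ s)"
      by (simp only: mult_smult_left E_smult)
  qed
  also have "\<dots> = (\<Sum>s\<le>n. pochhammer a n * pochhammer b n / (fact n * pochhammer (a + b) (n + j))
      * ((-1) ^ s * real (n choose s) * pochhammer ((b + real n) - real s) j))"
  proof (rule sum.cong[OF refl])
    fix s assume "s \<in> {..n}" then have s: "s \<le> n" by simp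
    have 1: "pochhammer b (n - s + j) = pochhammer b (n - s) * pochhammer ((b + real n) - real s) j"
      using pochhammer_product'[of b "n - s" j] s by (simp add: of_nat_diff algebra_simps)
    have 2: "real (n choose s) = fact n / (fact s * fact (n - s))"
      using binomial_fact[OF s] by simp
    have 3: "n - s + j + s = n + j" using s by simp
    show "((real n + (a - 1)) gchoose (n - s)) * ((real n + (b - 1)) gchoose s) * (-1) ^ s
       * E (monom 1 (n - s + j) * [:1, -1:] ^ s)
      = pochhammer a n * pochhammer b n / (fact n * pochhammer (a + b) (n + j))
      * ((-1) ^ s * real (n choose s) * pochhammer ((b + real n) - real s) j)"
      unfolding gchoose_a[OF s] gchoose_b[OF s] E_beta 1 2 3
      using poch_nz[OF a_pos, of s] poch_nz[OF b_pos, of "n - s"] by (simp add: field_simps)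
  qed
  finally show ?thesis by (simp add: sum_distrib_left)
qed

lemma E_jacobi_less: "j < n \<Longrightarrow> E (JP n * monom 1 j) = 0"
  by (simp add: E_jacobi_monom alternating_sum_pochhammer)

lemma E_jacobi_eq: "E (JP n * monom 1 n) = pochhammer a n * pochhammer b n / pochhammer (a + b) (2 * n)"
  by (simp add: E_jacobi_monom alternating_sum_pochhammer mult_2)

lemma E_mult_expand: "degree q \<le> n \<Longrightarrow> E (p * q) = (\<Sum>j\<le>n. coeff q j * E (p * monom 1 j))"
proof -
  assume "degree q \<le> n"
  then have "q = (\<Sum>j\<le>n. monom (coeff q j) j)" by (rule poly_as_sum_of_monoms'[symmetric])
  then have "p * q = (\<Sum>j\<le>n. smult (coeff q j) (p * monom 1 j))"
    by (metis (mono_tags, lifting) mult.right_neutral mult_smult_right smult_monom sum.cong sum_distrib_left)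
  then show ?thesis by (simp add: E_sum E_smult)
qed

text \<open>Only the coefficient of degree n survives, so this one formula yields both orthogonality
  and norms.\<close>

lemma E_jacobi_mult: "degree q \<le> n \<Longrightarrow> E (JP n * q) = coeff q n * (pochhammer a n * pochhammer b n / pochhammer (a + b) (2 * n))"
  using E_mult_expand[of q n "JP n"]
  by (simp add: lessThan_Suc_atMost[symmetric] E_jacobi_less E_jacobi_eq)

text \<open>The functional is not assumed to be positive. Instead R is paired with the Jacobi
  polynomial of its own degree, which isolates the leading coefficient with a nonzero
  factor.\<close>

lemma orthogonal_imp_zero:
  assumes "\<And>j. j < n \<Longrightarrow> E (R * monom 1 j) = 0" "R \<noteq> 0"
  shows "degree R \<ge> n"
proof (rule ccontr)
  assume less: "\<not> degree R \<ge> n"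
  have "E (R * JP (degree R)) = 0"
    using E_mult_expand[OF degree_jacobi_poly, of R "degree R" "a - 1" "b - 1"] assms(1) less by simp
  then have "lead_coeff R * (pochhammer a (degree R) * pochhammer b (degree R) / pochhammer (a + b) (2 * degree R)) = 0"
    using E_jacobi_mult[of R "degree R"] by (simp add: mult.commute)
  then show False using assms(2) poch_nz a_pos b_pos by auto
qed

lemma coeff_JP_pochhammer: "coeff (JP n) n = pochhammer (real n + a + b - 1) n / fact n"
  unfolding coeff_jacobi_poly gbinomial_pochhammer' by (simp add: algebra_simps)

lemma JP_1: "poly (JP n) 1 = pochhammer a n / fact n"
proof -
  have "poly (JP n) 1 = (\<Sum>s\<le>n. if s = 0 then (real n + (a - 1)) gchoose n else 0)"
    unfolding jacobi_poly_def poly_sum by (intro sum.cong refl) (simp add: poly_monom)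
  also have "\<dots> = pochhammer a n / fact n"
    using gchoose_a[of 0 n] by simp
  finally show ?thesis .
qed

text \<open>All Gamma quotients are rewritten as Pochhammer symbols. The hypothesis keeps the
  argument \<open>real n + a + b - 1\<close> positive also at n = 0.\<close>

lemma jacobi_a_eq:
  assumes "a + b > 1"
  shows "(jacobi_a (a - 1) (b - 1) n)\<^sup>2 = pochhammer (a + b) (2 * n) / (pochhammer (real n + a + b - 1) n * pochhammer b n)"
    and "(jacobi_a (a - 1) (b - 1) n)\<^sup>2 > 0"
proof -
  define c where "c = a + b"
  have c: "c > 1" "b > 0" using assms b_pos by (auto simp: c_def)
  have npos: "x \<notin> \<int>\<^sub>\<le>\<^sub>0" if "x > 0" for x :: real
    using that by (auto elim!: nonpos_Ints_cases)
  have G1: "pochhammer c (2 * n) = (c + 2 * real n - 1) * Gamma (c + 2 * real n - 1) / Gamma c"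
    using Gamma_plus1[of "c + 2 * real n - 1"] pochhammer_Gamma[of c "2 * n"] npos c by simp
  have G2: "pochhammer (real n + c - 1) n = Gamma (c + 2 * real n - 1) / Gamma (real n + c - 1)"
    using pochhammer_Gamma[of "real n + c - 1" n] npos c by (simp add: algebra_simps)
  have G3: "pochhammer b n = Gamma (real n + b) / Gamma b"
    using pochhammer_Gamma[of b n] npos c by (simp add: algebra_simps)
  have gen: "x * z * y / (w * v) = (z * r / w) / ((r / y) * (v / x))"
    if "x > 0" "y > 0" "r > 0" "v > 0" "w > 0" for x y z w v r :: real
    using that by (simp add: field_simps)
  define X where "X = (Gamma b * (2 * real n + c - 1) * Gamma (real n + c - 1)) / (Gamma c * Gamma (real n + b))"
  have X: "jacobi_a (a - 1) (b - 1) n = sqrt X"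
    unfolding jacobi_a_def X_def c_def by (simp add: algebra_simps)
  have "X > 0" unfolding X_def
    using c by (intro divide_pos_pos mult_pos_pos Gamma_real_pos) auto
  then show "(jacobi_a (a - 1) (b - 1) n)\<^sup>2 > 0" unfolding X by simp
  have "(jacobi_a (a - 1) (b - 1) n)\<^sup>2 = X" unfolding X using \<open>X > 0\<close> by simp
  also have "\<dots> = pochhammer c (2 * n) / (pochhammer (real n + c - 1) n * pochhammer b n)"
    unfolding X_def G1 G2 G3
    using c by (subst gen[where r = "Gamma (c + 2 * real n - 1)"]) (auto intro!: Gamma_real_pos simp: algebra_simps)
  finally show "(jacobi_a (a - 1) (b - 1) n)\<^sup>2 = pochhammer (a + b) (2 * n) / (pochhammer (real n + a + b - 1) n * pochhammer b n)"
    by (simp add: c_def add.assoc)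
qed

text \<open>Orthogonality to lower degrees determines F up to a factor, and the value at 1
  determines the factor because P_n(1) is nonzero.\<close>

lemma reproducing:
  assumes ab: "a + b > 1" and deg: "degree F \<le> n"
    and orth: "\<And>j. j < n \<Longrightarrow> E (F * monom 1 j) = 0"
    and one: "poly F 1 = E (JP n * JP n)"
  shows "F = smult (1 / (jacobi_a (a - 1) (b - 1) n)\<^sup>2) (JP n)"
proof -
  have lead: "coeff (JP n) n > 0"
    unfolding coeff_JP_pochhammer
    by (cases n) (use ab in \<open>auto intro!: divide_pos_pos pochhammer_pos\<close>)
  \<comment> \<open>Chosen to cancel the coefficient of degree n: the difference R then has degree
    below n while being orthogonal to all monomials below n, which forces R = 0.\<close>
  define c where "c = coeff F n / coeff (JP n) n"
  define R where "R = F + smult (- c) (JP n)"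
  have "E (R * monom 1 j) = 0" if "j < n" for j
    using orth[OF that] E_jacobi_less[OF that]
    by (simp add: R_def distrib_right E_add mult_smult_left E_smult del: smult_minus_left)
  moreover have "degree R \<le> n"
    unfolding R_def using deg degree_jacobi_poly degree_smult_le order_trans by (intro degree_add_le) blast+
  moreover have "coeff R n = 0" unfolding R_def c_def using lead by simp
  ultimately have "R = 0"
    using orthogonal_imp_zero[of n R] by (metis le_antisym leading_coeff_0_iff)
  then have F: "F = smult c (JP n)" by (simp add: R_def)
  have "c * (pochhammer a n / fact n)
      = pochhammer (real n + a + b - 1) n / fact n * (pochhammer a n * pochhammer b n / pochhammer (a + b) (2 * n))"
    using one unfolding F E_jacobi_mult[OF degree_jacobi_poly] coeff_JP_pochhammer by (simp add: JP_1)
  then have "pochhammer a n * c = pochhammer a n * (pochhammer (real n + a + b - 1) n * pochhammer b n / pochhammer (a + b) (2 * n))"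
    by (simp add: field_simps)
  then have "c = pochhammer (real n + a + b - 1) n * pochhammer b n / pochhammer (a + b) (2 * n)"
    using poch_nz[OF a_pos, of n] mult_left_cancel by blast
  then show ?thesis unfolding F jacobi_a_eq(1)[OF ab] by simp
qed

end

section \<open>Two-point homogeneous models\<close>

definition form_autos :: "'q set \<Rightarrow> ('q \<Rightarrow> 'q \<Rightarrow> real) \<Rightarrow> ('q \<Rightarrow> 'q) set" where
  "form_autos S ip = {g. bij_betw g S S \<and> (\<forall>x\<in>S. \<forall>y\<in>S. ip (g x) (g y) = ip x y)}"

lemma form_autos_ip: "g \<in> form_autos S ip \<Longrightarrow> x \<in> S \<Longrightarrow> y \<in> S \<Longrightarrow> ip (g x) (g y) = ip x y"
  by (simp add: form_autos_def)

lemma form_autos_in: "g \<in> form_autos S ip \<Longrightarrow> x \<in> S \<Longrightarrow> g x \<in> S"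
  by (auto simp: form_autos_def bij_betw_def)

lemma form_autos_comp: "g \<in> form_autos S ip \<Longrightarrow> h \<in> form_autos S ip \<Longrightarrow> g \<circ> h \<in> form_autos S ip"
  unfolding form_autos_def by (auto intro: bij_betw_trans simp: bij_betwE)

lemma form_autos_inv:
  assumes "g \<in> form_autos S ip" shows "inv_into S g \<in> form_autos S ip"
proof -
  have bij: "bij_betw g S S" and ip: "\<And>x y. x \<in> S \<Longrightarrow> y \<in> S \<Longrightarrow> ip (g x) (g y) = ip x y"
    using assms by (auto simp: form_autos_def)
  show ?thesis unfolding form_autos_def
  proof (safe)
    show "bij_betw (inv_into S g) S S" using bij by (rule bij_betw_inv_into)
    fix x y assume "x \<in> S" "y \<in> S"
    then show "ip (inv_into S g x) (inv_into S g y) = ip x y"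
      using ip[of "inv_into S g x" "inv_into S g y"] bij
      by (metis bij_betw_def bij_betw_inv_into_right inv_into_into)
  qed
qed

lemma form_autos_inverse_pair:
  assumes "\<And>x. x \<in> S \<Longrightarrow> g x \<in> S" "\<And>x. x \<in> S \<Longrightarrow> g' x \<in> S"
    and "\<And>x. x \<in> S \<Longrightarrow> g' (g x) = x" "\<And>x. x \<in> S \<Longrightarrow> g (g' x) = x"
    and "\<And>x y. x \<in> S \<Longrightarrow> y \<in> S \<Longrightarrow> ip (g x) (g y) = ip x y"
  shows "g \<in> form_autos S ip"
  unfolding form_autos_def using assms by (auto intro!: bij_betwI[where g = g'])

lemma form_autos_involution:
  assumes "\<And>x. x \<in> S \<Longrightarrow> g x \<in> S" "\<And>x. x \<in> S \<Longrightarrow> g (g x) = x"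
    and "\<And>x y. x \<in> S \<Longrightarrow> y \<in> S \<Longrightarrow> ip (g x) (g y) = ip x y"
  shows "g \<in> form_autos S ip"
  by (rule form_autos_inverse_pair[where g' = g]) (use assms in auto)

text \<open>A common description of the rank one idempotents of a simple Euclidean Jordan algebra:
  \<open>ip\<close> is the trace form, \<open>C i\<close> are closed geodesics through the base point whose initial
  directions form an orthonormal frame of the tangent space, and \<open>D i\<close> are the coordinates in that
  frame. Spheres have \<open>kap = card I\<close>, projective spaces over an algebra of real dimension \<open>k\<close>
  have \<open>kap = k\<close>.\<close>

locale two_point =
  fixes S :: "'q set" and ip :: "'q \<Rightarrow> 'q \<Rightarrow> real" and kap :: real and p0 :: 'q
    and I :: "'i set" and i0 :: 'i and C :: "'i \<Rightarrow> real \<Rightarrow> 'q" and D :: "'i \<Rightarrow> 'q \<Rightarrow> real"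
    and J :: "'j set" and h :: "'j \<Rightarrow> 'q \<Rightarrow> real"
  assumes fin_I: "finite I" and i0: "i0 \<in> I" and fin_J: "finite J" and kap_pos: "kap > 0"
    and ip_sym: "x \<in> S \<Longrightarrow> y \<in> S \<Longrightarrow> ip x y = ip y x"
    and C_in: "i \<in> I \<Longrightarrow> C i t \<in> S"
    and C_0: "i \<in> I \<Longrightarrow> C i 0 = p0"
    and ip_CC: "i \<in> I \<Longrightarrow> ip (C i s) (C i t) = (1 + cos (s - t)) / 2"
    and ip_C: "i \<in> I \<Longrightarrow> V \<in> S \<Longrightarrow> ip (C i t) V = (ip p0 V + ip (C i pi) V) / 2
        + cos t * ((ip p0 V - ip (C i pi) V) / 2) + sin t * D i V"
    and sum_D: "V \<in> S \<Longrightarrow> (\<Sum>i\<in>I. (D i V)\<^sup>2) = ip p0 V * (1 - ip p0 V)"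
    and sum_C: "V \<in> S \<Longrightarrow> (\<Sum>i\<in>I. ip (C i pi) V) = kap * (1 - ip p0 V)"
    and hom: "x \<in> S \<Longrightarrow> y \<in> S \<Longrightarrow> \<exists>g\<in>form_autos S ip. \<exists>t\<in>{0..pi}. g x = p0 \<and> g y = C i0 t"
    and finite_rank: "x \<in> S \<Longrightarrow> y \<in> S \<Longrightarrow> ip x y = (\<Sum>j\<in>J. h j x * h j y)"
    and h_measurable: "j \<in> J \<Longrightarrow> space N = S \<Longrightarrow> (\<And>e. e \<in> S \<Longrightarrow> ip e \<in> borel_measurable N) \<Longrightarrow> h j \<in> borel_measurable N"
begin

lemma p0_in: "p0 \<in> S" using C_in[OF i0, of 0] C_0[OF i0] by simp

lemma ip_p0_C: "i \<in> I \<Longrightarrow> ip p0 (C i t) = (1 + cos t) / 2"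
  using ip_CC[of i 0 t] C_0[of i] by simp

lemma ip_p0_p0: "ip p0 p0 = 1" using ip_p0_C[OF i0, of 0] C_0[OF i0] by simp

lemma ip_via_hom:
  assumes "x \<in> S" "y \<in> S" "g \<in> form_autos S ip" "g x = p0" "g y = C i0 t"
  shows "ip x y = (1 + cos t) / 2"
  using form_autos_ip[OF assms(3,1,2)] ip_p0_C[OF i0, of t] assms(4,5) by simp

lemma ip_range:
  assumes "x \<in> S" "y \<in> S" shows "ip x y \<in> {0..1}"
proof -
  obtain g t where g: "g \<in> form_autos S ip" "g x = p0" "g y = C i0 t"
    using hom[OF assms] by auto
  then have "ip x y = (1 + cos t) / 2" by (rule ip_via_hom[OF assms])
  moreover have "0 \<le> (1 + cos t) / 2" "(1 + cos t) / 2 \<le> 1"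
    using cos_ge_minus_one[of t] cos_le_one[of t] by argo+
  ultimately show ?thesis by (simp only: atLeastAtMost_iff)
qed

text \<open>Both pairs are brought to the normal form. Equal form values give equal cosines, hence
  equal angles in [0, pi], and one map is followed by the inverse of the other.\<close>

lemma two_point_homogeneous:
  assumes S: "x \<in> S" "y \<in> S" "x' \<in> S" "y' \<in> S" and eq: "ip x y = ip x' y'"
  shows "\<exists>g\<in>form_autos S ip. g x = x' \<and> g y = y'"
proof -
  obtain g t where g: "g \<in> form_autos S ip" and t: "t \<in> {0..pi}" and gx: "g x = p0" and gy: "g y = C i0 t"
    using hom[OF S(1,2)] by blast
  obtain g' t' where g': "g' \<in> form_autos S ip" and t': "t' \<in> {0..pi}" and gx': "g' x' = p0" and gy': "g' y' = C i0 t'"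
    using hom[OF S(3,4)] by blast
  have "(1 + cos t) / 2 = (1 + cos t') / 2"
    using eq unfolding ip_via_hom[OF S(1,2) g gx gy] ip_via_hom[OF S(3,4) g' gx' gy'] .
  then have "cos t = cos t'" by simp
  then have "t = t'" by (rule cos_inj_pi[rotated 4]) (use t t' in simp_all)
  have inj: "inj_on g' S" using g' by (simp add: form_autos_def bij_betw_def)
  let ?k = "inv_into S g' \<circ> g"
  show ?thesis
  proof (rule bexI[of _ ?k], rule conjI)
    show "?k \<in> form_autos S ip" by (rule form_autos_comp[OF form_autos_inv[OF g'] g])
    show "?k x = x'" unfolding comp_apply gx by (rule inv_into_f_eq[OF inj S(3) gx'])
    show "?k y = y'" unfolding comp_apply gy \<open>t = t'\<close> by (rule inv_into_f_eq[OF inj S(4) gy'])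
  qed
qed

text \<open>Expresses the coordinate by values of the form, from which its boundedness and
  measurability follow.\<close>

lemma D_eq: "i \<in> I \<Longrightarrow> V \<in> S \<Longrightarrow> D i V = ip (C i (pi / 2)) V - (ip p0 V + ip (C i pi) V) / 2"
  using ip_C[of i V "pi / 2"] by simp

end

text \<open>Even and odd parts (in the sine) of \<open>(s + r * cos t + d * sin t) ^ n\<close>, as polynomials in
  \<open>cos t\<close>.\<close>

fun cos_parts :: "real \<Rightarrow> real \<Rightarrow> real \<Rightarrow> nat \<Rightarrow> real poly \<times> real poly" where
  "cos_parts s r d 0 = (1, 0)"
| "cos_parts s r d (Suc n) = (case cos_parts s r d n of (w, w') \<Rightarrow>
     (smult s w + pCons 0 (smult r w) + smult d (w' - pCons 0 (pCons 0 w')),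
      smult s w' + pCons 0 (smult r w') + smult d w))"

lemma poly_cos_parts:
  "(s + r * cos t + d * sin t) ^ n
     = poly (fst (cos_parts s r d n)) (cos t) + sin t * poly (snd (cos_parts s r d n)) (cos t)"
proof (induction n)
  case (Suc n)
  obtain w w' where w: "cos_parts s r d n = (w, w')" by force
  have sq: "sin t * sin t = 1 - cos t * cos t"
    using sin_squared_eq[of t] by (simp add: power2_eq_square)
  have "(s + r * cos t + d * sin t) ^ Suc n = (s + r * cos t) * (poly w (cos t) + sin t * poly w' (cos t))
      + d * sin t * poly w (cos t) + d * (sin t * sin t) * poly w' (cos t)"
    using Suc w by (simp add: algebra_simps)
  then show ?case unfolding sq by (simp add: w algebra_simps)
qed simp

lemma degree_cos_parts: "degree (fst (cos_parts s r d n)) \<le> n"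
proof -
  \<comment> \<open>The second component needs the sharper bound, degree below n: the factor 1 -
    cos^2 raises its degree by two when it enters the even part.\<close>
  have "(\<forall>i>n. coeff (fst (cos_parts s r d n)) i = 0) \<and> (\<forall>i\<ge>n. coeff (snd (cos_parts s r d n)) i = 0)"
  proof (induction n)
    case (Suc n)
    then show ?case
      by (auto simp: coeff_pCons split: prod.splits nat.splits)
  qed simp
  then show ?thesis by (intro degree_le) auto
qed

lemma poly_altdef':
  fixes x :: "'a :: comm_semiring_1"
  assumes "degree p \<le> n" shows "poly p x = (\<Sum>i\<le>n. coeff p i * x ^ i)"
proof -
  have "poly p x = poly (\<Sum>i\<le>n. monom (coeff p i) i) x" by (simp add: poly_as_sum_of_monoms'[OF assms])
  then show ?thesis by (simp add: poly_sum poly_monom)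
qed

section \<open>Averaging operators of an invariant law\<close>

locale two_point_prob = two_point S ip kap p0 I i0 C D J h + prob_space \<mu>
  for S :: "'q set" and ip :: "'q \<Rightarrow> 'q \<Rightarrow> real" and kap :: real and p0 :: 'q
    and I :: "'i set" and i0 :: 'i and C :: "'i \<Rightarrow> real \<Rightarrow> 'q" and D :: "'i \<Rightarrow> 'q \<Rightarrow> real"
    and J :: "'j set" and h :: "'j \<Rightarrow> 'q \<Rightarrow> real" and \<mu> :: "'q measure" +
  assumes space_mu: "space \<mu> = S"
    and ip_measurable: "x \<in> S \<Longrightarrow> ip x \<in> borel_measurable \<mu>"
    and auto_measurable: "g \<in> form_autos S ip \<Longrightarrow> g \<in> measurable \<mu> \<mu>"
    and auto_distr: "g \<in> form_autos S ip \<Longrightarrow> distr \<mu> \<mu> g = \<mu>"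
begin

text \<open>Boundedness makes the class closed under products too, so integrability of every
  expression below is structural.\<close>

definition bm :: "('q \<Rightarrow> real) \<Rightarrow> bool" where
  "bm f \<longleftrightarrow> f \<in> borel_measurable \<mu> \<and> (\<exists>K. \<forall>V\<in>S. \<bar>f V\<bar> \<le> K)"

lemma bm_integrable: "bm f \<Longrightarrow> integrable \<mu> f"
  unfolding bm_def by (auto intro!: integrable_const_bound AE_I2 simp: space_mu)

lemma bm_measurable: "bm f \<Longrightarrow> f \<in> borel_measurable \<mu>"
  by (simp add: bm_def)

lemma bm_const: "bm (\<lambda>_. c)" unfolding bm_def by auto

lemma bm_add: assumes "bm f" "bm g" shows "bm (\<lambda>V. f V + g V)"
proof -
  obtain K L where "\<forall>V\<in>S. \<bar>f V\<bar> \<le> K" "\<forall>V\<in>S. \<bar>g V\<bar> \<le> L" using assms by (auto simp: bm_def)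
  then have "\<forall>V\<in>S. \<bar>f V + g V\<bar> \<le> K + L" by (auto intro: order_trans[OF abs_triangle_ineq add_mono])
  then show ?thesis using assms unfolding bm_def by auto
qed

lemma bm_mult: assumes "bm f" "bm g" shows "bm (\<lambda>V. f V * g V)"
proof -
  obtain K L where "\<forall>V\<in>S. \<bar>f V\<bar> \<le> K" "\<forall>V\<in>S. \<bar>g V\<bar> \<le> L" using assms by (auto simp: bm_def)
  then have "\<forall>V\<in>S. \<bar>f V * g V\<bar> \<le> K * L"
    unfolding abs_mult by (auto intro!: mult_mono intro: order_trans[OF abs_ge_zero])
  then show ?thesis using assms unfolding bm_def by auto
qed

lemma bm_cmult: "bm f \<Longrightarrow> bm (\<lambda>V. c * f V)" by (rule bm_mult[OF bm_const])
lemma bm_minus: "bm f \<Longrightarrow> bm (\<lambda>V. - f V)"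
  using bm_cmult[of f "-1"] by simp
lemma bm_diff: "bm f \<Longrightarrow> bm g \<Longrightarrow> bm (\<lambda>V. f V - g V)"
  using bm_add[OF _ bm_minus, of f g] by simp
lemma bm_divide: "bm f \<Longrightarrow> bm (\<lambda>V. f V / c)"
  using bm_cmult[of f "1 / c"] by simp
lemma bm_power: "bm f \<Longrightarrow> bm (\<lambda>V. f V ^ n)"
  by (induction n) (auto intro: bm_const bm_mult)
lemma bm_sum: "(\<And>i. i \<in> A \<Longrightarrow> bm (f i)) \<Longrightarrow> bm (\<lambda>V. \<Sum>i\<in>A. f i V)"
  by (induction A rule: infinite_finite_induct) (auto intro: bm_const bm_add)
lemma bm_ip: assumes "x \<in> S" shows "bm (ip x)"
proof -
  have "\<bar>ip x V\<bar> \<le> 1" if "V \<in> S" for V using ip_range[OF assms that] by auto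
  then show ?thesis using ip_measurable[OF assms] unfolding bm_def by auto
qed

lemma bm_poly: "bm f \<Longrightarrow> bm (\<lambda>V. poly q (f V))"
  by (induction q) (auto intro: bm_const bm_mult bm_add)

lemma bm_D: assumes "i \<in> I" shows "bm (D i)"
proof -
  have *: "bm (\<lambda>V. ip (C i (pi / 2)) V - (ip p0 V + ip (C i pi) V) / 2)"
    by (intro bm_diff bm_divide bm_add bm_ip C_in p0_in assms)
  have "D i \<in> borel_measurable \<mu> \<longleftrightarrow> (\<lambda>V. ip (C i (pi / 2)) V - (ip p0 V + ip (C i pi) V) / 2) \<in> borel_measurable \<mu>"
    by (rule measurable_cong) (simp add: space_mu D_eq assms)
  then show ?thesis using * D_eq[OF assms] unfolding bm_def by metis
qed

lemmas bm_intros = bm_const bm_add bm_mult bm_minus bm_diff bm_divide bm_power bm_sum bm_poly bm_ip bm_D p0_in C_in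

lemma integral_invariant:
  assumes g: "g \<in> form_autos S ip" and x: "x \<in> S" "y \<in> S"
  shows "(\<integral>V. poly p (ip (g x) V) * poly q (ip (g y) V) \<partial>\<mu>) = (\<integral>V. poly p (ip x V) * poly q (ip y V) \<partial>\<mu>)"
proof -
  have gS: "g x \<in> S" "g y \<in> S" and ip: "\<And>x y. x \<in> S \<Longrightarrow> y \<in> S \<Longrightarrow> ip (g x) (g y) = ip x y"
    using g x by (auto simp: form_autos_def bij_betw_def)
  have "(\<integral>V. poly p (ip (g x) V) * poly q (ip (g y) V) \<partial>\<mu>)
      = (\<integral>V. poly p (ip (g x) V) * poly q (ip (g y) V) \<partial>(distr \<mu> \<mu> g))"
    by (simp add: auto_distr[OF g])
  also have "\<dots> = (\<integral>V. poly p (ip (g x) (g V)) * poly q (ip (g y) (g V)) \<partial>\<mu>)"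
    by (intro integral_distr auto_measurable g bm_measurable bm_intros gS)
  also have "\<dots> = (\<integral>V. poly p (ip x V) * poly q (ip y V) \<partial>\<mu>)"
    by (intro Bochner_Integration.integral_cong) (auto simp: space_mu ip x)
  finally show ?thesis .
qed

lemma integral_pair_cong:
  assumes "x \<in> S" "y \<in> S" "x' \<in> S" "y' \<in> S" "ip x y = ip x' y'"
  shows "(\<integral>V. poly p (ip x V) * poly q (ip y V) \<partial>\<mu>) = (\<integral>V. poly p (ip x' V) * poly q (ip y' V) \<partial>\<mu>)"
proof -
  obtain g where g: "g \<in> form_autos S ip" "g x = x'" "g y = y'"
    using two_point_homogeneous[OF assms] by blast
  show ?thesis using integral_invariant[OF g(1) assms(1,2), of p q] unfolding g(2,3) by (rule sym)
qed

lemma integral_power_cong: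
  assumes "x \<in> S" "y \<in> S" "x' \<in> S" "y' \<in> S" "ip x y = ip x' y'"
  shows "(\<integral>V. ip x V ^ j * ip y V ^ l \<partial>\<mu>) = (\<integral>V. ip x' V ^ j * ip y' V ^ l \<partial>\<mu>)"
  using integral_pair_cong[OF assms, of "monom 1 j" "monom 1 l"] by (simp add: poly_monom)

lemma bm_cos_parts:
  assumes "bm s" "bm r" "bm d"
  shows "bm (\<lambda>V. coeff (fst (cos_parts (s V) (r V) (d V) n)) i) \<and> bm (\<lambda>V. coeff (snd (cos_parts (s V) (r V) (d V) n)) i)"
proof (induction n arbitrary: i)
  case 0 then show ?case by (simp add: bm_const)
next
  case (Suc n)
  have *: "bm (\<lambda>V. coeff (fst (cos_parts (s V) (r V) (d V) n)) i)" "bm (\<lambda>V. coeff (snd (cos_parts (s V) (r V) (d V) n)) i)" for i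
    using Suc by auto
  show ?case
    unfolding cos_parts.simps case_prod_beta fst_conv snd_conv coeff_add coeff_smult coeff_diff coeff_pCons
    by (cases i; cases "i - 1") (auto intro!: bm_intros * assms)
qed

lemma eq_midpoint: "x = y \<Longrightarrow> x = (x + y) / 2" for x y :: real
  by simp

lemma power_convolution:
  "\<exists>Q. degree Q \<le> j \<and> (\<forall>t. (\<integral>V. poly p (ip p0 V) * ip (C i0 t) V ^ j \<partial>\<mu>) = poly Q (cos t))"
proof -
  define s where "s = (\<lambda>V. (ip p0 V + ip (C i0 pi) V) / 2)"
  define r where "r = (\<lambda>V. (ip p0 V - ip (C i0 pi) V) / 2)"
  define W where "W = (\<lambda>V. fst (cos_parts (s V) (r V) (D i0 V) j))"
  define W' where "W' = (\<lambda>V. snd (cos_parts (s V) (r V) (D i0 V) j))"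
  have bms: "bm s" "bm r" unfolding s_def r_def by (intro bm_intros i0)+
  have bmW: "bm (\<lambda>V. coeff (W V) i)" "bm (\<lambda>V. coeff (W' V) i)" for i
    unfolding W_def W'_def using bm_cos_parts[OF bms bm_D[OF i0]] by auto
  have degW: "degree (W V) \<le> j" for V unfolding W_def by (rule degree_cos_parts)
  have eq: "ip (C i0 t) V ^ j = poly (W V) (cos t) + sin t * poly (W' V) (cos t)" if "V \<in> S" for V t
    unfolding ip_C[OF i0 that, of t] W_def W'_def poly_cos_parts[symmetric] s_def r_def by (simp add: mult.commute)
  define Q where "Q = (\<Sum>i\<le>j. monom (\<integral>V. poly p (ip p0 V) * coeff (W V) i \<partial>\<mu>) i)"
  have "degree Q \<le> j" unfolding Q_def
    by (rule degree_sum_le) (auto intro: order_trans[OF degree_monom_le])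
  moreover have "(\<integral>V. poly p (ip p0 V) * ip (C i0 t) V ^ j \<partial>\<mu>) = poly Q (cos t)" for t
  proof -
    let ?F = "\<lambda>t. (\<integral>V. poly p (ip p0 V) * ip (C i0 t) V ^ j \<partial>\<mu>)"
    \<comment> \<open>\<open>C i0 t\<close> and \<open>C i0 (- t)\<close> have the same form value
      with the base point. Averaging the two integrals removes the part that is odd in the
      sine.\<close>
    have "?F t = ?F (- t)"
      using integral_pair_cong[of p0 "C i0 t" p0 "C i0 (- t)" p "monom 1 j"]
      by (simp add: p0_in C_in i0 ip_p0_C poly_monom)
    then have "?F t = (?F t + ?F (- t)) / 2" by (rule eq_midpoint)
    also have "\<dots> = (\<integral>V. (poly p (ip p0 V) * ip (C i0 t) V ^ j + poly p (ip p0 V) * ip (C i0 (- t)) V ^ j) / 2 \<partial>\<mu>)"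
      by (subst Bochner_Integration.integral_divide_zero, subst Bochner_Integration.integral_add)
         (auto intro!: bm_integrable bm_intros i0)
    also have "\<dots> = (\<integral>V. poly p (ip p0 V) * poly (W V) (cos t) \<partial>\<mu>)"
      by (intro Bochner_Integration.integral_cong) (auto simp: space_mu eq field_simps)
    also have "\<dots> = (\<integral>V. (\<Sum>i\<le>j. poly p (ip p0 V) * coeff (W V) i * cos t ^ i) \<partial>\<mu>)"
      by (intro Bochner_Integration.integral_cong) (auto simp: poly_altdef'[OF degW] sum_distrib_left mult.assoc)
    also have "\<dots> = (\<Sum>i\<le>j. (\<integral>V. poly p (ip p0 V) * coeff (W V) i * cos t ^ i \<partial>\<mu>))"
      by (intro Bochner_Integration.integral_sum) (auto intro!: bm_integrable bm_intros bmW)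
    also have "\<dots> = poly Q (cos t)" unfolding Q_def poly_sum poly_monom by simp
    finally show ?thesis .
  qed
  ultimately show ?thesis by blast
qed

text \<open>The averaging operators do not raise degrees: along a geodesic through the base point the
  average is a trigonometric polynomial, and it is even since it depends on the distance only.\<close>

lemma poly_convolution:
  "\<exists>Q. degree Q \<le> degree q \<and>
     (\<forall>x\<in>S. \<forall>y\<in>S. (\<integral>V. poly p (ip x V) * poly q (ip y V) \<partial>\<mu>) = poly Q (ip x y))"
proof -
  obtain R where R: "\<And>j. degree (R j) \<le> j"
    "\<And>j t. (\<integral>V. poly p (ip p0 V) * ip (C i0 t) V ^ j \<partial>\<mu>) = poly (R j) (cos t)"
    using power_convolution[of _ p] by metis
  \<comment> \<open>\<open>[:-1, 2:]\<close> substitutes cos t = 2 u - 1, where u is the form value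
    (1 + cos t) / 2.\<close>
  define Q where "Q = (\<Sum>j\<le>degree q. smult (coeff q j) (R j)) \<circ>\<^sub>p [:-1, 2:]"
  have "degree Q \<le> degree (\<Sum>j\<le>degree q. smult (coeff q j) (R j))"
    unfolding Q_def by (simp add: degree_pcompose)
  also have "\<dots> \<le> degree q"
    by (rule degree_sum_le) (auto intro: order_trans[OF degree_smult_le] order_trans[OF R(1)])
  finally have "degree Q \<le> degree q" .
  moreover have "(\<integral>V. poly p (ip x V) * poly q (ip y V) \<partial>\<mu>) = poly Q (ip x y)" if xy: "x \<in> S" "y \<in> S" for x y
  proof -
    obtain g t where g: "g \<in> form_autos S ip" "g x = p0" "g y = C i0 t"
      using hom[OF xy] by auto
    have ip: "ip x y = (1 + cos t) / 2" by (rule ip_via_hom[OF xy g])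
    have "(\<integral>V. poly p (ip x V) * poly q (ip y V) \<partial>\<mu>) = (\<integral>V. poly p (ip p0 V) * poly q (ip (C i0 t) V) \<partial>\<mu>)"
      using integral_invariant[OF g(1) xy, of p q] g by simp
    also have "\<dots> = (\<integral>V. (\<Sum>j\<le>degree q. coeff q j * (poly p (ip p0 V) * ip (C i0 t) V ^ j)) \<partial>\<mu>)"
      by (intro Bochner_Integration.integral_cong) (auto simp: poly_altdef sum_distrib_left ac_simps)
    also have "\<dots> = (\<Sum>j\<le>degree q. coeff q j * poly (R j) (cos t))"
      by (subst Bochner_Integration.integral_sum) (auto intro!: bm_integrable bm_intros i0 simp: R(2))
    also have "\<dots> = poly Q (ip x y)"
    proof -
      have "poly [:-1, 2:] ((1 + cos t) / 2) = cos t" by (simp add: field_simps)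
      then show ?thesis unfolding Q_def ip by (simp only: poly_pcompose poly_sum poly_smult)
    qed
    finally show ?thesis .
  qed
  ultimately show ?thesis by blast
qed

text \<open>Self-adjointness of averaging with the kernel p, applied to two functions of the form
  value with the base point.\<close>

lemma integral_swap:
  "(\<integral>V. poly r (ip p0 V) * (\<integral>W. poly q (ip p0 W) * poly p (ip V W) \<partial>\<mu>) \<partial>\<mu>)
   = (\<integral>W. poly q (ip p0 W) * (\<integral>V. poly p (ip W V) * poly r (ip p0 V) \<partial>\<mu>) \<partial>\<mu>)"
proof -
  interpret pair_sigma_finite \<mu> \<mu> ..
  interpret PP: pair_prob_space \<mu> \<mu> ..
  \<comment> \<open>Measurability of each section \<open>ip x\<close> does not give joint
    measurability in (V, W). The expansion into products does, and it agrees with \<open>ip\<close>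
    on S.\<close>
  define f where "f = (\<lambda>V W. poly r (ip p0 V) * poly q (ip p0 W) * poly p (\<Sum>j\<in>J. h j V * h j W))"
  have hm: "h j \<in> borel_measurable \<mu>" if "j \<in> J" for j
    using h_measurable[OF that space_mu] ip_measurable by auto
  have pm: "(\<lambda>x. poly p (f x)) \<in> borel_measurable N" if "f \<in> borel_measurable N" for p :: "real poly" and f and N :: "'z measure"
    by (rule measurable_compose[OF that]) (auto intro!: borel_measurable_continuous_onI continuous_intros)
  have meas: "case_prod f \<in> borel_measurable (\<mu> \<Otimes>\<^sub>M \<mu>)"
    unfolding f_def case_prod_beta
    by (intro borel_measurable_times pm borel_measurable_sum measurable_compose[OF measurable_fst]
         measurable_compose[OF measurable_snd] hm ip_measurable p0_in) auto
  obtain K where K: "\<And>s x. x \<in> {0..1::real} \<Longrightarrow> \<bar>poly (s::real poly) x\<bar> \<le> K s"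
  proof -
    have "\<exists>K. \<forall>x\<in>{0..1::real}. \<bar>poly s x\<bar> \<le> K" for s :: "real poly"
    proof -
      have "compact (poly s ` {0..1})" by (intro compact_continuous_image continuous_intros compact_Icc)
      then show ?thesis by (auto dest!: compact_imp_bounded simp: bounded_iff)
    qed
    then show ?thesis using that by metis
  qed
  have fS: "f V W = poly r (ip p0 V) * poly q (ip p0 W) * poly p (ip V W)" if "V \<in> S" "W \<in> S" for V W
    unfolding f_def finite_rank[OF that] by simp
  have "integrable (\<mu> \<Otimes>\<^sub>M \<mu>) (case_prod f)"
  proof (rule PP.integrable_const_bound[OF _ meas, of "K r * K q * K p"])
    show "AE z in \<mu> \<Otimes>\<^sub>M \<mu>. norm (case_prod f z) \<le> K r * K q * K p"
    proof (rule AE_I2)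
      fix z assume "z \<in> space (\<mu> \<Otimes>\<^sub>M \<mu>)"
      then obtain V W where z: "z = (V, W)" "V \<in> S" "W \<in> S" by (auto simp: space_pair_measure space_mu)
      have "\<bar>poly r (ip p0 V)\<bar> * \<bar>poly q (ip p0 W)\<bar> * \<bar>poly p (ip V W)\<bar> \<le> K r * K q * K p"
        by (intro mult_mono K ip_range p0_in z mult_nonneg_nonneg abs_ge_zero order_trans[OF abs_ge_zero K[OF ip_range[OF p0_in p0_in]]])
      then show "norm (case_prod f z) \<le> K r * K q * K p" using z by (simp add: fS abs_mult)
    qed
  qed
  then have "(\<integral>W. (\<integral>V. f V W \<partial>\<mu>) \<partial>\<mu>) = (\<integral>V. (\<integral>W. f V W \<partial>\<mu>) \<partial>\<mu>)"
    by (rule Fubini_integral)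
  moreover have "(\<integral>V. (\<integral>W. f V W \<partial>\<mu>) \<partial>\<mu>) = (\<integral>V. poly r (ip p0 V) * (\<integral>W. poly q (ip p0 W) * poly p (ip V W) \<partial>\<mu>) \<partial>\<mu>)"
  proof (intro Bochner_Integration.integral_cong refl)
    fix V assume "V \<in> space \<mu>" then have V: "V \<in> S" by (simp add: space_mu)
    have "(\<integral>W. f V W \<partial>\<mu>) = (\<integral>W. poly r (ip p0 V) * (poly q (ip p0 W) * poly p (ip V W)) \<partial>\<mu>)"
      by (intro Bochner_Integration.integral_cong) (auto simp: fS V space_mu)
    then show "(\<integral>W. f V W \<partial>\<mu>) = poly r (ip p0 V) * (\<integral>W. poly q (ip p0 W) * poly p (ip V W) \<partial>\<mu>)" by simp
  qed
  moreover have "(\<integral>W. (\<integral>V. f V W \<partial>\<mu>) \<partial>\<mu>) = (\<integral>W. poly q (ip p0 W) * (\<integral>V. poly p (ip W V) * poly r (ip p0 V) \<partial>\<mu>) \<partial>\<mu>)"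
  proof (intro Bochner_Integration.integral_cong refl)
    fix W assume "W \<in> space \<mu>" then have W: "W \<in> S" by (simp add: space_mu)
    have "(\<integral>V. f V W \<partial>\<mu>) = (\<integral>V. poly q (ip p0 W) * (poly p (ip W V) * poly r (ip p0 V)) \<partial>\<mu>)"
      by (intro Bochner_Integration.integral_cong) (auto simp: fS W space_mu ip_sym)
    then show "(\<integral>V. f V W \<partial>\<mu>) = poly q (ip p0 W) * (\<integral>V. poly p (ip W V) * poly r (ip p0 V) \<partial>\<mu>)" by simp
  qed
  ultimately show ?thesis by simp
qed

section \<open>Moments of the form value with the base point\<close>

abbreviation mom :: "nat \<Rightarrow> real" where "mom j \<equiv> (\<integral>V. ip p0 V ^ j \<partial>\<mu>)"

text \<open>The points \<open>C i pi\<close> all have form value 0 with the base point, so the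
  integral is the same for every i and can be averaged over the frame with
  \<open>sum_C\<close>.\<close>

lemma integral_antipode:
  assumes "i \<in> I"
  shows "card I * (\<integral>V. ip p0 V ^ j * ip (C i pi) V \<partial>\<mu>) = kap * (mom j - mom (Suc j))"
proof -
  have "(\<integral>V. ip p0 V ^ j * ip (C i pi) V \<partial>\<mu>) = (\<integral>V. ip p0 V ^ j * ip (C l pi) V \<partial>\<mu>)" if "l \<in> I" for l
    using integral_power_cong[of p0 "C i pi" p0 "C l pi" j 1] assms that by (simp add: p0_in C_in ip_p0_C)
  then have "(\<Sum>l\<in>I. (\<integral>V. ip p0 V ^ j * ip (C l pi) V \<partial>\<mu>)) = (\<Sum>l\<in>I. (\<integral>V. ip p0 V ^ j * ip (C i pi) V \<partial>\<mu>))"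
    by (intro sum.cong) auto
  then have "card I * (\<integral>V. ip p0 V ^ j * ip (C i pi) V \<partial>\<mu>) = (\<Sum>l\<in>I. (\<integral>V. ip p0 V ^ j * ip (C l pi) V \<partial>\<mu>))"
    by simp
  also have "\<dots> = (\<integral>V. (\<Sum>l\<in>I. ip p0 V ^ j * ip (C l pi) V) \<partial>\<mu>)"
    by (intro Bochner_Integration.integral_sum[symmetric] bm_integrable bm_intros)
  also have "\<dots> = (\<integral>V. kap * (ip p0 V ^ j - ip p0 V ^ Suc j) \<partial>\<mu>)"
    by (intro Bochner_Integration.integral_cong) (auto simp: sum_C space_mu algebra_simps simp flip: sum_distrib_left)
  also have "\<dots> = kap * (mom j - mom (Suc j))"
    by (simp add: bm_integrable bm_intros Bochner_Integration.integral_diff del: power_Suc)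
  finally show ?thesis .
qed

text \<open>Averaging over the frame again, with \<open>sum_D\<close>. Since \<open>D i\<close> is
  not itself a form value, its independence of i needs the expansion \<open>eq\<close>: the square
  of \<open>D l\<close> is the mean of the squared form values at angles pi/2 and -pi/2 minus the
  squared midpoint.\<close>

lemma integral_D_sq:
  assumes "i \<in> I"
  shows "card I * (\<integral>V. ip p0 V ^ j * (D i V)\<^sup>2 \<partial>\<mu>) = mom (Suc j) - mom (Suc (Suc j))"
proof -
  have eq: "(\<integral>V. ip p0 V ^ j * (D l V)\<^sup>2 \<partial>\<mu>)
     = ((\<integral>V. ip p0 V ^ j * ip (C l (pi/2)) V ^ 2 \<partial>\<mu>) + (\<integral>V. ip p0 V ^ j * ip (C l (-pi/2)) V ^ 2 \<partial>\<mu>)) / 2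
       - (mom (j + 2) + 2 * (\<integral>V. ip p0 V ^ (j + 1) * ip (C l pi) V ^ 1 \<partial>\<mu>) + (\<integral>V. ip p0 V ^ j * ip (C l pi) V ^ 2 \<partial>\<mu>)) / 4"
    if l: "l \<in> I" for l
  proof -
    have "(\<integral>V. ip p0 V ^ j * (D l V)\<^sup>2 \<partial>\<mu>)
      = (\<integral>V. (ip p0 V ^ j * ip (C l (pi/2)) V ^ 2 + ip p0 V ^ j * ip (C l (-pi/2)) V ^ 2) / 2
       - (ip p0 V ^ (j + 2) + 2 * (ip p0 V ^ (j + 1) * ip (C l pi) V ^ 1) + ip p0 V ^ j * ip (C l pi) V ^ 2) / 4 \<partial>\<mu>)"
    proof (intro Bochner_Integration.integral_cong refl)
      fix V assume "V \<in> space \<mu>" then have V: "V \<in> S" by (simp add: space_mu)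
      have *: "ip (C l (-pi/2)) V = (ip p0 V + ip (C l pi) V) / 2 - D l V"
        "ip (C l (pi/2)) V = (ip p0 V + ip (C l pi) V) / 2 + D l V"
        using ip_C[OF l V, of "-pi/2"] ip_C[OF l V, of "pi/2"] by simp_all
      show "ip p0 V ^ j * (D l V)\<^sup>2 = (ip p0 V ^ j * ip (C l (pi/2)) V ^ 2 + ip p0 V ^ j * ip (C l (-pi/2)) V ^ 2) / 2
       - (ip p0 V ^ (j + 2) + 2 * (ip p0 V ^ (j + 1) * ip (C l pi) V ^ 1) + ip p0 V ^ j * ip (C l pi) V ^ 2) / 4"
        unfolding * by (simp add: field_simps power2_eq_square)
    qed
    also have "\<dots> = ((\<integral>V. ip p0 V ^ j * ip (C l (pi/2)) V ^ 2 \<partial>\<mu>) + (\<integral>V. ip p0 V ^ j * ip (C l (-pi/2)) V ^ 2 \<partial>\<mu>)) / 2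
       - (mom (j + 2) + 2 * (\<integral>V. ip p0 V ^ (j + 1) * ip (C l pi) V ^ 1 \<partial>\<mu>) + (\<integral>V. ip p0 V ^ j * ip (C l pi) V ^ 2 \<partial>\<mu>)) / 4"
      using l by (subst Bochner_Integration.integral_diff Bochner_Integration.integral_add
          Bochner_Integration.integral_divide_zero Bochner_Integration.integral_mult_right_zero | intro bm_integrable bm_intros | assumption)+ simp
    finally show ?thesis .
  qed
  have "(\<integral>V. ip p0 V ^ j * (D i V)\<^sup>2 \<partial>\<mu>) = (\<integral>V. ip p0 V ^ j * (D l V)\<^sup>2 \<partial>\<mu>)" if l: "l \<in> I" for l
    unfolding eq[OF l] eq[OF assms]
    by (intro arg_cong2[where f = "(-)"] arg_cong2[where f = "(/)"] arg_cong2[where f = "(+)"] arg_cong2[where f = "(*)"] refl integral_power_cong)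
       (use assms l in \<open>auto simp: ip_p0_C p0_in C_in\<close>)
  then have "(\<Sum>l\<in>I. (\<integral>V. ip p0 V ^ j * (D l V)\<^sup>2 \<partial>\<mu>)) = (\<Sum>l\<in>I. (\<integral>V. ip p0 V ^ j * (D i V)\<^sup>2 \<partial>\<mu>))"
    by (intro sum.cong) auto
  then have "card I * (\<integral>V. ip p0 V ^ j * (D i V)\<^sup>2 \<partial>\<mu>) = (\<Sum>l\<in>I. (\<integral>V. ip p0 V ^ j * (D l V)\<^sup>2 \<partial>\<mu>))"
    by simp
  also have "\<dots> = (\<integral>V. (\<Sum>l\<in>I. ip p0 V ^ j * (D l V)\<^sup>2) \<partial>\<mu>)"
    by (intro Bochner_Integration.integral_sum[symmetric] bm_integrable bm_intros)
  also have "\<dots> = (\<integral>V. ip p0 V ^ Suc j - ip p0 V ^ Suc (Suc j) \<partial>\<mu>)"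
    by (intro Bochner_Integration.integral_cong) (auto simp: sum_D space_mu algebra_simps simp flip: sum_distrib_left)
  also have "\<dots> = mom (Suc j) - mom (Suc (Suc j))"
    by (intro Bochner_Integration.integral_diff bm_integrable bm_intros)
  finally show ?thesis .
qed

text \<open>Differentiation under the integral sign at 0: the mean value theorem bounds the
  difference quotients by K, so dominated convergence applies along the steps 1 / (n + 1).\<close>

lemma derivative_integral_zero:
  fixes g g' :: "real \<Rightarrow> 'q \<Rightarrow> real"
  assumes bm: "\<And>t. bm (g t)" "bm (g' 0)" and zero: "\<And>t. (\<integral>V. g t V \<partial>\<mu>) = 0"
    and deriv: "\<And>t V. V \<in> S \<Longrightarrow> ((\<lambda>t. g t V) has_real_derivative g' t V) (at t)"
    and bound: "\<And>t V. V \<in> S \<Longrightarrow> \<bar>g' t V\<bar> \<le> K"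
  shows "(\<integral>V. g' 0 V \<partial>\<mu>) = 0"
proof -
  let ?q = "\<lambda>n V. (g (1 / real (Suc n)) V - g 0 V) / (1 / real (Suc n))"
  have "(\<lambda>n. \<integral>V. ?q n V \<partial>\<mu>) \<longlonglongrightarrow> (\<integral>V. g' 0 V \<partial>\<mu>)"
  proof (rule integral_dominated_convergence[where w = "\<lambda>_. K"])
    show "g' 0 \<in> borel_measurable \<mu>" "\<And>n. ?q n \<in> borel_measurable \<mu>"
      by (intro bm_measurable bm_intros bm)+
    show "AE V in \<mu>. (\<lambda>n. ?q n V) \<longlonglongrightarrow> g' 0 V"
    proof (rule AE_I2)
      fix V assume "V \<in> space \<mu>"
      then have "((\<lambda>t. g t V) has_real_derivative g' 0 V) (at 0)" using deriv by (simp add: space_mu)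
      then have "((\<lambda>t. (g t V - g 0 V) / t) \<longlongrightarrow> g' 0 V) (at 0)" by (simp add: DERIV_def)
      moreover have "filterlim (\<lambda>n. 1 / real (Suc n)) (at 0) sequentially"
        unfolding filterlim_at using LIMSEQ_Suc[OF lim_1_over_n] by auto
      ultimately show "(\<lambda>n. ?q n V) \<longlonglongrightarrow> g' 0 V"
        by (rule filterlim_compose)
    qed
    show "AE V in \<mu>. norm (?q n V) \<le> K" for n
    proof (rule AE_I2)
      fix V assume V: "V \<in> space \<mu>"
      obtain z where "g (1 / real (Suc n)) V - g 0 V = (1 / real (Suc n) - 0) * g' z V"
        using MVT2[of 0 "1 / real (Suc n)" "\<lambda>t. g t V" "\<lambda>t. g' t V"] deriv V by (auto simp: space_mu)
      then have "?q n V = g' z V" by simp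
      then show "norm (?q n V) \<le> K" using bound V by (simp add: space_mu)
    qed
  qed simp
  moreover have "(\<integral>V. ?q n V \<partial>\<mu>) = 0" for n
    by (simp add: bm_integrable bm zero Bochner_Integration.integral_diff del: of_nat_Suc)
  ultimately show ?thesis by (simp add: LIMSEQ_const_iff)
qed

text \<open>The average of \<open>ip (C i0 t) V ^ j\<close> times the derivative of \<open>ip (C i0 t) V\<close> vanishes because
  that derivative is half the difference of the values at two points symmetric about \<open>C i0 t\<close>;
  differentiating once more gives the moment recursion.\<close>

lemma rotation_identity:
  "j * (\<integral>V. ip p0 V ^ (j - 1) * (D i0 V)\<^sup>2 \<partial>\<mu>) = (\<integral>V. ip p0 V ^ j * ((ip p0 V - ip (C i0 pi) V) / 2) \<partial>\<mu>)"
proof -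
  define r where "r = (\<lambda>V. (ip p0 V - ip (C i0 pi) V) / 2)"
  define u where "u = (\<lambda>t V. ip (C i0 t) V)"
  define u' where "u' = (\<lambda>t V. D i0 V * cos t - r V * sin t)"
  define g where "g = (\<lambda>t V. u t V ^ j * u' t V)"
  define g' where "g' = (\<lambda>t V. j * u t V ^ (j - 1) * (u' t V)\<^sup>2 + u t V ^ j * (- D i0 V * sin t - r V * cos t))"
  have bmr: "bm r" unfolding r_def by (intro bm_intros i0)
  have bmu: "bm (u t)" "bm (u' t)" for t unfolding u_def u'_def by (intro bm_intros i0 bmr)+
  have u'_eq: "u' t V = (ip (C i0 (t + pi / 2)) V - ip (C i0 (t - pi / 2)) V) / 2" if "V \<in> S" for t V
    unfolding ip_C[OF i0 that, of "t + pi / 2"] ip_C[OF i0 that, of "t - pi / 2"] u'_def r_def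
    unfolding sin_add cos_add sin_diff cos_diff by (simp add: algebra_simps diff_divide_distrib)
  have range: "0 \<le> ip x V" "ip x V \<le> 1" if "x \<in> S" "V \<in> S" for x V using ip_range[OF that] by auto
  have half: "\<bar>(x - y) / 2\<bar> \<le> 1" if "0 \<le> x" "x \<le> 1" "0 \<le> y" "y \<le> 1" for x y :: real
    unfolding abs_le_iff using that by argo
  have ub: "\<bar>u t V\<bar> \<le> 1" "\<bar>u' t V\<bar> \<le> 1" if "V \<in> S" for t V
    unfolding u'_eq[OF that] u_def using range[OF C_in[OF i0] that] by (simp, intro half)
  have "(\<integral>V. g' 0 V \<partial>\<mu>) = 0"
  proof (rule derivative_integral_zero)
    show "bm (g t)" for t unfolding g_def by (intro bm_intros bmu)
    show "bm (g' 0)" unfolding g'_def by (intro bm_intros bmu bmr i0)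
    show "(\<integral>V. g t V \<partial>\<mu>) = 0" for t
    proof -
      have "(\<integral>V. g t V \<partial>\<mu>) = (\<integral>V. (u t V ^ j * ip (C i0 (t + pi / 2)) V ^ 1 - u t V ^ j * ip (C i0 (t - pi / 2)) V ^ 1) / 2 \<partial>\<mu>)"
        by (intro Bochner_Integration.integral_cong) (auto simp: g_def u'_eq space_mu field_simps)
      also have "\<dots> = ((\<integral>V. u t V ^ j * ip (C i0 (t + pi / 2)) V ^ 1 \<partial>\<mu>) - (\<integral>V. u t V ^ j * ip (C i0 (t - pi / 2)) V ^ 1 \<partial>\<mu>)) / 2"
        by (subst Bochner_Integration.integral_divide_zero, subst Bochner_Integration.integral_diff)
           (intro bm_integrable bm_intros bmu i0 refl)+
      also have "\<dots> = 0"
        unfolding u_def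
        by (subst integral_power_cong[of "C i0 t" "C i0 (t + pi / 2)" "C i0 t" "C i0 (t - pi / 2)"]) (auto simp: C_in i0 ip_CC)
      finally show ?thesis .
    qed
    fix t V assume V: "V \<in> S"
    have du: "((\<lambda>t. u t V) has_real_derivative u' t V) (at t)"
    proof -
      have u: "(\<lambda>t. u t V) = (\<lambda>t. (ip p0 V + ip (C i0 pi) V) / 2 + cos t * r V + sin t * D i0 V)"
        unfolding u_def r_def by (rule ext) (rule ip_C[OF i0 V])
      show ?thesis unfolding u u'_def by (auto intro!: derivative_eq_intros)
    qed
    have du': "((\<lambda>t. u' t V) has_real_derivative - D i0 V * sin t - r V * cos t) (at t)"
      unfolding u'_def by (auto intro!: derivative_eq_intros)
    show "((\<lambda>t. g t V) has_real_derivative g' t V) (at t)"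
      unfolding g_def g'_def
      by (rule DERIV_cong[OF DERIV_mult[OF DERIV_power[OF du, of j] du']])
         (simp add: power2_eq_square mult.commute mult.left_commute)
    \<comment> \<open>The second derivative is the first one shifted by a quarter period, so the
      bound for \<open>u'\<close> covers it.\<close>
    have "\<bar>- D i0 V * sin t - r V * cos t\<bar> = \<bar>u' (t + pi / 2) V\<bar>"
      unfolding u'_def by (simp add: sin_add cos_add)
    then have 1: "\<bar>- D i0 V * sin t - r V * cos t\<bar> \<le> 1" using ub(2)[OF V] by simp
    have 2: "\<bar>u t V ^ n\<bar> \<le> 1" for n using ub(1)[OF V, of t] by (simp add: power_abs power_le_one)
    have 3: "\<bar>(u' t V)\<^sup>2\<bar> \<le> 1" using ub(2)[OF V, of t] by (simp only: power_abs power_le_one abs_ge_zero)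
    have "\<bar>g' t V\<bar> \<le> \<bar>real j * u t V ^ (j - 1) * (u' t V)\<^sup>2\<bar> + \<bar>u t V ^ j * (- D i0 V * sin t - r V * cos t)\<bar>"
      unfolding g'_def by (rule abs_triangle_ineq)
    also have "\<dots> \<le> real j * 1 * 1 + 1 * 1"
      unfolding abs_mult by (intro add_mono mult_mono 1 2 3) auto
    finally show "\<bar>g' t V\<bar> \<le> real j * 1 * 1 + 1 * 1" .
  qed
  moreover have "(\<integral>V. g' 0 V \<partial>\<mu>) = (\<integral>V. j * (ip p0 V ^ (j - 1) * (D i0 V)\<^sup>2) - ip p0 V ^ j * r V \<partial>\<mu>)"
    by (intro Bochner_Integration.integral_cong) (auto simp: g'_def u_def u'_def C_0[OF i0])
  moreover have "\<dots> = j * (\<integral>V. ip p0 V ^ (j - 1) * (D i0 V)\<^sup>2 \<partial>\<mu>) - (\<integral>V. ip p0 V ^ j * r V \<partial>\<mu>)"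
    by (subst Bochner_Integration.integral_diff) (auto intro!: bm_integrable bm_intros i0 bmr)
  ultimately show ?thesis by (simp add: r_def)
qed

lemma card_I: "real (card I) > 0" using fin_I i0 by (auto simp: card_gt_0_iff)

text \<open>Both sides of the rotation identity are replaced by their averages over the frame, after
  multiplication by \<open>card I\<close>.\<close>

lemma moment_recursion: "(2 * real j + kap) * (mom j - mom (Suc j)) = card I * mom (Suc j)"
proof -
  have 1: "card I * (\<integral>V. ip p0 V ^ j * ip (C i0 pi) V \<partial>\<mu>) = kap * (mom j - mom (Suc j))"
    by (rule integral_antipode[OF i0])
  have "(\<integral>V. ip p0 V ^ j * ((ip p0 V - ip (C i0 pi) V) / 2) \<partial>\<mu>)
      = (\<integral>V. (ip p0 V ^ Suc j - ip p0 V ^ j * ip (C i0 pi) V) / 2 \<partial>\<mu>)"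
    by (intro Bochner_Integration.integral_cong) (auto simp: field_simps)
  also have "\<dots> = (mom (Suc j) - (\<integral>V. ip p0 V ^ j * ip (C i0 pi) V \<partial>\<mu>)) / 2"
    by (subst Bochner_Integration.integral_divide_zero, subst Bochner_Integration.integral_diff)
       (intro bm_integrable bm_intros i0 refl)+
  finally have 2: "real j * (\<integral>V. ip p0 V ^ (j - 1) * (D i0 V)\<^sup>2 \<partial>\<mu>) = (mom (Suc j) - (\<integral>V. ip p0 V ^ j * ip (C i0 pi) V \<partial>\<mu>)) / 2"
    using rotation_identity[of j] by simp
  \<comment> \<open>At j = 0 the truncated exponent j - 1 is harmless because of the factor
    j.\<close>
  have 3: "real j * (card I * (\<integral>V. ip p0 V ^ (j - 1) * (D i0 V)\<^sup>2 \<partial>\<mu>)) = real j * (mom j - mom (Suc j))"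
    using integral_D_sq[OF i0, of "j - 1"] by (cases j) auto
  have "(2 * real j + kap) * (m - m') = c * m'"
    if "c * q = kap * (m - m')" "real j * d = (m' - q) / 2" "real j * (c * d) = real j * (m - m')" for q m m' d c
  proof -
    have "2 * (real j * (c * d)) = c * (2 * (real j * d))" by simp
    also have "\<dots> = c * m' - c * q" unfolding that(2) by (simp add: right_diff_distrib)
    finally have "2 * (real j * (m - m')) = c * m' - kap * (m - m')" unfolding that(1,3) .
    then show ?thesis by (simp add: algebra_simps)
  qed
  from this[OF 1 2 3] show ?thesis .
qed

text \<open>The recursion has the moments of the Beta law with parameters kap/2 and
  \<open>card I\<close>/2 as its solution.\<close>

lemma moment: "mom j = pochhammer (kap / 2) j / pochhammer (card I / 2 + kap / 2) j"
proof (induction j)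
  case 0 then show ?case by (simp add: prob_space)
next
  case (Suc j)
  have pos: "card I / 2 + kap / 2 + real j > 0" using kap_pos card_I by simp
  have "y = (kap / 2 + real j) * x / (card I / 2 + kap / 2 + real j)"
    if "(2 * real j + kap) * (x - y) = card I * y" for x y :: real
    using that pos by (simp add: field_simps)
  then have "mom (Suc j) = (kap / 2 + real j) * mom j / (card I / 2 + kap / 2 + real j)"
    using moment_recursion by blast
  then show ?case unfolding Suc pochhammer_Suc by (simp only: times_divide_times_eq times_divide_eq_right mult.commute divide_divide_eq_left)
qed

section \<open>The reproducing property of Jacobi polynomials\<close>

definition avg :: "real poly \<Rightarrow> real" where "avg p = (\<integral>V. poly p (ip p0 V) \<partial>\<mu>)"

lemma bm_poly_p0: "bm (\<lambda>V. poly p (ip p0 V))"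
  by (rule bm_poly[OF bm_ip[OF p0_in]])

lemma avg_add: "avg (p + q) = avg p + avg q"
  unfolding avg_def poly_add by (rule Bochner_Integration.integral_add) (rule bm_integrable bm_poly_p0)+

lemma avg_smult: "avg (smult c p) = c * avg p"
  unfolding avg_def by simp

lemma avg_monom: "avg (monom 1 j) = pochhammer (kap / 2) j / pochhammer (card I / 2 + kap / 2) j"
  unfolding avg_def moment[symmetric] by (simp add: poly_monom)

lemma half_pos: "real (card I) / 2 > 0" "kap / 2 > 0"
  using card_I kap_pos by auto

sublocale beta_functional avg "card I / 2" "kap / 2"
  by (rule beta_functional.intro) (rule avg_add avg_smult avg_monom half_pos)+

theorem jacobi_reproducing:
  assumes dim: "card I + kap > 2" and xy: "x \<in> S" "y \<in> S"
  shows "(\<integral>V. poly (JP n) (ip x V) * poly (JP n) (ip y V) \<partial>\<mu>)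
    = poly (JP n) (ip x y) / (jacobi_a (card I / 2 - 1) (kap / 2 - 1) n)\<^sup>2"
proof -
  obtain F where F: "degree F \<le> degree (JP n)"
      "\<And>x y. x \<in> S \<Longrightarrow> y \<in> S \<Longrightarrow> (\<integral>V. poly (JP n) (ip x V) * poly (JP n) (ip y V) \<partial>\<mu>) = poly F (ip x y)"
    using poly_convolution[of "JP n" "JP n"] by blast
  have "F = smult (1 / (jacobi_a (card I / 2 - 1) (kap / 2 - 1) n)\<^sup>2) (JP n)"
  proof (rule reproducing)
    show "card I / 2 + kap / 2 > 1" using dim by simp
    show "degree F \<le> n" using F(1) degree_jacobi_poly order_trans by blast
    show "poly F 1 = avg (JP n * JP n)"
      using F(2)[OF p0_in p0_in] by (simp add: avg_def ip_p0_p0)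
    fix j assume j: "j < n"
    \<comment> \<open>Averaging u^j against P_n gives a polynomial Q of degree at most j < n, to
      which P_n is orthogonal. Self-adjointness carries this over to F paired with u^j.\<close>
    obtain Q where Q: "degree Q \<le> degree (monom (1::real) j)"
      "\<And>x y. x \<in> S \<Longrightarrow> y \<in> S \<Longrightarrow> (\<integral>V. poly (JP n) (ip x V) * poly (monom 1 j) (ip y V) \<partial>\<mu>) = poly Q (ip x y)"
      using poly_convolution[of "monom 1 j" "JP n"] by blast
    then have degQ: "degree Q < n" using j by (simp add: degree_monom_eq)
    have "avg (F * monom 1 j) = (\<integral>V. poly (monom 1 j) (ip p0 V) * (\<integral>W. poly (JP n) (ip p0 W) * poly (JP n) (ip V W) \<partial>\<mu>) \<partial>\<mu>)"
      unfolding avg_def by (intro Bochner_Integration.integral_cong) (auto simp: F(2) p0_in space_mu)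
    also have "\<dots> = (\<integral>W. poly (JP n) (ip p0 W) * (\<integral>V. poly (JP n) (ip W V) * poly (monom 1 j) (ip p0 V) \<partial>\<mu>) \<partial>\<mu>)"
      by (rule integral_swap)
    also have "\<dots> = avg (JP n * Q)"
      unfolding avg_def by (intro Bochner_Integration.integral_cong) (auto simp: Q(2) p0_in space_mu ip_sym)
    also have "\<dots> = 0"
      using E_jacobi_mult[of Q n] degQ by (simp add: coeff_eq_0)
    finally show "avg (F * monom 1 j) = 0" .
  qed
  then show ?thesis using F(2)[OF xy] by simp
qed

end

section \<open>Octonions\<close>

lemma oplus_eq: "oplus x y = x + y"
  by (simp add: oplus_def qplus_def plus_prod_def)

lemma ozero_eq: "ozero = 0"
  by (simp add: ozero_def qzero_def zero_prod_def)

lemmas oct_defs = omult_def oconj_def oone_def qmult_def qconj_def qplus_def qminus_def qzero_def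

lemma ore_inner: "ore x = x \<bullet> oone"
  by (simp add: ore_def oone_def qzero_def inner_prod_def inner_complex_def)

lemma omult_add_left: "omult (x + y) z = omult x z + omult y z"
  by (simp add: oct_defs plus_prod_def algebra_simps)

lemma omult_add_right: "omult z (x + y) = omult z x + omult z y"
  by (simp add: oct_defs plus_prod_def algebra_simps)

lemma omult_scaleR_left: "omult (r *\<^sub>R x) z = r *\<^sub>R omult x z"
  by (simp add: oct_defs scaleR_prod_def algebra_simps)

lemma omult_scaleR_right: "omult z (r *\<^sub>R x) = r *\<^sub>R omult z x"
  by (simp add: oct_defs scaleR_prod_def algebra_simps)

lemma omult_zero [simp]: "omult 0 x = 0" "omult x 0 = 0"
  by (simp_all add: oct_defs zero_prod_def)

lemma omult_sum_left: "omult (sum f A) z = (\<Sum>i\<in>A. omult (f i) z)"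
  by (induction A rule: infinite_finite_induct) (auto simp: omult_add_left)

lemma omult_sum_right: "omult z (sum f A) = (\<Sum>i\<in>A. omult z (f i))"
  by (induction A rule: infinite_finite_induct) (auto simp: omult_add_right)

lemma omult_one [simp]: "omult oone x = x" "omult x oone = x"
  by (simp_all add: oct_defs)

lemma oconj_add: "oconj (x + y) = oconj x + oconj y"
  by (simp add: oct_defs plus_prod_def)

lemma oconj_scaleR: "oconj (r *\<^sub>R x) = r *\<^sub>R oconj x"
  by (simp add: oct_defs scaleR_prod_def)

lemma oconj_zero [simp]: "oconj 0 = 0"
  by (simp add: oct_defs zero_prod_def)

lemma oconj_one [simp]: "oconj oone = oone"
  by (simp add: oct_defs)

lemma oconj_sum: "oconj (sum f A) = (\<Sum>i\<in>A. oconj (f i))"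
  by (induction A rule: infinite_finite_induct) (auto simp: oconj_add)

lemma oconj_oconj [simp]: "oconj (oconj x) = x"
  by (simp add: oct_defs)

lemma oconj_omult: "oconj (omult x y) = omult (oconj y) (oconj x)"
  by (simp add: oct_defs algebra_simps)

lemma inner_omult: "x \<bullet> y = ore (omult x (oconj y))"
  by (simp add: oct_defs ore_def inner_prod_def inner_complex_def)

lemma inner_oconj: "oconj x \<bullet> oconj y = x \<bullet> y"
  by (simp add: oct_defs inner_prod_def inner_complex_def)

lemma inner_omult_adjoint_right: "x \<bullet> omult y z = omult x (oconj z) \<bullet> y"
  by (simp add: oct_defs inner_prod_def inner_complex_def algebra_simps)

lemma omult_oconj_self: "omult x (oconj x) = (x \<bullet> x) *\<^sub>R oone"
  by (simp add: oct_defs scaleR_prod_def inner_prod_def complex_eq_iff inner_complex_def algebra_simps)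

lemma omult_oconj_self': "omult (oconj x) x = (x \<bullet> x) *\<^sub>R oone"
  using omult_oconj_self[of "oconj x"] by (simp add: inner_oconj)

text \<open>Only two elements and a conjugate occur, so alternativity is enough where associativity
  fails.\<close>

lemma omult_cancel_left: "omult u (omult (oconj u) x) = (u \<bullet> u) *\<^sub>R x"
  by (simp add: oct_defs scaleR_prod_def inner_prod_def complex_eq_iff inner_complex_def algebra_simps)

lemma omult_cancel_right: "omult (omult x u) (oconj u) = (u \<bullet> u) *\<^sub>R x"
  by (simp add: oct_defs scaleR_prod_def inner_prod_def complex_eq_iff inner_complex_def algebra_simps)

text \<open>Together with the next two, the substitute for associativity when one factor is
  repeated; they allow a unit and its conjugate to cancel across a product of three.\<close>

lemma left_moufang: "omult (omult (omult u a) u) y = omult u (omult a (omult u y))"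
  by (simp add: oct_defs algebra_simps)

lemma right_moufang: "omult y (omult (omult u a) u) = omult (omult (omult y u) a) u"
  by (simp add: oct_defs algebra_simps)

lemma middle_moufang: "omult (omult u x) (omult y u) = omult (omult u (omult x y)) u"
  by (simp add: oct_defs algebra_simps)

lemma omult_flexible: "omult (omult u a) u = omult u (omult a u)"
  by (simp add: oct_defs algebra_simps)

text \<open>A vanishing second component means lying in the quaternions, which contain the models of
  R and C as well.\<close>

lemma quaternion_assoc:
  assumes "snd x = 0" "snd y = 0" "snd z = 0"
  shows "omult (omult x y) z = omult x (omult y z)"
  using assms by (cases x; cases y; cases z) (simp add: oct_defs zero_prod_def algebra_simps)

section \<open>Projective spaces\<close>

lemma inner_omult_adjoint_left: "x \<bullet> omult y z = omult (oconj y) x \<bullet> z"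
  by (simp add: oct_defs inner_prod_def inner_complex_def algebra_simps)

text \<open>The polarised norm law of a composition algebra; for a unit u, multiplication by u is
  orthogonal.\<close>

lemma inner_omult_left: "omult u x \<bullet> omult u y = (u \<bullet> u) * (x \<bullet> y)"
  using omult_cancel_left[of "oconj u" x] by (simp add: inner_omult_adjoint_left inner_oconj)

lemma inner_omult_right: "omult x u \<bullet> omult y u = (u \<bullet> u) * (x \<bullet> y)"
  using omult_cancel_right[of x u] by (simp add: inner_omult_adjoint_right)

lemma oconj_self_real: "oconj x = x \<Longrightarrow> x = ore x *\<^sub>R oone"
  by (cases x) (auto simp: oct_defs ore_def scaleR_prod_def complex_eq_iff zero_prod_def)

lemma oone_inner [simp]: "oone \<bullet> oone = 1"
  by (simp add: oct_defs inner_prod_def inner_complex_def)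

lemma omult_scaleR_one [simp]: "omult (r *\<^sub>R oone) x = r *\<^sub>R x" "omult x (r *\<^sub>R oone) = r *\<^sub>R x"
  by (simp_all add: omult_scaleR_left omult_scaleR_right)

lemma in_alg_zero: "in_alg k 0"
  by (simp add: in_alg_def qzero_def zero_prod_def)

lemma in_alg_oone: "in_alg k oone"
  by (simp add: in_alg_def oct_defs zero_prod_def)

lemma in_alg_add: "in_alg k x \<Longrightarrow> in_alg k y \<Longrightarrow> in_alg k (x + y)"
  by (auto simp: in_alg_def qzero_def plus_prod_def split: if_splits)

lemma in_alg_scaleR: "in_alg k x \<Longrightarrow> in_alg k (r *\<^sub>R x)"
  by (auto simp: in_alg_def qzero_def scaleR_prod_def split: if_splits)

lemma in_alg_sum: "(\<And>i. i \<in> A \<Longrightarrow> in_alg k (f i)) \<Longrightarrow> in_alg k (sum f A)"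
  by (induction A rule: infinite_finite_induct) (auto simp: in_alg_zero in_alg_add)

lemma in_alg_oconj: "in_alg k x \<Longrightarrow> in_alg k (oconj x)"
  by (auto simp: in_alg_def oct_defs split: if_splits)

lemma in_alg_omult: "in_alg k x \<Longrightarrow> in_alg k y \<Longrightarrow> in_alg k (omult x y)"
  by (auto simp: in_alg_def oct_defs split: if_splits)

lemma in_alg_quaternion: "k \<in> {1, 2, 4} \<Longrightarrow> in_alg k x \<Longrightarrow> snd x = 0"
  by (auto simp: in_alg_def qzero_def zero_prod_def split: if_splits)

section \<open>Hermitian idempotents of trace one\<close>

definition mm :: "nat \<Rightarrow> (nat \<Rightarrow> nat \<Rightarrow> oct) \<Rightarrow> (nat \<Rightarrow> nat \<Rightarrow> oct) \<Rightarrow> nat \<Rightarrow> nat \<Rightarrow> oct" where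
  "mm N X Y = (\<lambda>i j. \<Sum>l<N. omult (X i l) (Y l j))"

definition supported :: "nat \<Rightarrow> (nat \<Rightarrow> nat \<Rightarrow> oct) \<Rightarrow> bool" where
  "supported N X \<longleftrightarrow> (\<forall>i j. i \<ge> N \<or> j \<ge> N \<longrightarrow> X i j = 0)"

definition pip :: "nat \<Rightarrow> (nat \<Rightarrow> nat \<Rightarrow> oct) \<Rightarrow> (nat \<Rightarrow> nat \<Rightarrow> oct) \<Rightarrow> real" where
  "pip N X Y = (\<Sum>i<N. \<Sum>j<N. X i j \<bullet> Y i j)"

definition vvT :: "nat \<Rightarrow> (nat \<Rightarrow> real) \<Rightarrow> nat \<Rightarrow> nat \<Rightarrow> oct" where
  "vvT N v = (\<lambda>i j. if i < N \<and> j < N then (v i * v j) *\<^sub>R oone else 0)"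

lemma omat_mult_eq: "supported N X \<Longrightarrow> supported N Y \<Longrightarrow> omat_mult N X Y = mm N X Y"
proof -
  assume S: "supported N X" "supported N Y"
  have "foldr (\<lambda>l acc. oplus (f l) acc) xs ozero = sum_list (map f xs)" for f :: "nat \<Rightarrow> oct" and xs
    by (induction xs) (auto simp: oplus_eq ozero_eq)
  then have *: "foldr (\<lambda>l acc. oplus (f l) acc) [0..<N] ozero = sum f {..<N}" for f
    by (simp add: interv_sum_list_conv_sum_set_nat atLeast0LessThan)
  show ?thesis
    unfolding omat_mult_def mm_def *
    using S by (intro ext) (auto simp: supported_def ozero_eq intro!: sum.neutral)
qed

lemma proj_set_iff: "X \<in> proj_set k N \<longleftrightarrow> supported N X \<and> (\<forall>i j. in_alg k (X i j))
    \<and> (\<forall>i j. X j i = oconj (X i j)) \<and> mm N X X = X \<and> (\<Sum>i<N. ore (X i i)) = 1"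
proof -
  have cong: "(A \<Longrightarrow> D = D') \<Longrightarrow> (A \<and> B \<and> C \<and> D \<and> E) = (A \<and> B \<and> C \<and> D' \<and> E)" for A B C D D' E by auto
  show ?thesis
    unfolding proj_set_def mem_Collect_eq ozero_eq supported_def[symmetric]
    by (rule cong) (simp only: omat_mult_eq)
qed

lemma pip_sym: "pip N X Y = pip N Y X"
  by (simp add: pip_def inner_commute)

context
  fixes X k N assumes X: "X \<in> proj_set k N"
begin

lemma proj_supported: "supported N X" and proj_in_alg: "in_alg k (X i j)"
  and proj_herm: "X j i = oconj (X i j)" and proj_idem: "mm N X X = X"
  and proj_trace: "(\<Sum>i<N. ore (X i i)) = 1"
proof -
  note D = proj_set_iff[THEN iffD1, OF X]
  show "supported N X" by (rule D[THEN conjunct1])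
  show "in_alg k (X i j)" by (rule D[THEN conjunct2, THEN conjunct1, rule_format])
  show "X j i = oconj (X i j)" by (rule D[THEN conjunct2, THEN conjunct2, THEN conjunct1, rule_format])
  show "mm N X X = X" by (rule D[THEN conjunct2, THEN conjunct2, THEN conjunct2, THEN conjunct1])
  show "(\<Sum>i<N. ore (X i i)) = 1" by (rule D[THEN conjunct2, THEN conjunct2, THEN conjunct2, THEN conjunct2])
qed

lemma proj_diag: "X i i = ore (X i i) *\<^sub>R oone"
  by (rule oconj_self_real) (rule proj_herm[symmetric])

text \<open>This is the diagonal of X X = X, where hermiticity turns each product into a squared
  norm.\<close>

lemma proj_row: "(\<Sum>l<N. X i l \<bullet> X i l) = ore (X i i)"
proof -
  have "X i i = (\<Sum>l<N. omult (X i l) (X l i))" using proj_idem by (metis mm_def)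
  also have "\<dots> = (\<Sum>l<N. X i l \<bullet> X i l) *\<^sub>R oone"
    unfolding scaleR_sum_left
  proof (rule sum.cong[OF refl])
    fix l show "omult (X i l) (X l i) = (X i l \<bullet> X i l) *\<^sub>R oone"
      unfolding proj_herm[of l i] by (rule omult_oconj_self)
  qed
  finally show ?thesis by (metis inner_scaleR_left mult.right_neutral oone_inner ore_inner)
qed

lemma proj_col: "(\<Sum>l<N. X l i \<bullet> X l i) = ore (X i i)"
proof -
  have "X l i \<bullet> X l i = X i l \<bullet> X i l" for l unfolding proj_herm[of l i] inner_oconj ..
  then show ?thesis using proj_row by simp
qed

lemma proj_diag_nonneg: "ore (X i i) \<ge> 0"
  unfolding proj_row[symmetric] by (intro sum_nonneg) simp

text \<open>The difference of both sides, divided by \<open>ore (X i i)\<close>, has squared norm \<open>1 + 1 - 2\<close>.\<close>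

lemma proj_rank_one:
  assumes "i < N" "a < N" "b < N"
  shows "ore (X i i) *\<^sub>R X a b = omult (X a i) (X i b)"
proof (cases "ore (X i i) = 0")
  case True
  then have "X a i \<bullet> X a i = 0"
    using proj_col[of i] assms by (auto simp: sum_nonneg_eq_0_iff)
  then show ?thesis using True by simp
next
  case False
  define r where "r = ore (X i i)"
  have r: "r \<noteq> 0" using False by (simp add: r_def)
  define Q where "Q = (\<lambda>a b. omult (X a i) (X i b))"
  have XX: "(\<Sum>a<N. \<Sum>b<N. X a b \<bullet> X a b) = 1" unfolding proj_row by (rule proj_trace)
  have QQ: "(\<Sum>a<N. \<Sum>b<N. Q a b \<bullet> Q a b) = r * r"
    unfolding Q_def inner_omult_left sum_distrib_left[symmetric] proj_row sum_distrib_right[symmetric] proj_col r_def ..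
  \<comment> \<open>Moving the right factor of Q across the inner product turns the sum over b into
    an entry of X X; no associativity is involved.\<close>
  have "(\<Sum>b<N. X a b \<bullet> Q a b) = X a i \<bullet> X a i" for a
  proof -
    have "(\<Sum>b<N. X a b \<bullet> Q a b) = (\<Sum>b<N. omult (X a b) (X b i) \<bullet> X a i)"
      unfolding Q_def inner_omult_adjoint_right by (simp add: proj_herm[of i])
    also have "\<dots> = mm N X X a i \<bullet> X a i" by (simp add: mm_def inner_sum_left)
    finally show ?thesis by (simp add: proj_idem)
  qed
  then have XQ: "(\<Sum>a<N. \<Sum>b<N. X a b \<bullet> Q a b) = r" by (simp add: proj_col r_def)
  have "(\<Sum>a<N. \<Sum>b<N. (r *\<^sub>R X a b - Q a b) \<bullet> (r *\<^sub>R X a b - Q a b))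
     = (\<Sum>a<N. \<Sum>b<N. r * r * (X a b \<bullet> X a b) + Q a b \<bullet> Q a b - 2 * r * (X a b \<bullet> Q a b))"
    by (intro sum.cong refl) (simp add: inner_diff_left inner_diff_right inner_commute)
  also have "\<dots> = r * r * 1 + r * r - 2 * r * r"
    unfolding sum_subtractf sum.distrib sum_distrib_left[symmetric] XX QQ XQ ..
  finally have "(\<Sum>a<N. \<Sum>b<N. (r *\<^sub>R X a b - Q a b) \<bullet> (r *\<^sub>R X a b - Q a b)) = 0" by simp
  then have "(r *\<^sub>R X a b - Q a b) \<bullet> (r *\<^sub>R X a b - Q a b) = 0"
    using assms by (simp add: sum_nonneg_eq_0_iff sum_nonneg)
  then show ?thesis by (simp add: r_def Q_def)
qed

text \<open>The principal 2 by 2 minors vanish: this is the rank one relation with pivot a, read at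
  the diagonal entry b.\<close>

lemma proj_entry_norm:
  assumes "a < N" "b < N" shows "X a b \<bullet> X a b = ore (X a a) * ore (X b b)"
proof -
  have "ore (X a a) *\<^sub>R X b b = omult (X b a) (X a b)" by (rule proj_rank_one) (use assms in auto)
  also have "\<dots> = (X a b \<bullet> X a b) *\<^sub>R oone"
    unfolding proj_herm[of b a] by (rule omult_oconj_self')
  finally have "(ore (X a a) *\<^sub>R X b b) \<bullet> oone = X a b \<bullet> X a b" by simp
  then show ?thesis by (simp add: ore_inner)
qed

lemma proj_diag_pos_ex: "\<exists>i<N. ore (X i i) > 0"
proof (rule ccontr)
  assume "\<not> ?thesis"
  then have "(\<Sum>i<N. ore (X i i)) \<le> 0" by (intro sum_nonpos) (meson lessThan_iff linorder_not_le)
  then show False using proj_trace by simp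
qed

end

lemma proj_dist_eq: "Y \<in> proj_set k N \<Longrightarrow> proj_dist N X Y = arccos (2 * pip N X Y - 1)"
proof -
  assume Y: "Y \<in> proj_set k N"
  have "ore (omult (X i j) (Y j i)) = X i j \<bullet> Y i j" for i j
    unfolding inner_omult by (rule arg_cong[OF proj_herm[OF Y]])
  then show ?thesis unfolding proj_dist_def pip_def by simp
qed

section \<open>Conjugation by real reflections\<close>

definition lmul :: "nat \<Rightarrow> (nat \<Rightarrow> nat \<Rightarrow> real) \<Rightarrow> (nat \<Rightarrow> nat \<Rightarrow> oct) \<Rightarrow> nat \<Rightarrow> nat \<Rightarrow> oct" where
  "lmul N A X = (\<lambda>i j. \<Sum>p<N. A i p *\<^sub>R X p j)"

definition rmul :: "nat \<Rightarrow> (nat \<Rightarrow> nat \<Rightarrow> oct) \<Rightarrow> (nat \<Rightarrow> nat \<Rightarrow> real) \<Rightarrow> nat \<Rightarrow> nat \<Rightarrow> oct" where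
  "rmul N X A = (\<lambda>i j. \<Sum>q<N. A q j *\<^sub>R X i q)"

text \<open>Real entries commute and associate with everything, so A X A is unambiguous over the
  octonions too.\<close>

definition rconj :: "nat \<Rightarrow> (nat \<Rightarrow> nat \<Rightarrow> real) \<Rightarrow> (nat \<Rightarrow> nat \<Rightarrow> oct) \<Rightarrow> nat \<Rightarrow> nat \<Rightarrow> oct" where
  "rconj N A X = lmul N A (rmul N X A)"

text \<open>Symmetric orthogonal matrices are their own inverses and transposes, which makes the
  conjugation an involution. Reflections of this kind are all that the normal forms require.\<close>

definition sym_involution :: "nat \<Rightarrow> (nat \<Rightarrow> nat \<Rightarrow> real) \<Rightarrow> bool" where
  "sym_involution N A \<longleftrightarrow> (\<forall>i j. A i j = A j i) \<and> (\<forall>i j. i \<ge> N \<longrightarrow> A i j = 0)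
     \<and> (\<forall>i<N. \<forall>j<N. (\<Sum>l<N. A i l * A l j) = (if i = j then 1 else 0))"

lemma lmul_rmul: "lmul N A (rmul N X B) = rmul N (lmul N A X) B"
  unfolding lmul_def rmul_def scaleR_sum_right
  by (intro ext, subst sum.swap) (simp add: mult.commute)

lemma mm_lmul: "mm N (lmul N A X) Y = lmul N A (mm N X Y)"
  unfolding mm_def lmul_def omult_sum_left omult_scaleR_left scaleR_sum_right
  by (intro ext, rule sum.swap)

lemma mm_rmul: "mm N X (rmul N Y A) = rmul N (mm N X Y) A"
  unfolding mm_def rmul_def omult_sum_right omult_scaleR_right scaleR_sum_right
  by (intro ext, rule sum.swap)

lemma mm_middle: "mm N (rmul N X A) Y = mm N X (lmul N A Y)"
  unfolding mm_def rmul_def lmul_def omult_sum_right omult_scaleR_right omult_sum_left omult_scaleR_left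
  by (intro ext, rule sum.swap)

lemma pip_lmul: "(\<And>i j. A i j = A j i) \<Longrightarrow> pip N (lmul N A X) Y = pip N X (lmul N A Y)"
proof -
  assume sym: "\<And>i j. A i j = A j i"
  have "pip N (lmul N A X) Y = (\<Sum>i<N. \<Sum>j<N. \<Sum>p<N. A i p * (X p j \<bullet> Y i j))"
    by (simp add: pip_def lmul_def inner_sum_left)
  also have "\<dots> = (\<Sum>i<N. \<Sum>p<N. \<Sum>j<N. A i p * (X p j \<bullet> Y i j))"
    by (intro sum.cong refl sum.swap)
  also have "\<dots> = (\<Sum>p<N. \<Sum>i<N. \<Sum>j<N. A i p * (X p j \<bullet> Y i j))"
    by (rule sum.swap)
  also have "\<dots> = (\<Sum>p<N. \<Sum>j<N. \<Sum>i<N. A i p * (X p j \<bullet> Y i j))"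
    by (intro sum.cong refl sum.swap)
  also have "\<dots> = pip N X (lmul N A Y)"
    unfolding pip_def lmul_def inner_sum_right inner_scaleR_right by (intro sum.cong refl) (metis sym)
  finally show ?thesis .
qed

lemma pip_rmul: "(\<And>i j. A i j = A j i) \<Longrightarrow> pip N (rmul N X A) Y = pip N X (rmul N Y A)"
proof -
  assume sym: "\<And>i j. A i j = A j i"
  have "pip N (rmul N X A) Y = (\<Sum>i<N. \<Sum>j<N. \<Sum>q<N. A q j * (X i q \<bullet> Y i j))"
    by (simp add: pip_def rmul_def inner_sum_left)
  also have "\<dots> = (\<Sum>i<N. \<Sum>q<N. \<Sum>j<N. A q j * (X i q \<bullet> Y i j))"
    by (intro sum.cong refl sum.swap)
  also have "\<dots> = pip N X (rmul N Y A)"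
    unfolding pip_def rmul_def inner_sum_right inner_scaleR_right by (intro sum.cong refl) (metis sym)
  finally show ?thesis .
qed

text \<open>Writes the trace as a form value with the identity matrix, so that invariance of the
  form implies invariance of the trace.\<close>

lemma pip_identity: "(\<Sum>i<N. ore (X i i)) = pip N X (\<lambda>i j. if i = j \<and> i < N then oone else 0)"
proof -
  have "(\<Sum>j<N. X i j \<bullet> (if i = j \<and> i < N then oone else 0)) = (\<Sum>j<N. if i = j then ore (X i i) else 0)" if "i < N" for i
    by (intro sum.cong refl) (use that in \<open>auto simp: ore_inner\<close>)
  then show ?thesis unfolding pip_def by simp
qed

context
  fixes N A assumes A: "sym_involution N A"
begin

lemma A_sym: "A i j = A j i" and A_zero: "i \<ge> N \<Longrightarrow> A i j = 0" and A_zero': "j \<ge> N \<Longrightarrow> A i j = 0"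
  and A_sq: "i < N \<Longrightarrow> j < N \<Longrightarrow> (\<Sum>l<N. A i l * A l j) = (if i = j then 1 else 0)"
  using A unfolding sym_involution_def by metis+

lemma lmul_lmul: assumes "supported N X" shows "lmul N A (lmul N A X) = X"
proof (intro ext)
  fix i j
  have "lmul N A (lmul N A X) i j = (\<Sum>q<N. (\<Sum>p<N. A i p * A p q) *\<^sub>R X q j)"
    unfolding lmul_def scaleR_sum_right scaleR_sum_left by (subst sum.swap) simp
  also have "\<dots> = X i j"
  proof (cases "i < N")
    case True
    then have "(\<Sum>q<N. (\<Sum>p<N. A i p * A p q) *\<^sub>R X q j) = (\<Sum>q<N. if q = i then X i j else 0)"
      by (intro sum.cong refl) (auto simp: A_sq)
    then show ?thesis using True by simp
  next
    case False then show ?thesis using assms by (simp add: A_zero supported_def)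
  qed
  finally show "lmul N A (lmul N A X) i j = X i j" .
qed

lemma rmul_rmul: assumes "supported N X" shows "rmul N (rmul N X A) A = X"
proof (intro ext)
  fix i j
  have "rmul N (rmul N X A) A i j = (\<Sum>q<N. (\<Sum>p<N. A q p * A p j) *\<^sub>R X i q)"
    unfolding rmul_def scaleR_sum_right scaleR_sum_left by (subst sum.swap) (simp add: mult.commute)
  also have "\<dots> = X i j"
  proof (cases "j < N")
    case True
    then have "(\<Sum>q<N. (\<Sum>p<N. A q p * A p j) *\<^sub>R X i q) = (\<Sum>q<N. if q = j then X i j else 0)"
      by (intro sum.cong refl) (auto simp: A_sq)
    then show ?thesis using True by simp
  next
    case False then show ?thesis using assms by (simp add: A_zero' supported_def)
  qed
  finally show "rmul N (rmul N X A) A i j = X i j" .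
qed

lemma supported_lmul: "supported N X \<Longrightarrow> supported N (lmul N A X)"
  unfolding supported_def lmul_def by (auto simp: A_zero)

lemma supported_rmul: "supported N X \<Longrightarrow> supported N (rmul N X A)"
  unfolding supported_def rmul_def by (auto simp: A_zero')

lemma rconj_rconj: "supported N X \<Longrightarrow> rconj N A (rconj N A X) = X"
  unfolding rconj_def by (simp add: lmul_rmul[symmetric] lmul_lmul rmul_rmul supported_rmul)

lemma pip_rconj: "supported N X \<Longrightarrow> supported N Y \<Longrightarrow> pip N (rconj N A X) (rconj N A Y) = pip N X Y"
  unfolding rconj_def
  by (simp add: pip_lmul[OF A_sym] lmul_lmul supported_rmul pip_rmul[OF A_sym] rmul_rmul)

lemma rconj_vvT: "rconj N A (vvT N v) = vvT N (\<lambda>i. \<Sum>p<N. A i p * v p)"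
proof (intro ext)
  fix i j
  have "rconj N A (vvT N v) i j = (\<Sum>p<N. \<Sum>q<N. (A i p * v p * (A j q * v q)) *\<^sub>R oone)"
    unfolding rconj_def lmul_def rmul_def scaleR_sum_right vvT_def
    by (intro sum.cong refl) (auto simp: A_sym[of _ j])
  also have "\<dots> = ((\<Sum>p<N. A i p * v p) * (\<Sum>q<N. A j q * v q)) *\<^sub>R oone"
    by (simp add: sum_product scaleR_sum_left)
  also have "\<dots> = vvT N (\<lambda>i. \<Sum>p<N. A i p * v p) i j"
    by (auto simp: vvT_def A_zero)
  finally show "rconj N A (vvT N v) i j = vvT N (\<lambda>i. \<Sum>p<N. A i p * v p) i j" .
qed

lemma rconj_proj_set:
  assumes X: "X \<in> proj_set k N" shows "rconj N A X \<in> proj_set k N"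
proof -
  note s = proj_supported[OF X]
  let ?I = "\<lambda>i j. if i = j \<and> i < N then oone else 0"
  have sI: "supported N ?I" by (auto simp: supported_def)
  have rI: "rconj N A ?I = ?I"
  proof (intro ext)
    fix i j
    have "rmul N ?I A p j = A p j *\<^sub>R oone" for p
    proof -
      have "rmul N ?I A p j = (\<Sum>q<N. if q = p then A p j *\<^sub>R oone else 0)"
        unfolding rmul_def by (intro sum.cong refl) auto
      then show ?thesis by (auto simp: A_zero)
    qed
    then have "rconj N A ?I i j = (\<Sum>p<N. A i p * A p j) *\<^sub>R oone"
      unfolding rconj_def lmul_def by (simp add: scaleR_sum_left)
    then show "rconj N A ?I i j = ?I i j"
      using A_sq[of i j] by (cases "i < N"; cases "j < N") (auto simp: A_zero A_zero')
  qed
  show ?thesis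
    unfolding proj_set_iff
  proof (intro conjI allI)
    show "supported N (rconj N A X)" unfolding rconj_def by (intro supported_lmul supported_rmul s)
    show "in_alg k (rconj N A X i j)" for i j
      unfolding rconj_def lmul_def rmul_def by (intro in_alg_sum in_alg_scaleR proj_in_alg[OF X])
    show "rconj N A X j i = oconj (rconj N A X i j)" for i j
    proof -
      have "rconj N A X j i = (\<Sum>p<N. \<Sum>q<N. (A j p * A q i) *\<^sub>R X p q)"
        unfolding rconj_def lmul_def rmul_def by (simp add: scaleR_sum_right)
      also have "\<dots> = (\<Sum>q<N. \<Sum>p<N. (A j p * A q i) *\<^sub>R X p q)" by (rule sum.swap)
      also have "\<dots> = (\<Sum>q<N. \<Sum>p<N. oconj ((A i q * A p j) *\<^sub>R X q p))"
        unfolding oconj_scaleR proj_herm[OF X, symmetric]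
        by (intro sum.cong refl) (simp add: A_sym[of i] A_sym[of j] mult.commute)
      also have "\<dots> = oconj (rconj N A X i j)"
        unfolding rconj_def lmul_def rmul_def by (simp add: scaleR_sum_right oconj_sum)
      finally show ?thesis .
    qed
    \<comment> \<open>The product is regrouped as A ((X A) (A X)) A, where the two inner factors A
      cancel and idempotence leaves X.\<close>
    have "mm N (rconj N A X) (rconj N A X) = mm N (lmul N A (rmul N X A)) (rmul N (lmul N A X) A)"
      unfolding rconj_def lmul_rmul ..
    also have "\<dots> = lmul N A (rmul N (mm N (rmul N X A) (lmul N A X)) A)"
      by (simp only: mm_lmul mm_rmul) (rule lmul_rmul[symmetric])
    also have "mm N (rmul N X A) (lmul N A X) = X"
      unfolding mm_middle lmul_lmul[OF s] by (rule proj_idem[OF X])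
    finally show "mm N (rconj N A X) (rconj N A X) = rconj N A X" by (simp add: rconj_def)
    show "(\<Sum>i<N. ore (rconj N A X i i)) = 1"
      using pip_rconj[OF s sI] unfolding rI pip_identity[symmetric] proj_trace[OF X] .
  qed
qed

lemma rconj_auto: "rconj N A \<in> form_autos (proj_set k N) (pip N)"
  by (rule form_autos_involution) (auto intro: rconj_proj_set rconj_rconj pip_rconj proj_supported)

end

text \<open>The reflection in the hyperplane orthogonal to x - y exchanges two vectors of equal
  length and fixes whatever is orthogonal to both.\<close>

lemma householder:
  assumes "(\<Sum>i<N. (x i)\<^sup>2) = (\<Sum>i<N. (y i)\<^sup>2)"
  shows "\<exists>A. sym_involution N A \<and> (\<forall>i<N. (\<Sum>p<N. A i p * x p) = y i)
     \<and> (\<forall>z. (\<Sum>p<N. z p * x p) = 0 \<longrightarrow> (\<Sum>p<N. z p * y p) = 0 \<longrightarrow> (\<forall>i<N. (\<Sum>p<N. A i p * z p) = z i))"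
proof -
  define w where "w = (\<lambda>i. x i - y i)"
  define n where "n = (\<Sum>i<N. (w i)\<^sup>2)"
  \<comment> \<open>If x and y agree below N then n = 0, the quotient is 0 by convention, and A is
    the identity on the block.\<close>
  define A where "A = (\<lambda>i j. if i < N \<and> j < N then (if i = j then 1 else 0) - 2 * w i * w j / n else 0)"
  have Az: "(\<Sum>p<N. A i p * z p) = z i - 2 * w i * (\<Sum>p<N. w p * z p) / n" if "i < N" for i z
  proof -
    have "(\<Sum>p<N. A i p * z p) = (\<Sum>p<N. (if p = i then z i else 0) - (2 * w i / n) * (w p * z p))"
      by (intro sum.cong refl) (use that in \<open>auto simp: A_def algebra_simps\<close>)
    also have "\<dots> = z i - (2 * w i / n) * (\<Sum>p<N. w p * z p)"
      using that by (simp add: sum_subtractf sum_distrib_left)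
    finally show ?thesis by simp
  qed
  have "sym_involution N A"
    unfolding sym_involution_def
  proof (intro conjI allI impI)
    fix i j assume ij: "i < N" "j < N"
    have "(\<Sum>p<N. w p * A p j) = w j - 2 * w j * n / n"
    proof -
      have "(\<Sum>p<N. w p * A p j) = (\<Sum>p<N. A j p * w p)"
        by (intro sum.cong refl) (auto simp: A_def)
      then show ?thesis using Az[OF ij(2), of w] by (simp add: n_def power2_eq_square)
    qed
    then have "(\<Sum>l<N. A i l * A l j) = A i j - 2 * w i * (w j - 2 * w j * n / n) / n"
      using Az[OF ij(1), of "\<lambda>l. A l j"] by simp
    also have "\<dots> = (if i = j then 1 else 0)"
      using ij by (cases "n = 0") (auto simp: A_def field_simps)
    finally show "(\<Sum>l<N. A i l * A l j) = (if i = j then 1 else 0)" .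
  qed (auto simp: A_def)
  moreover have "(\<Sum>p<N. A i p * x p) = y i" if i: "i < N" for i
  proof (cases "n = 0")
    case True
    then have "w i = 0" using i by (simp add: n_def sum_nonneg_eq_0_iff)
    then show ?thesis using Az[OF i, of x] by (simp add: w_def)
  next
    case False
    have "n = (\<Sum>i<N. (x i)\<^sup>2) + (\<Sum>i<N. (y i)\<^sup>2) - 2 * (\<Sum>i<N. x i * y i)"
      unfolding n_def w_def by (simp add: power2_diff sum.distrib sum_subtractf sum_distrib_left mult.assoc)
    also have "\<dots> = 2 * (\<Sum>p<N. w p * x p)"
      using assms unfolding w_def by (simp add: algebra_simps sum_subtractf power2_eq_square)
    finally have "(\<Sum>p<N. w p * x p) = n / 2" by simp
    then have "(\<Sum>p<N. A i p * x p) = x i - w i" using Az[OF i, of x] False by (simp only:) simp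
    then show ?thesis by (simp add: w_def)
  qed
  moreover have "(\<Sum>p<N. A i p * z p) = z i"
    if "(\<Sum>p<N. z p * x p) = 0" "(\<Sum>p<N. z p * y p) = 0" "i < N" for i z
  proof -
    have "(\<Sum>p<N. w p * z p) = (\<Sum>p<N. z p * x p) - (\<Sum>p<N. z p * y p)"
      unfolding w_def sum_subtractf[symmetric] by (intro sum.cong refl) (simp add: algebra_simps)
    then show ?thesis using Az[OF that(3), of z] that by simp
  qed
  ultimately show ?thesis by blast
qed

section \<open>Phase changes over the associative algebras\<close>

definition base_point :: "nat \<Rightarrow> nat \<Rightarrow> nat \<Rightarrow> oct" where
  "base_point N = vvT N (\<lambda>i. if i = 0 then 1 else 0)"

text \<open>The half angle gives the form value cos(t/2)^2 = (1 + cos t) / 2 with the base point,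
  and period 2 pi, because v and -v define the same idempotent.\<close>

definition real_circle :: "nat \<Rightarrow> real \<Rightarrow> nat \<Rightarrow> nat \<Rightarrow> oct" where
  "real_circle N t = vvT N (\<lambda>i. if i = 0 then cos (t / 2) else if i = 1 then sin (t / 2) else 0)"

text \<open>The value at 0 is an arbitrary unit, so that a phase exists even where an entry
  vanishes.\<close>

definition unit_of :: "oct \<Rightarrow> oct" where
  "unit_of x = (if x = 0 then oone else (1 / sqrt (x \<bullet> x)) *\<^sub>R x)"

lemma unit_of_inner: "unit_of x \<bullet> unit_of x = 1"
  by (simp add: unit_of_def)

lemma in_alg_unit_of: "in_alg k x \<Longrightarrow> in_alg k (unit_of x)"
  by (simp add: unit_of_def in_alg_oone in_alg_scaleR)

lemma omult_unit_of_oconj: "omult x (oconj (unit_of x)) = sqrt (x \<bullet> x) *\<^sub>R oone"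
proof (cases "x = 0")
  case False
  then have "(x \<bullet> x) / sqrt (x \<bullet> x) = sqrt (x \<bullet> x)" by (simp add: real_div_sqrt)
  then show ?thesis using False by (simp add: unit_of_def oconj_scaleR omult_scaleR_right omult_oconj_self)
qed simp

definition phase_conj :: "(nat \<Rightarrow> oct) \<Rightarrow> (nat \<Rightarrow> nat \<Rightarrow> oct) \<Rightarrow> nat \<Rightarrow> nat \<Rightarrow> oct" where
  "phase_conj u X = (\<lambda>i j. omult (omult (u i) (X i j)) (oconj (u j)))"

context
  fixes k :: nat assumes k: "k \<in> {1, 2, 4}"
begin

lemma alg_assoc: "in_alg k x \<Longrightarrow> in_alg k y \<Longrightarrow> in_alg k z \<Longrightarrow> omult (omult x y) z = omult x (omult y z)"
  by (rule quaternion_assoc) (rule in_alg_quaternion[OF k]; assumption)+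

lemma phase_conj_in:
  assumes u: "\<And>i. in_alg k (u i)" "\<And>i. u i \<bullet> u i = 1" and X: "X \<in> proj_set k N"
  shows "phase_conj u X \<in> proj_set k N"
  unfolding proj_set_iff
proof (intro conjI allI)
  note uc = in_alg_oconj[OF u(1)] and XA = proj_in_alg[OF X]
  show "supported N (phase_conj u X)"
    using proj_supported[OF X] by (auto simp: supported_def phase_conj_def)
  show "in_alg k (phase_conj u X i j)" for i j
    unfolding phase_conj_def by (intro in_alg_omult uc u XA)
  show "phase_conj u X j i = oconj (phase_conj u X i j)" for i j
    unfolding phase_conj_def oconj_omult oconj_oconj proj_herm[OF X, symmetric]
    by (rule alg_assoc[OF u(1) XA uc])
  have prod_entry: "omult (phase_conj u X i l) (phase_conj u X l j) = omult (omult (u i) (omult (X i l) (X l j))) (oconj (u j))" for i j l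
  proof -
    have "omult (phase_conj u X i l) (phase_conj u X l j)
        = omult (omult (omult (u i) (X i l)) (oconj (u l))) (omult (u l) (omult (X l j) (oconj (u j))))"
      unfolding phase_conj_def by (simp only: alg_assoc[OF u(1) XA uc])
    also have "\<dots> = omult (omult (u i) (X i l)) (omult (oconj (u l)) (omult (u l) (omult (X l j) (oconj (u j)))))"
      by (intro alg_assoc in_alg_omult uc u XA)
    also have "\<dots> = omult (omult (u i) (X i l)) (omult (X l j) (oconj (u j)))"
      using omult_cancel_left[of "oconj (u l)"] by (simp add: inner_oconj u)
    also have "\<dots> = omult (omult (omult (u i) (X i l)) (X l j)) (oconj (u j))"
      by (rule alg_assoc[symmetric]) (intro in_alg_omult uc u XA)+
    also have "omult (omult (u i) (X i l)) (X l j) = omult (u i) (omult (X i l) (X l j))"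
      by (rule alg_assoc[OF u(1) XA XA])
    finally show ?thesis .
  qed
  show "mm N (phase_conj u X) (phase_conj u X) = phase_conj u X"
  proof (intro ext)
    fix i j
    have "mm N (phase_conj u X) (phase_conj u X) i j = omult (omult (u i) (mm N X X i j)) (oconj (u j))"
      unfolding mm_def prod_entry omult_sum_left omult_sum_right ..
    then show "mm N (phase_conj u X) (phase_conj u X) i j = phase_conj u X i j"
      unfolding proj_idem[OF X] phase_conj_def .
  qed
  have "phase_conj u X i i = X i i" for i
    unfolding phase_conj_def by (subst (1 2) proj_diag[OF X]) (simp add: omult_scaleR_left omult_oconj_self u)
  then show "(\<Sum>i<N. ore (phase_conj u X i i)) = 1" using proj_trace[OF X] by simp
qed

lemma phase_conj_inverse:
  assumes u: "\<And>i. in_alg k (u i)" "\<And>i. u i \<bullet> u i = 1" and X: "X \<in> proj_set k N"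
  shows "phase_conj (\<lambda>i. oconj (u i)) (phase_conj u X) = X"
proof (intro ext)
  fix i j
  note uc = in_alg_oconj[OF u(1)] and XA = proj_in_alg[OF X]
  have "omult (oconj (u i)) (omult (omult (u i) (X i j)) (oconj (u j))) = omult (X i j) (oconj (u j))"
    using omult_cancel_left[of "oconj (u i)"] by (simp add: alg_assoc[OF u(1) XA uc] inner_oconj u)
  then show "phase_conj (\<lambda>i. oconj (u i)) (phase_conj u X) i j = X i j"
    using omult_cancel_right[of "X i j" "oconj (u j)"] by (simp add: phase_conj_def inner_oconj u)
qed

lemma phase_conj_auto:
  assumes u: "\<And>i. in_alg k (u i)" "\<And>i. u i \<bullet> u i = 1"
  shows "phase_conj u \<in> form_autos (proj_set k N) (pip N)"
proof (rule form_autos_inverse_pair[where g' = "phase_conj (\<lambda>i. oconj (u i))"])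
  have uc: "in_alg k (oconj (u i))" "oconj (u i) \<bullet> oconj (u i) = 1" for i
    using u by (auto simp: in_alg_oconj inner_oconj)
  show "phase_conj u X \<in> proj_set k N" "phase_conj (\<lambda>i. oconj (u i)) X \<in> proj_set k N"
    "phase_conj (\<lambda>i. oconj (u i)) (phase_conj u X) = X" "phase_conj u (phase_conj (\<lambda>i. oconj (u i)) X) = X"
    if "X \<in> proj_set k N" for X
    using phase_conj_in[of u, OF u that] phase_conj_in[of "\<lambda>i. oconj (u i)", OF uc that]
      phase_conj_inverse[of u, OF u that] phase_conj_inverse[of "\<lambda>i. oconj (u i)", OF uc that] by simp_all
  show "pip N (phase_conj u X) (phase_conj u Y) = pip N X Y" for X Y
    unfolding pip_def phase_conj_def inner_omult_left inner_omult_right inner_oconj u by simp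
qed

text \<open>The phases are read off from the column of a pivot i with positive diagonal entry. Once
  that column is real, the rank one relation makes every entry real and nonnegative.\<close>

lemma phase_normal_form:
  assumes Y: "Y \<in> proj_set k N" and N: "N > 0"
  shows "\<exists>g\<in>form_autos (proj_set k N) (pip N). g (base_point N) = base_point N \<and>
    (\<forall>a<N. \<forall>b<N. g Y a b = (sqrt (ore (Y a a)) * sqrt (ore (Y b b))) *\<^sub>R oone)"
proof -
  obtain i where i: "i < N" "ore (Y i i) > 0" using proj_diag_pos_ex[OF Y] by blast
  define r where "r = ore (Y i i)"
  define u where "u = (\<lambda>a. oconj (unit_of (Y a i)))"
  have u: "in_alg k (u a)" "u a \<bullet> u a = 1" for a
    unfolding u_def by (simp_all add: in_alg_oconj in_alg_unit_of proj_in_alg[OF Y] inner_oconj unit_of_inner)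
  note uc = in_alg_oconj[OF u(1)] and YA = proj_in_alg[OF Y]
  have right: "omult (Y i b) (oconj (u b)) = sqrt (ore (Y b b) * r) *\<^sub>R oone" if "b < N" for b
  proof -
    have "unit_of (oconj x) = oconj (unit_of x)" for x
      using oconj_oconj[of x] by (auto simp: unit_of_def oconj_scaleR inner_oconj simp del: oconj_oconj) 
    then have "oconj (u b) = oconj (unit_of (Y i b))" by (simp add: u_def proj_herm[OF Y, of b i])
    then show ?thesis
      using omult_unit_of_oconj[of "Y i b"] proj_entry_norm[OF Y i(1) that] by (simp add: r_def mult.commute)
  qed
  have left: "omult (u a) (Y a i) = sqrt (ore (Y a a) * r) *\<^sub>R oone" if "a < N" for a
  proof -
    have "omult (u a) (Y a i) = oconj (omult (Y i a) (oconj (u a)))"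
      by (simp add: oconj_omult proj_herm[OF Y, of i a])
    then show ?thesis by (simp add: right[OF that] oconj_scaleR)
  qed
  have "phase_conj u Y a b = (sqrt (ore (Y a a)) * sqrt (ore (Y b b))) *\<^sub>R oone" if ab: "a < N" "b < N" for a b
  proof -
    \<comment> \<open>Multiplication by r replaces the entry by a product of an entry of column i
      and one of row i, each of which one phase makes real.\<close>
    have "r *\<^sub>R phase_conj u Y a b = omult (omult (u a) (omult (Y a i) (Y i b))) (oconj (u b))"
      unfolding phase_conj_def proj_rank_one[OF Y i(1) ab, symmetric] r_def by (simp add: omult_scaleR_left omult_scaleR_right)
    also have "omult (u a) (omult (Y a i) (Y i b)) = omult (omult (u a) (Y a i)) (Y i b)"
      by (rule alg_assoc[OF u(1) YA YA, symmetric])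
    also have "omult (omult (omult (u a) (Y a i)) (Y i b)) (oconj (u b)) = (sqrt (ore (Y a a) * r) * sqrt (ore (Y b b) * r)) *\<^sub>R oone"
      unfolding left[OF ab(1)] by (simp add: omult_scaleR_left right[OF ab(2)])
    also have "\<dots> = r *\<^sub>R ((sqrt (ore (Y a a)) * sqrt (ore (Y b b))) *\<^sub>R oone)"
      using i by (simp add: real_sqrt_mult r_def)
    finally show ?thesis using i by (simp only: r_def scaleR_cancel_left) simp
  qed
  moreover have "phase_conj u (base_point N) = base_point N"
    by (intro ext) (auto simp: phase_conj_def base_point_def vvT_def omult_oconj_self u)
  ultimately show ?thesis using phase_conj_auto[of u, OF u] by blast
qed

end

text \<open>The octonionic substitute for conjugation by a diagonal unitary matrix; the three Moufang
  identities are what makes it map Hermitian idempotents to Hermitian idempotents.\<close>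

definition moufang_map :: "oct \<Rightarrow> (nat \<Rightarrow> nat \<Rightarrow> oct) \<Rightarrow> nat \<Rightarrow> nat \<Rightarrow> oct" where
  "moufang_map u X = (\<lambda>i j.
     if (i, j) = (0, 1) then omult (X 0 1) (oconj u)
     else if (i, j) = (1, 0) then omult u (X 1 0)
     else if (i, j) = (0, 2) then omult (X 0 2) u
     else if (i, j) = (2, 0) then omult (oconj u) (X 2 0)
     else if (i, j) = (1, 2) then omult (omult u (X 1 2)) u
     else if (i, j) = (2, 1) then omult (omult (oconj u) (X 2 1)) (oconj u)
     else X i j)"

lemma sum_lessThan_3: "(\<Sum>i<3. f i) = f 0 + f 1 + f (2::nat)"
  by (simp add: numeral_3_eq_3 numeral_2_eq_2)

lemma less_3_cases: "i < 3 \<Longrightarrow> i = 0 \<or> i = 1 \<or> i = (2::nat)"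
  by auto

lemma moufang_map_entries:
  "moufang_map u X 0 1 = omult (X 0 1) (oconj u)" "moufang_map u X 1 0 = omult u (X 1 0)"
  "moufang_map u X 0 2 = omult (X 0 2) u" "moufang_map u X 2 0 = omult (oconj u) (X 2 0)"
  "moufang_map u X 1 2 = omult (omult u (X 1 2)) u"
  "moufang_map u X 2 1 = omult (omult (oconj u) (X 2 1)) (oconj u)"
  "moufang_map u X i i = X i i"
  "supported 3 X \<Longrightarrow> supported 3 (moufang_map u X)"
  by (auto simp: moufang_map_def supported_def)

context
  fixes u :: oct assumes u: "u \<bullet> u = 1"
begin

lemma unit_cancel: "omult u (omult (oconj u) x) = x" "omult (oconj u) (omult u x) = x"
  "omult (omult x u) (oconj u) = x" "omult (omult x (oconj u)) u = x"
  using omult_cancel_left[of u x] omult_cancel_left[of "oconj u" x]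
    omult_cancel_right[of x u] omult_cancel_right[of x "oconj u"] by (simp_all add: inner_oconj u)

text \<open>For 3 by 3 matrices an off-diagonal entry of X X = X contains one genuine product: the
  two terms with a diagonal factor are real multiples of the entry itself. So idempotence off the
  diagonal amounts to six relations \<open>off\<close>, each with a single product, and the Moufang
  identities preserve these one by one.\<close>

lemma moufang_map_in:
  assumes X: "X \<in> proj_set 8 3" shows "moufang_map u X \<in> proj_set 8 3"
  unfolding proj_set_iff
proof (intro conjI allI)
  let ?Y = "moufang_map u X"
  note en = moufang_map_entries(1-7)
  show "supported 3 ?Y" by (rule moufang_map_entries(8)[OF proj_supported[OF X]])
  show "in_alg 8 (?Y i j)" for i j by (simp add: in_alg_def)
  have h: "X 1 0 = oconj (X 0 1)" "X 2 0 = oconj (X 0 2)" "X 2 1 = oconj (X 1 2)" by (rule proj_herm[OF X])+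
  show herm: "?Y j i = oconj (?Y i j)" for i j
  proof (cases "i < 3 \<and> j < 3")
    case True
    show ?thesis
    proof (cases "i = j")
      case True
      then show ?thesis using proj_herm[OF X, of i i] by (simp only: en)
    next
      case False
      have "(i, j) \<in> {(0,1), (1,0), (0,2), (2,0), (1,2), (2,1)}"
        using False True less_3_cases[of i] less_3_cases[of j] by auto
      then show ?thesis
        by (elim insertE emptyE; clarify; simp only: en h oconj_omult oconj_oconj omult_flexible)
    qed
  next
    case False
    then show ?thesis using \<open>supported 3 ?Y\<close> by (auto simp: supported_def not_less)
  qed
  show "(\<Sum>i<3. ore (?Y i i)) = 1" unfolding en by (rule proj_trace[OF X])
  have id: "omult (X i 0) (X 0 j) + omult (X i 1) (X 1 j) + omult (X i 2) (X 2 j) = X i j" for i j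
    using fun_cong[OF fun_cong[OF proj_idem[OF X]], of i j] unfolding mm_def sum_lessThan_3 .
  define z where "z = (\<lambda>i. ore (X i i))"
  have dg: "X i i = z i *\<^sub>R oone" for i unfolding z_def by (rule proj_diag[OF X])
  have dgl: "omult (X i i) x = z i *\<^sub>R x" "omult x (X i i) = z i *\<^sub>R x" for i x unfolding dg by simp_all
  have solve: "p = (1 - a - b) *\<^sub>R x"
    if "a *\<^sub>R x + b *\<^sub>R x + p = x \<or> a *\<^sub>R x + p + b *\<^sub>R x = x \<or> p + a *\<^sub>R x + b *\<^sub>R x = x" for p x :: oct and a b
    using that by (auto simp: algebra_simps)
  have join: "a *\<^sub>R x + b *\<^sub>R x + (1 - a - b) *\<^sub>R x = x" "a *\<^sub>R x + (1 - a - b) *\<^sub>R x + b *\<^sub>R x = x"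
    "(1 - a - b) *\<^sub>R x + a *\<^sub>R x + b *\<^sub>R x = x" for x :: oct and a b
    by (simp_all add: algebra_simps)
  have off: "omult (X 0 2) (X 2 1) = (1 - z 0 - z 1) *\<^sub>R X 0 1" "omult (X 1 2) (X 2 0) = (1 - z 1 - z 0) *\<^sub>R X 1 0"
    "omult (X 0 1) (X 1 2) = (1 - z 0 - z 2) *\<^sub>R X 0 2" "omult (X 2 1) (X 1 0) = (1 - z 2 - z 0) *\<^sub>R X 2 0"
    "omult (X 1 0) (X 0 2) = (1 - z 1 - z 2) *\<^sub>R X 1 2" "omult (X 2 0) (X 0 1) = (1 - z 2 - z 1) *\<^sub>R X 2 1"
    using id[of 0 1] id[of 1 0] id[of 0 2] id[of 2 0] id[of 1 2] id[of 2 1] unfolding dgl by (auto intro!: solve simp: ac_simps)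
  have rm: "omult (omult x u) (omult (omult (oconj u) y) (oconj u)) = omult (omult x y) (oconj u)"
    "omult (omult x (oconj u)) (omult (omult u y) u) = omult (omult x y) u" for x y
    unfolding right_moufang unit_cancel by (rule refl)+
  have lm: "omult (omult (omult u y) u) (omult (oconj u) x) = omult u (omult y x)"
    "omult (omult (omult (oconj u) y) (oconj u)) (omult u x) = omult (oconj u) (omult y x)" for x y
    unfolding left_moufang unit_cancel by (rule refl)+
  have offY: "omult (?Y 0 2) (?Y 2 1) = (1 - z 0 - z 1) *\<^sub>R ?Y 0 1" "omult (?Y 1 2) (?Y 2 0) = (1 - z 1 - z 0) *\<^sub>R ?Y 1 0"
    "omult (?Y 0 1) (?Y 1 2) = (1 - z 0 - z 2) *\<^sub>R ?Y 0 2" "omult (?Y 2 1) (?Y 1 0) = (1 - z 2 - z 0) *\<^sub>R ?Y 2 0"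
    "omult (?Y 1 0) (?Y 0 2) = (1 - z 1 - z 2) *\<^sub>R ?Y 1 2" "omult (?Y 2 0) (?Y 0 1) = (1 - z 2 - z 1) *\<^sub>R ?Y 2 1"
    unfolding en rm lm middle_moufang off omult_scaleR_left omult_scaleR_right by (rule refl)+
  \<comment> \<open>Diagonal entries of the square involve only norms of entries, which
    multiplication by units preserves.\<close>
  have nrm: "omult (?Y i l) (?Y l i) = omult (X i l) (X l i)" if "i < 3" "l < 3" for i l
  proof -
    have "?Y i l \<bullet> ?Y i l = X i l \<bullet> X i l"
      using less_3_cases[OF that(1)] less_3_cases[OF that(2)]
      by (elim disjE) (simp_all only: en inner_omult_left inner_omult_right inner_oconj u mult_1)
    then show ?thesis unfolding herm[of l i] proj_herm[OF X, of l i] by (simp only: omult_oconj_self)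
  qed
  have dY: "omult (?Y i i) x = z i *\<^sub>R x" "omult x (?Y i i) = z i *\<^sub>R x" for i x unfolding en dgl by (rule refl)+
  show "mm 3 ?Y ?Y = ?Y"
  proof (intro ext)
    fix i j
    show "mm 3 ?Y ?Y i j = ?Y i j"
    proof (cases "i < 3 \<and> j < 3")
      case False
      then show ?thesis using \<open>supported 3 ?Y\<close> by (auto simp: supported_def not_less mm_def)
    next
      case True
      show ?thesis
      proof (cases "i = j")
        case True': True
        have "mm 3 ?Y ?Y i i = omult (X i 0) (X 0 i) + omult (X i 1) (X 1 i) + omult (X i 2) (X 2 i)"
          unfolding mm_def sum_lessThan_3 using True by (simp add: nrm)
        then show ?thesis using True' id[of i i] by (simp only: en)
      next
        case False
        have "(i, j) \<in> {(0,1), (1,0), (0,2), (2,0), (1,2), (2,1)}"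
          using False True less_3_cases[of i] less_3_cases[of j] by auto
        then show ?thesis
          unfolding mm_def sum_lessThan_3
          by (elim insertE emptyE; clarify; simp only: dY offY; simp add: algebra_simps)
      qed
    qed
  qed
qed

lemma moufang_map_inverse:
  assumes "supported 3 X" shows "moufang_map (oconj u) (moufang_map u X) = X"
proof (intro ext)
  fix i j
  note en = moufang_map_entries(1-7)
  show "moufang_map (oconj u) (moufang_map u X) i j = X i j"
  proof (cases "(i, j) \<in> {(0,1), (1,0), (0,2), (2,0), (1,2), (2,1)}")
    case True
    then show ?thesis
      by (elim insertE emptyE; clarify; simp only: en oconj_oconj unit_cancel omult_flexible)
  next
    case False
    then show ?thesis by (auto simp: moufang_map_def)
  qed
qed

end

lemma moufang_map_auto:
  assumes u: "u \<bullet> u = 1"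
  shows "moufang_map u \<in> form_autos (proj_set 8 3) (pip 3)"
proof (rule form_autos_inverse_pair[where g' = "moufang_map (oconj u)"])
  have uc: "oconj u \<bullet> oconj u = 1" by (simp add: u inner_oconj)
  show "moufang_map u X \<in> proj_set 8 3" "moufang_map (oconj u) X \<in> proj_set 8 3"
    "moufang_map (oconj u) (moufang_map u X) = X" "moufang_map u (moufang_map (oconj u) X) = X"
    if "X \<in> proj_set 8 3" for X
    using moufang_map_in[OF u that] moufang_map_in[OF uc that]
      moufang_map_inverse[OF u proj_supported[OF that]] moufang_map_inverse[OF uc proj_supported[OF that]] by simp_all
  show "pip 3 (moufang_map u X) (moufang_map u Y) = pip 3 X Y" for X Y
    unfolding pip_def sum_lessThan_3 moufang_map_entries(1-7) inner_omult_left inner_omult_right inner_oconj u by simp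
qed

lemma moufang_map_base_point: "u \<bullet> u = 1 \<Longrightarrow> moufang_map u (base_point 3) = base_point 3"
  by (intro ext) (auto simp: moufang_map_def base_point_def vvT_def)

lemma octonion_phase_01:
  assumes Y: "Y \<in> proj_set 8 3"
  shows "\<exists>g\<in>form_autos (proj_set 8 3) (pip 3). g (base_point 3) = base_point 3 \<and> (\<forall>i. g Y i i = Y i i) \<and>
    g Y 0 1 = (sqrt (ore (Y 0 0)) * sqrt (ore (Y 1 1))) *\<^sub>R oone"
proof (intro bexI conjI allI)
  let ?u = "unit_of (Y 0 1)"
  have u: "?u \<bullet> ?u = 1" by (rule unit_of_inner)
  show "moufang_map ?u \<in> form_autos (proj_set 8 3) (pip 3)" by (rule moufang_map_auto[OF u])
  show "moufang_map ?u (base_point 3) = base_point 3" by (rule moufang_map_base_point[OF u])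
  show "moufang_map ?u Y i i = Y i i" for i by (rule moufang_map_entries)
  show "moufang_map ?u Y 0 1 = (sqrt (ore (Y 0 0)) * sqrt (ore (Y 1 1))) *\<^sub>R oone"
    unfolding moufang_map_entries omult_unit_of_oconj by (subst proj_entry_norm[OF Y]) (simp_all add: real_sqrt_mult)
qed

text \<open>Exchange of the coordinates 0 and 2, itself a real reflection; it transports the phase
  change from entry (0, 1) to entry (2, 1).\<close>

lemma octonion_swap:
  obtains g where "g \<in> form_autos (proj_set 8 3) (pip 3)" "\<And>X i j. i < 3 \<Longrightarrow> j < 3 \<Longrightarrow> g X i j = X (2 - i) (2 - j)"
proof -
  define A :: "nat \<Rightarrow> nat \<Rightarrow> real" where "A = (\<lambda>i j. if i < 3 \<and> j < 3 \<and> i + j = 2 then 1 else 0)"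
  have lt: "(i < (3::nat)) = (i = 0 \<or> i = 1 \<or> i = 2)" for i by auto
  have "sym_involution 3 A"
    unfolding sym_involution_def sum_lessThan_3 by (auto simp: A_def add.commute lt)
  moreover have "rconj 3 A X i j = X (2 - i) (2 - j)" if "i < 3" "j < 3" for X i j
    using that unfolding rconj_def lmul_def rmul_def sum_lessThan_3 lt by (auto simp: A_def)
  ultimately show ?thesis using that[of "rconj 3 A"] rconj_auto[of 3 A] by blast
qed

text \<open>The Moufang map conjugated by the swap. Associating freely is impossible, so just the
  block away from the base coordinate is made real here; the entry (0, 1) is treated
  separately.\<close>

lemma octonion_phase_12:
  assumes Y: "Y \<in> proj_set 8 3" and B: "base_point 3 \<in> proj_set 8 3"
  shows "\<exists>g\<in>form_autos (proj_set 8 3) (pip 3). g (base_point 3) = base_point 3 \<and>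
    (\<forall>a b. 1 \<le> a \<and> a < 3 \<and> 1 \<le> b \<and> b < 3 \<longrightarrow> g Y a b = (sqrt (ore (Y a a)) * sqrt (ore (Y b b))) *\<^sub>R oone)"
proof -
  obtain s where s: "s \<in> form_autos (proj_set 8 3) (pip 3)" "\<And>X i j. i < 3 \<Longrightarrow> j < 3 \<Longrightarrow> s X i j = X (2 - i) (2 - j)"
    by (rule octonion_swap) blast
  let ?u = "unit_of (Y 2 1)"
  have u: "?u \<bullet> ?u = 1" by (rule unit_of_inner)
  let ?g = "s \<circ> (moufang_map ?u \<circ> s)"
  have g: "?g \<in> form_autos (proj_set 8 3) (pip 3)"
    by (intro form_autos_comp s moufang_map_auto u)
  then have in': "?g Y \<in> proj_set 8 3" "?g (base_point 3) \<in> proj_set 8 3"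
    using form_autos_in[OF g Y] form_autos_in[OF g B] by simp_all
  have d: "?g X i i = X i i" if "i < 3" for i X
    using that by (simp add: s(2) moufang_map_entries(7))
  have e: "?g Y 2 1 = (sqrt (ore (Y 2 2)) * sqrt (ore (Y 1 1))) *\<^sub>R oone"
  proof -
    have "?g Y 2 1 = omult (Y 2 1) (oconj ?u)"
      using moufang_map_entries(1)[of ?u "s Y"] by (simp add: s(2))
    also have "\<dots> = (sqrt (ore (Y 2 2)) * sqrt (ore (Y 1 1))) *\<^sub>R oone"
      unfolding omult_unit_of_oconj by (subst proj_entry_norm[OF Y]) (simp_all add: real_sqrt_mult)
    finally show ?thesis .
  qed
  have e': "?g Y 1 2 = (sqrt (ore (Y 1 1)) * sqrt (ore (Y 2 2))) *\<^sub>R oone"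
    using proj_herm[OF in'(1), of 1 2] unfolding e by (simp add: oconj_scaleR mult.commute)
  have dd: "?g Y i i = (sqrt (ore (Y i i)) * sqrt (ore (Y i i))) *\<^sub>R oone" if "i < 3" for i
    unfolding d[OF that] using proj_diag[OF Y, of i] proj_diag_nonneg[OF Y, of i] by simp
  \<comment> \<open>The diagonal is preserved, and for the base point the norm formula then forces
    all off-diagonal entries of the image to vanish.\<close>
  have "?g (base_point 3) i j = base_point 3 i j" for i j
  proof (cases "i < 3 \<and> j < 3")
    case False
    then show ?thesis using proj_supported[OF in'(2)] proj_supported[OF B] by (auto simp: supported_def not_less)
  next
    case True
    show ?thesis
    proof (cases "i = j")
      case True': True then show ?thesis using d[of i "base_point 3"] True by simp
    next
      case False
      then have 0: "base_point 3 i j = 0" "ore (base_point 3 i i) * ore (base_point 3 j j) = 0"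
        by (auto simp: base_point_def vvT_def ore_inner)
      have "?g (base_point 3) i j \<bullet> ?g (base_point 3) i j = ore (base_point 3 i i) * ore (base_point 3 j j)"
        using proj_entry_norm[OF in'(2), of i j] True unfolding d[OF conjunct1[OF True]] d[OF conjunct2[OF True]] by blast
      then show ?thesis using 0 by (metis inner_eq_zero_iff)
    qed
  qed
  then have gB: "?g (base_point 3) = base_point 3" by (intro ext)
  have "?g Y a b = (sqrt (ore (Y a a)) * sqrt (ore (Y b b))) *\<^sub>R oone" if "1 \<le> a" "a < 3" "1 \<le> b" "b < 3" for a b
  proof -
    have "(a = 1 \<or> a = 2) \<and> (b = 1 \<or> b = 2)" using that by auto
    then show ?thesis using e e' dd[of 1] dd[of 2] by (elim conjE disjE) (simp_all del: o_apply)
  qed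
  then show ?thesis using g gB by blast
qed

section \<open>Normal form of a pair of points in projective space\<close>

lemma vvT_in_proj_set:
  assumes "(\<Sum>i<N. (v i)\<^sup>2) = 1" shows "vvT N v \<in> proj_set k N"
  unfolding proj_set_iff
proof (intro conjI allI)
  show "supported N (vvT N v)" by (auto simp: supported_def vvT_def)
  show "in_alg k (vvT N v i j)" for i j by (simp add: vvT_def in_alg_scaleR in_alg_oone in_alg_zero)
  show "vvT N v j i = oconj (vvT N v i j)" for i j by (simp add: vvT_def oconj_scaleR mult.commute)
  show "mm N (vvT N v) (vvT N v) = vvT N v"
  proof (intro ext)
    fix i j
    show "mm N (vvT N v) (vvT N v) i j = vvT N v i j"
    proof (cases "i < N \<and> j < N")
      case True
      then have "mm N (vvT N v) (vvT N v) i j = (\<Sum>l<N. ((v i * v j) * (v l)\<^sup>2) *\<^sub>R oone)"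
        unfolding mm_def by (intro sum.cong refl) (auto simp: vvT_def power2_eq_square)
      then show ?thesis using True assms by (simp add: vvT_def scaleR_sum_left[symmetric] sum_distrib_left[symmetric])
    qed (auto simp: mm_def vvT_def)
  qed
  show "(\<Sum>i<N. ore (vvT N v i i)) = 1"
    using assms by (simp add: vvT_def ore_inner power2_eq_square)
qed

lemma sum_first_two: "(N::nat) \<ge> 2 \<Longrightarrow> (\<Sum>i<N. if i = 0 then a else if i = 1 then b else 0) = a + (b :: real)"
proof -
  assume N: "N \<ge> 2"
  have "(\<Sum>i<N. if i = 0 then a else if i = 1 then b else 0) = (\<Sum>i\<in>{0, 1}. if i = 0 then a else if i = (1::nat) then b else 0)"
    using N by (intro sum.mono_neutral_right) auto
  then show ?thesis by simp
qed

lemma real_circle_in: "N \<ge> 2 \<Longrightarrow> real_circle N t \<in> proj_set k N"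
  unfolding real_circle_def
proof (rule vvT_in_proj_set)
  assume N: "N \<ge> 2"
  have "(\<Sum>i<N. (if i = 0 then cos (t / 2) else if i = 1 then sin (t / 2) else 0)\<^sup>2)
      = (\<Sum>i<N. if i = 0 then (cos (t / 2))\<^sup>2 else if i = 1 then (sin (t / 2))\<^sup>2 else 0)"
    by (intro sum.cong refl) auto
  then show "(\<Sum>i<N. (if i = 0 then cos (t / 2) else if i = 1 then sin (t / 2) else 0)\<^sup>2) = 1"
    using sum_first_two[OF N] by simp
qed

lemma base_point_circle: "base_point N = real_circle N 0"
  unfolding base_point_def real_circle_def by (rule arg_cong[where f = "vvT N"]) auto

lemma rotate_to_base:
  assumes N: "N \<ge> 2"
  shows "\<exists>g\<in>form_autos (proj_set k N) (pip N). g (real_circle N t) = base_point N"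
proof -
  let ?x = "\<lambda>i. if i = 0 then cos (t / 2) else if i = 1 then sin (t / 2) else (0::real)"
  let ?y = "\<lambda>i. if i = 0 then 1 else (0::real)"
  have "(\<Sum>i<N. (?x i)\<^sup>2) = (\<Sum>i<N. if i = 0 then (cos (t / 2))\<^sup>2 else if i = 1 then (sin (t / 2))\<^sup>2 else 0)"
    by (intro sum.cong refl) auto
  moreover have "(\<Sum>i<N. (?y i)\<^sup>2) = (\<Sum>i<N. if i = 0 then 1 else if i = 1 then 0 else 0)"
    by (intro sum.cong refl) auto
  ultimately have "(\<Sum>i<N. (?x i)\<^sup>2) = (\<Sum>i<N. (?y i)\<^sup>2)"
    using sum_first_two[OF N] by simp
  then obtain A where A: "sym_involution N A" "\<And>i. i < N \<Longrightarrow> (\<Sum>p<N. A i p * ?x p) = ?y i"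
    using householder[of ?x N ?y] by blast
  have "rconj N A (real_circle N t) = base_point N"
    unfolding real_circle_def base_point_def rconj_vvT[OF A(1)]
    by (intro ext) (auto simp: vvT_def A(2))
  then show ?thesis using rconj_auto[OF A(1)] by blast
qed

text \<open>A point whose block away from the base coordinate is real is moved by a Householder reflection
  into the coordinate projective line, where one more phase change makes it real.\<close>

lemma stabilizer_normal_form:
  assumes N: "N \<ge> 2"
    and block: "\<And>Y. Y \<in> proj_set k N \<Longrightarrow> \<exists>g\<in>form_autos (proj_set k N) (pip N). g (base_point N) = base_point N \<and>
      (\<forall>a b. 1 \<le> a \<and> a < N \<and> 1 \<le> b \<and> b < N \<longrightarrow> g Y a b = (sqrt (ore (Y a a)) * sqrt (ore (Y b b))) *\<^sub>R oone)"
    and phase: "\<And>Y. Y \<in> proj_set k N \<Longrightarrow> \<exists>g\<in>form_autos (proj_set k N) (pip N). g (base_point N) = base_point N \<and>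
      (\<forall>i<N. g Y i i = Y i i) \<and> g Y 0 1 = (sqrt (ore (Y 0 0)) * sqrt (ore (Y 1 1))) *\<^sub>R oone"
    and Y: "Y \<in> proj_set k N"
  shows "\<exists>g\<in>form_autos (proj_set k N) (pip N). \<exists>t\<in>{0..pi}. g (base_point N) = base_point N \<and> g Y = real_circle N t"
proof -
  let ?G = "form_autos (proj_set k N) (pip N)"
  obtain g1 where g1: "g1 \<in> ?G" "g1 (base_point N) = base_point N"
    and g1Y: "\<And>a b. 1 \<le> a \<Longrightarrow> a < N \<Longrightarrow> 1 \<le> b \<Longrightarrow> b < N \<Longrightarrow> g1 Y a b = (sqrt (ore (Y a a)) * sqrt (ore (Y b b))) *\<^sub>R oone"
    using block[OF Y] by blast
  define Y1 where "Y1 = g1 Y"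
  have Y1: "Y1 \<in> proj_set k N" unfolding Y1_def using g1(1) Y by (rule form_autos_in)
  \<comment> \<open>The base coordinate is set to 0 in both vectors, so the reflection exchanging
    them fixes the base vector e. The target y is the multiple of the next axis with the length of
    x.\<close>
  define x where "x = (\<lambda>a. if a = 0 then 0 else sqrt (ore (Y a a)))"
  define y where "y = (\<lambda>a::nat. if a = 0 then 0 else if a = 1 then sqrt (\<Sum>i<N. (x i)\<^sup>2) else 0)"
  define e where "e = (\<lambda>a::nat. if a = 0 then 1 else (0::real))"
  have "(\<Sum>i<N. (y i)\<^sup>2) = (\<Sum>i<N. if i = 0 then 0 else if i = 1 then (\<Sum>i<N. (x i)\<^sup>2) else 0)"
    by (intro sum.cong refl) (auto simp: y_def sum_nonneg)
  then have "(\<Sum>i<N. (x i)\<^sup>2) = (\<Sum>i<N. (y i)\<^sup>2)" using sum_first_two[OF N] by simp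
  moreover have "(\<Sum>p<N. e p * x p) = 0" "(\<Sum>p<N. e p * y p) = 0"
    by (intro sum.neutral; simp add: e_def x_def y_def)+
  ultimately obtain A where A: "sym_involution N A" "\<And>i. i < N \<Longrightarrow> (\<Sum>p<N. A i p * x p) = y i"
    "\<And>i. i < N \<Longrightarrow> (\<Sum>p<N. A i p * e p) = e i"
    using householder[of x N y] by blast
  have A0: "A i 0 = e i" if "i < N" for i
  proof -
    have "(\<Sum>p<N. A i p * e p) = (\<Sum>p<N. if p = 0 then A i 0 else 0)"
      by (intro sum.cong refl) (auto simp: e_def)
    then show ?thesis using A(3)[OF that] N by simp
  qed
  define Y2 where "Y2 = rconj N A Y1"
  have Y2: "Y2 \<in> proj_set k N" unfolding Y2_def by (rule rconj_proj_set[OF A(1) Y1])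
  have rB: "rconj N A (base_point N) = base_point N"
    unfolding base_point_def rconj_vvT[OF A(1)] using A(3) unfolding e_def
    by (intro ext) (auto simp: vvT_def)
  have Y2d: "Y2 a a = (y a * y a) *\<^sub>R oone" if a: "1 \<le> a" "a < N" for a
  proof -
    have "Y2 a a = (\<Sum>p<N. \<Sum>q<N. (A a p * A a q) *\<^sub>R Y1 p q)"
      unfolding Y2_def rconj_def lmul_def rmul_def scaleR_sum_right by (simp add: A_sym[OF A(1), of _ a])
    also have "\<dots> = (\<Sum>p<N. \<Sum>q<N. (A a p * x p * (A a q * x q)) *\<^sub>R oone)"
    proof (intro sum.cong refl)
      fix p q assume "p \<in> {..<N}" "q \<in> {..<N}"
      \<comment> \<open>The entries of \<open>Y1\<close> in row or column 0 need not be real; they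
        drop out because A does not mix the base coordinate with the others.\<close>
      have "A a 0 = 0" using A0[OF a(2)] a by (simp add: e_def)
      then show "(A a p * A a q) *\<^sub>R Y1 p q = (A a p * x p * (A a q * x q)) *\<^sub>R oone"
        using g1Y[of p q] \<open>p \<in> {..<N}\<close> \<open>q \<in> {..<N}\<close>
        by (cases "p = 0"; cases "q = 0") (auto simp: Y1_def x_def)
    qed
    also have "\<dots> = ((\<Sum>p<N. A a p * x p) * (\<Sum>q<N. A a q * x q)) *\<^sub>R oone"
      by (simp add: sum_product scaleR_sum_left)
    finally show ?thesis by (simp add: A(2)[OF a(2)])
  qed
  obtain g3 where g3: "g3 \<in> ?G" "g3 (base_point N) = base_point N"
    and g3d: "\<And>i. i < N \<Longrightarrow> g3 Y2 i i = Y2 i i" and g3o: "g3 Y2 0 1 = (sqrt (ore (Y2 0 0)) * sqrt (ore (Y2 1 1))) *\<^sub>R oone"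
    using phase[OF Y2] by blast
  define Z where "Z = g3 Y2"
  have Z: "Z \<in> proj_set k N" unfolding Z_def using g3(1) Y2 by (rule form_autos_in)
  define z where "z = (\<lambda>i. ore (Z i i))"
  have z0: "z a = 0" if "2 \<le> a" "a < N" for a
    using g3d[of a] Y2d[of a] that by (simp add: z_def Z_def y_def ore_inner)
  have znn: "z i \<ge> 0" for i unfolding z_def by (rule proj_diag_nonneg[OF Z])
  have zsum: "z 0 + z 1 = 1"
  proof -
    have "1 = (\<Sum>i<N. z i)" unfolding z_def by (rule proj_trace[OF Z, symmetric])
    also have "\<dots> = (\<Sum>i<N. if i = 0 then z 0 else if i = 1 then z 1 else 0)"
      by (intro sum.cong refl) (auto intro!: z0)
    finally show ?thesis using sum_first_two[OF N] by simp
  qed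
  have Zoff: "Z a b = 0" if "a < N" "b < N" "2 \<le> a \<or> 2 \<le> b" for a b
  proof -
    have "Z a b \<bullet> Z a b = 0" using proj_entry_norm[OF Z that(1,2)] z0[of a] z0[of b] that unfolding z_def by auto
    then show ?thesis by simp
  qed
  have Z01: "Z 0 1 = (sqrt (z 0) * sqrt (z 1)) *\<^sub>R oone"
    using g3o g3d[of 0] g3d[of 1] N by (simp add: z_def Z_def)
  have Z10: "Z 1 0 = (sqrt (z 1) * sqrt (z 0)) *\<^sub>R oone"
    using proj_herm[OF Z, of 1 0] Z01 by (simp add: oconj_scaleR mult.commute)
  have Zd: "Z i i = (sqrt (z i) * sqrt (z i)) *\<^sub>R oone" for i
    using proj_diag[OF Z, of i] znn[of i] by (simp add: z_def)
  \<comment> \<open>Half of the distance from the base point: the circle at parameter 2 s has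
    coordinates cos s and sin s.\<close>
  define s where "s = arccos (sqrt (z 0))"
  have le1: "sqrt (z 0) \<le> 1" "0 \<le> sqrt (z 0)" using zsum znn[of 1] znn[of 0] by auto
  have s: "cos s = sqrt (z 0)" "0 \<le> s" "s \<le> pi / 2"
    unfolding s_def using le1 cos_arccos[of "sqrt (z 0)"] arccos_lbound[of "sqrt (z 0)"] arccos_le_pi2[of "sqrt (z 0)"]
    by linarith+
  have "sin s = sqrt (1 - (cos s)\<^sup>2)"
    using s by (intro sin_cos_sqrt sin_ge_zero) auto
  then have sins: "sin s = sqrt (z 1)" using s(1) znn[of 0] zsum by (simp add: algebra_simps)
  have "Z = real_circle N (2 * s)"
  proof (intro ext)
    fix i j
    show "Z i j = real_circle N (2 * s) i j"
    proof (cases "i < N \<and> j < N")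
      case False
      then show ?thesis using proj_supported[OF Z] by (auto simp: supported_def real_circle_def vvT_def)
    next
      case True
      have "i = 0 \<or> i = 1 \<or> 2 \<le> i" "j = 0 \<or> j = 1 \<or> 2 \<le> j" by auto
      then show ?thesis
        using True Zd[of 0] Zd[of 1] Z01 Z10 Zoff[of i j]
        by (elim disjE) (auto simp: real_circle_def vvT_def s(1) sins)
    qed
  qed
  moreover have "2 * s \<in> {0..pi}" using s by auto
  moreover have "g3 \<circ> (rconj N A \<circ> g1) \<in> ?G"
    by (intro form_autos_comp g3 g1 rconj_auto A)
  moreover have "(g3 \<circ> (rconj N A \<circ> g1)) (base_point N) = base_point N" "(g3 \<circ> (rconj N A \<circ> g1)) Y = Z"
    by (simp_all add: g1 g3 rB Z_def Y2_def Y1_def)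
  ultimately show ?thesis by metis
qed

lemma proj_stabilizer_normal_form:
  assumes "k \<in> {1, 2, 4} \<and> N \<ge> 2 \<or> k = 8 \<and> N = 3" and Y: "Y \<in> proj_set k N"
  shows "\<exists>g\<in>form_autos (proj_set k N) (pip N). \<exists>t\<in>{0..pi}. g (base_point N) = base_point N \<and> g Y = real_circle N t"
  using assms(1)
proof
  assume kN: "k \<in> {1, 2, 4} \<and> N \<ge> 2"
  then have k: "k \<in> {1, 2, 4}" and N: "N \<ge> 2" by auto
  then have N0: "N > 0" "0 < N" "1 < N" by auto
  show ?thesis
  proof (rule stabilizer_normal_form[OF N _ _ Y])
    fix Y assume Y: "Y \<in> proj_set k N"
    \<comment> \<open>A single phase change makes all entries real, so it serves for the block
      condition as well as for the entry (0, 1).\<close>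
    obtain g where g: "g \<in> form_autos (proj_set k N) (pip N)" "g (base_point N) = base_point N"
      "\<And>a b. a < N \<Longrightarrow> b < N \<Longrightarrow> g Y a b = (sqrt (ore (Y a a)) * sqrt (ore (Y b b))) *\<^sub>R oone"
      using phase_normal_form[OF k Y N0(1)] by blast
    then show "\<exists>g\<in>form_autos (proj_set k N) (pip N). g (base_point N) = base_point N \<and>
      (\<forall>a b. 1 \<le> a \<and> a < N \<and> 1 \<le> b \<and> b < N \<longrightarrow> g Y a b = (sqrt (ore (Y a a)) * sqrt (ore (Y b b))) *\<^sub>R oone)"
      by blast
    have "g Y i i = Y i i" if "i < N" for i
      unfolding g(3)[OF that that] using proj_diag[OF Y, of i] proj_diag_nonneg[OF Y, of i] by simp
    then show "\<exists>g\<in>form_autos (proj_set k N) (pip N). g (base_point N) = base_point N \<and>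
      (\<forall>i<N. g Y i i = Y i i) \<and> g Y 0 1 = (sqrt (ore (Y 0 0)) * sqrt (ore (Y 1 1))) *\<^sub>R oone"
      using g(1,2) g(3)[OF N0(2,3)] by blast
  qed
next
  assume kN: "k = 8 \<and> N = 3"
  then have k: "k = 8" and N: "N = 3" by auto
  have B: "base_point 3 \<in> proj_set 8 3" unfolding base_point_circle by (rule real_circle_in) simp
  show ?thesis
    using Y unfolding k N
  proof (intro stabilizer_normal_form)
    fix Y assume Y: "Y \<in> proj_set 8 3"
    show "\<exists>g\<in>form_autos (proj_set 8 3) (pip 3). g (base_point 3) = base_point 3 \<and>
      (\<forall>a b. 1 \<le> a \<and> a < 3 \<and> 1 \<le> b \<and> b < 3 \<longrightarrow> g Y a b = (sqrt (ore (Y a a)) * sqrt (ore (Y b b))) *\<^sub>R oone)"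
      by (rule octonion_phase_12[OF Y B])
    show "\<exists>g\<in>form_autos (proj_set 8 3) (pip 3). g (base_point 3) = base_point 3 \<and>
      (\<forall>i<3. g Y i i = Y i i) \<and> g Y 0 1 = (sqrt (ore (Y 0 0)) * sqrt (ore (Y 1 1))) *\<^sub>R oone"
      using octonion_phase_01[OF Y] by blast
  qed simp
qed

text \<open>X reaches the base point in two moves, by way of the real circle; a map fixing the base
  point then normalises the image of Y.\<close>

lemma proj_hom:
  assumes kN: "k \<in> {1, 2, 4} \<and> N \<ge> 2 \<or> k = 8 \<and> N = 3" and X: "X \<in> proj_set k N" and Y: "Y \<in> proj_set k N"
  shows "\<exists>g\<in>form_autos (proj_set k N) (pip N). \<exists>t\<in>{0..pi}. g X = base_point N \<and> g Y = real_circle N t"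
proof -
  have N: "N \<ge> 2" using kN by auto
  obtain g1 t1 where g1: "g1 \<in> form_autos (proj_set k N) (pip N)" "g1 X = real_circle N t1"
    using proj_stabilizer_normal_form[OF kN X] by blast
  obtain g2 where g2: "g2 \<in> form_autos (proj_set k N) (pip N)" "g2 (real_circle N t1) = base_point N"
    using rotate_to_base[OF N] by blast
  have "g2 (g1 Y) \<in> proj_set k N" by (intro form_autos_in[OF g2(1)] form_autos_in[OF g1(1)] Y)
  then obtain g3 t where g3: "g3 \<in> form_autos (proj_set k N) (pip N)" "t \<in> {0..pi}"
    "g3 (base_point N) = base_point N" "g3 (g2 (g1 Y)) = real_circle N t"
    using proj_stabilizer_normal_form[OF kN] by blast
  show ?thesis
  proof (intro bexI conjI)
    show "(g3 \<circ> (g2 \<circ> g1)) X = base_point N" "(g3 \<circ> (g2 \<circ> g1)) Y = real_circle N t"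
      by (simp_all add: g1 g2 g3)
    show "g3 \<circ> (g2 \<circ> g1) \<in> form_autos (proj_set k N) (pip N)" by (intro form_autos_comp g1 g2 g3)
  qed (rule g3)
qed

section \<open>Geodesic frames of projective spaces\<close>

definition alg_basis :: "nat \<Rightarrow> oct set" where
  "alg_basis k = {b \<in> Basis. in_alg k b}"

lemma Basis_oct: "(Basis :: oct set) = {((1, 0), (0, 0)), ((\<i>, 0), (0, 0)), ((0, 1), (0, 0)), ((0, \<i>), (0, 0)),
    ((0, 0), (1, 0)), ((0, 0), (\<i>, 0)), ((0, 0), (0, 1)), ((0, 0), (0, \<i>))}"
  by (auto simp: Basis_prod_def Basis_complex_def zero_prod_def)

lemma card_alg_basis:
  assumes "k \<in> {1, 2, 4, 8}" shows "card (alg_basis k) = k"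
proof -
  have "alg_basis 1 = {((1, 0), (0, 0))}" "alg_basis 2 = {((1, 0), (0, 0)), ((\<i>, 0), (0, 0))}"
    "alg_basis 4 = {((1, 0), (0, 0)), ((\<i>, 0), (0, 0)), ((0, 1), (0, 0)), ((0, \<i>), (0, 0))}"
    "alg_basis 8 = Basis"
    unfolding alg_basis_def Basis_oct by (auto simp: in_alg_def qzero_def)
  then show ?thesis using assms unfolding Basis_oct by auto
qed

lemma finite_alg_basis: "finite (alg_basis k)"
  by (simp add: alg_basis_def)

lemma alg_basis_unit: "b \<in> alg_basis k \<Longrightarrow> b \<bullet> b = 1"
  by (simp add: alg_basis_def inner_same_Basis)

lemma oone_alg_basis: "oone \<in> alg_basis k"
  unfolding alg_basis_def using in_alg_oone by (simp add: Basis_oct oone_def qzero_def)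

lemma alg_basis_orth:
  assumes "b \<in> Basis" "b \<notin> alg_basis k" "in_alg k x" shows "b \<bullet> x = 0"
  using assms unfolding alg_basis_def Basis_oct
  by (auto simp: in_alg_def qzero_def inner_prod_def inner_complex_def split: if_splits)

lemma sum_alg_basis: "in_alg k x \<Longrightarrow> (\<Sum>b\<in>alg_basis k. (b \<bullet> x)\<^sup>2) = x \<bullet> x"
proof -
  assume x: "in_alg k x"
  have "x \<bullet> x = (\<Sum>b\<in>Basis. (b \<bullet> x)\<^sup>2)"
    by (subst euclidean_inner) (simp add: power2_eq_square inner_commute)
  also have "\<dots> = (\<Sum>b\<in>alg_basis k. (b \<bullet> x)\<^sup>2)"
  proof (rule sum.mono_neutral_right)
    show "\<forall>b\<in>Basis - alg_basis k. (b \<bullet> x)\<^sup>2 = 0" using alg_basis_orth[OF _ _ x] by simp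
  qed (auto simp: alg_basis_def)
  finally show ?thesis by simp
qed

text \<open>The projection onto cos(t/2) e_i + sin(t/2) conj(b) e_j, written in the full angle: a
  geodesic of the coordinate projective line with initial direction b.\<close>

definition line :: "nat \<Rightarrow> nat \<Rightarrow> oct \<Rightarrow> real \<Rightarrow> nat \<Rightarrow> nat \<Rightarrow> oct" where
  "line i j b t = (\<lambda>p q.
     if p = i \<and> q = i then ((1 + cos t) / 2) *\<^sub>R oone
     else if p = j \<and> q = j then ((1 - cos t) / 2) *\<^sub>R oone
     else if p = i \<and> q = j then (sin t / 2) *\<^sub>R b
     else if p = j \<and> q = i then (sin t / 2) *\<^sub>R oconj b
     else 0)"

lemma line_entries:
  assumes "i \<noteq> j"
  shows "line i j b t i i = ((1 + cos t) / 2) *\<^sub>R oone" "line i j b t j j = ((1 - cos t) / 2) *\<^sub>R oone"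
    "line i j b t i j = (sin t / 2) *\<^sub>R b" "line i j b t j i = (sin t / 2) *\<^sub>R oconj b"
    "p \<notin> {i, j} \<Longrightarrow> line i j b t p q = 0" "q \<notin> {i, j} \<Longrightarrow> line i j b t p q = 0"
  using assms by (auto simp: line_def)

lemma sum_pair_support:
  fixes N :: nat
  assumes "i \<noteq> j" "i < N" "j < N" "\<And>l. l \<notin> {i, j} \<Longrightarrow> f l = 0"
  shows "(\<Sum>l<N. f l) = f i + (f j :: 'a :: comm_monoid_add)"
proof -
  have "(\<Sum>l<N. f l) = (\<Sum>l\<in>{i, j}. f l)"
    by (intro sum.mono_neutral_right) (use assms in auto)
  then show ?thesis using assms(1) by simp
qed

lemma line_in:
  assumes ij: "i \<noteq> j" "i < N" "j < N" and b: "in_alg k b" "b \<bullet> b = 1"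
  shows "line i j b t \<in> proj_set k N"
  unfolding proj_set_iff
proof (intro conjI allI)
  let ?L = "line i j b t"
  note e = line_entries[OF ij(1)]
  show "supported N ?L" using ij by (auto simp: supported_def line_def)
  show "in_alg k (?L p q)" for p q
    unfolding line_def by (simp add: in_alg_scaleR in_alg_oone in_alg_oconj in_alg_zero b(1))
  show "?L q p = oconj (?L p q)" for p q
  proof (cases "p \<in> {i, j} \<and> q \<in> {i, j}")
    case False
    then consider "p \<notin> {i, j}" | "q \<notin> {i, j}" by blast
    then show ?thesis by cases (simp_all only: e oconj_zero not_False_eq_True)
  next
    case True
    then show ?thesis
      by (elim conjE insertE emptyE; hypsubst) (simp_all only: e oconj_scaleR oconj_one oconj_oconj)
  qed
  have s2: "sin t * sin t = 1 - cos t * cos t" using sin_squared_eq[of t] by (simp add: power2_eq_square)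
  have bb: "omult b (oconj b) = oone" "omult (oconj b) b = oone"
    by (simp_all add: omult_oconj_self omult_oconj_self' b)
  have trig: "(1 + cos t) / 2 * ((1 + cos t) / 2) + sin t / 2 * (sin t / 2) = (1 + cos t) / 2"
    "sin t / 2 * (sin t / 2) + (1 - cos t) / 2 * ((1 - cos t) / 2) = (1 - cos t) / 2"
    "(1 + cos t) / 2 * (sin t / 2) + sin t / 2 * ((1 - cos t) / 2) = sin t / 2"
    "sin t / 2 * ((1 + cos t) / 2) + (1 - cos t) / 2 * (sin t / 2) = sin t / 2"
    by (simp_all add: field_simps s2)
  show "mm N ?L ?L = ?L"
  proof (intro ext)
    fix p q
    have "mm N ?L ?L p q = omult (?L p i) (?L i q) + omult (?L p j) (?L j q)"
      unfolding mm_def by (rule sum_pair_support[OF ij]) (simp add: e)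
    also have "\<dots> = ?L p q"
    proof (cases "p \<in> {i, j} \<and> q \<in> {i, j}")
      case False
      then consider "p \<notin> {i, j}" | "q \<notin> {i, j}" by blast
      then show ?thesis by cases (simp_all only: e omult_zero add_0_left not_False_eq_True)
    next
      case True
      then show ?thesis
        by (elim conjE insertE emptyE; hypsubst)
           (simp_all only: e omult_scaleR_left omult_scaleR_right omult_one bb scaleR_scaleR scaleR_add_left[symmetric] trig)
    qed
    finally show "mm N ?L ?L p q = ?L p q" .
  qed
  have "(\<Sum>p<N. ore (?L p p)) = ore (?L i i) + ore (?L j j)"
    by (rule sum_pair_support[OF ij]) (simp add: e ore_inner)
  then show "(\<Sum>p<N. ore (?L p p)) = 1" by (simp add: e ore_inner add_divide_distrib diff_divide_distrib)
qed

text \<open>Being affine in cos t and sin t is what \<open>ip_C\<close> demands. The angles 0, pi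
  and pi/2 recover the two diagonal entries and the coordinate of V along b.\<close>

lemma pip_line:
  assumes ij: "i \<noteq> j" "i < N" "j < N" and V: "V \<in> proj_set k N"
  shows "pip N (line i j b t) V = (1 + cos t) / 2 * ore (V i i) + (1 - cos t) / 2 * ore (V j j) + sin t * (b \<bullet> V i j)"
proof -
  let ?L = "line i j b t"
  note e = line_entries[OF ij(1)]
  have "pip N ?L V = (?L i i \<bullet> V i i + ?L i j \<bullet> V i j) + (?L j i \<bullet> V j i + ?L j j \<bullet> V j j)"
  proof -
    have "(\<Sum>q<N. ?L p q \<bullet> V p q) = ?L p i \<bullet> V p i + ?L p j \<bullet> V p j" for p
      by (rule sum_pair_support[OF ij]) (simp add: e)
    moreover have "(\<Sum>p<N. ?L p i \<bullet> V p i + ?L p j \<bullet> V p j)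
        = (?L i i \<bullet> V i i + ?L i j \<bullet> V i j) + (?L j i \<bullet> V j i + ?L j j \<bullet> V j j)"
      by (rule sum_pair_support[OF ij]) (simp add: e)
    ultimately show ?thesis unfolding pip_def by simp
  qed
  also have "\<dots> = (1 + cos t) / 2 * ore (V i i) + (1 - cos t) / 2 * ore (V j j) + sin t * (b \<bullet> V i j)"
    unfolding e proj_herm[OF V, of j i] by (simp add: inner_oconj ore_inner inner_commute)
  finally show ?thesis .
qed

lemma base_point_line: "0 < j \<Longrightarrow> j < N \<Longrightarrow> line 0 j b 0 = base_point N"
  by (intro ext) (auto simp: line_def base_point_def vvT_def)

lemma real_circle_line: "N \<ge> 2 \<Longrightarrow> line 0 1 oone t = real_circle N t"
proof (intro ext)
  fix p q assume N: "N \<ge> 2"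
  have "cos (t / 2) * cos (t / 2) = (1 + cos t) / 2" "sin (t / 2) * sin (t / 2) = (1 - cos t) / 2"
    "cos (t / 2) * sin (t / 2) = sin t / 2"
    using cos_squared_eq[of "t / 2"] cos_double_cos[of "t / 2"] cos_double_sin[of "t / 2"] sin_double[of "t / 2"]
    by (simp_all add: power2_eq_square field_simps)
  then show "line 0 1 oone t p q = real_circle N t p q"
    using N by (auto simp: line_def real_circle_def vvT_def mult.commute)
qed

lemma ore_eq_pip:
  assumes "N \<ge> 2" "i < N"
  shows "\<exists>e\<in>proj_set k N. \<forall>V\<in>proj_set k N. ore (V i i) = pip N e V"
proof -
  have "i \<noteq> (if i = 0 then 1 else 0) \<and> (if i = 0 then 1 else 0) < N" using assms by auto
  then obtain j where j: "i \<noteq> j" "j < N" by blast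
  show ?thesis
    using line_in[OF j(1) assms(2) j(2) in_alg_oone oone_inner, where k = k and t = 0] pip_line[OF j(1) assms(2) j(2), of _ k oone 0]
    by (intro bexI[of _ "line i j oone 0"] ballI) auto
qed

text \<open>Only the functions \<open>pip N e\<close> are known to be measurable. Diagonal entries
  are their values at coordinate points, off-diagonal components come from lines at angle pi/2, and
  components outside the algebra vanish.\<close>

lemma entry_measurable:
  assumes N: "N \<ge> 2" "i < N" "j < N" and b: "b \<in> Basis"
    and sp: "space \<mu> = proj_set k N" and meas: "\<And>e. e \<in> proj_set k N \<Longrightarrow> pip N e \<in> borel_measurable \<mu>"
  shows "(\<lambda>V. b \<bullet> V i j) \<in> borel_measurable \<mu>"
proof -
  have diag: "(\<lambda>V. ore (V l l)) \<in> borel_measurable \<mu>" if l: "l < N" for l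
  proof -
    obtain e where e: "e \<in> proj_set k N" "\<And>V. V \<in> proj_set k N \<Longrightarrow> ore (V l l) = pip N e V"
      using ore_eq_pip[OF N(1) l] by blast
    have "(\<lambda>V. ore (V l l)) \<in> borel_measurable \<mu> \<longleftrightarrow> (\<lambda>V. pip N e V) \<in> borel_measurable \<mu>"
      by (rule measurable_cong) (simp add: sp e(2))
    then show ?thesis using meas[OF e(1)] by simp
  qed
  show ?thesis
  proof (cases "i = j")
    case True
    have eq: "b \<bullet> V i j = (b \<bullet> oone) * ore (V i i)" if "V \<in> space \<mu>" for V
      using proj_diag[of V k N i] that True by (metis inner_scaleR_right mult.commute sp)
    have "(\<lambda>V. b \<bullet> V i j) \<in> borel_measurable \<mu> \<longleftrightarrow> (\<lambda>V. (b \<bullet> oone) * ore (V i i)) \<in> borel_measurable \<mu>"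
      by (rule measurable_cong) (rule eq)
    then show ?thesis using diag[OF N(2)] by simp
  next
    case ij: False
    show ?thesis
    proof (cases "b \<in> alg_basis k")
      case True
      then have b: "in_alg k b" "b \<bullet> b = 1" by (auto simp: alg_basis_def inner_same_Basis)
      have eq: "b \<bullet> V i j = pip N (line i j b (pi / 2)) V - (ore (V i i) + ore (V j j)) / 2" if "V \<in> space \<mu>" for V
        using pip_line[OF ij N(2,3), of V k b "pi / 2"] that by (simp add: sp add_divide_distrib)
      have "(\<lambda>V. b \<bullet> V i j) \<in> borel_measurable \<mu>
          \<longleftrightarrow> (\<lambda>V. pip N (line i j b (pi / 2)) V - (ore (V i i) + ore (V j j)) / 2) \<in> borel_measurable \<mu>"
        by (rule measurable_cong) (rule eq)
      then show ?thesis
        using diag[OF N(2)] diag[OF N(3)] meas[OF line_in[OF ij N(2,3) b]] by simp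
    next
      case False
      have "(\<lambda>V. b \<bullet> V i j) \<in> borel_measurable \<mu> \<longleftrightarrow> (\<lambda>V. 0::real) \<in> borel_measurable \<mu>"
        by (rule measurable_cong) (simp add: sp alg_basis_orth[OF b False] proj_in_alg)
      then show ?thesis by simp
    qed
  qed
qed

text \<open>The frame has one direction for each coordinate j \<ge> 1 and each basis unit b. At
  angle pi the geodesic (j, b) reaches the coordinate point j whatever b is, so each diagonal entry
  is counted k times; this is why \<open>kap\<close> equals k.\<close>

lemma two_point_proj:
  assumes kN: "k \<in> {1, 2, 4} \<and> N \<ge> 2 \<or> k = 8 \<and> N = 3"
  shows "two_point (proj_set k N) (pip N) (real k) (base_point N) ({1..<N} \<times> alg_basis k) (1, oone)
    (\<lambda>(j, b). line 0 j b) (\<lambda>(j, b) V. b \<bullet> V 0 j) (({..<N} \<times> {..<N}) \<times> (Basis :: oct set)) (\<lambda>((i, j), b) V. b \<bullet> V i j)"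
proof -
  have N: "N \<ge> 2" and k: "k \<in> {1, 2, 4, 8}" using kN by auto
  have N0: "0 < N" using N by simp
  have base: "ore (base_point N i i) = (if i = 0 then 1 else 0)" "base_point N i j = (if i = 0 \<and> j = 0 then oone else 0)" for i j
    using N by (auto simp: base_point_def vvT_def ore_inner)
  have pip0: "pip N (base_point N) V = ore (V 0 0)" if "V \<in> proj_set k N" for V
    using pip_line[of 0 1 N V k oone 0] that N by (simp add: base_point_line[of 1 N oone, symmetric])
  have idx: "fst i \<noteq> 0" "0 \<noteq> fst i" "fst i < N" "in_alg k (snd i)" "snd i \<bullet> snd i = 1" if "i \<in> {1..<N} \<times> alg_basis k" for i
  proof -
    have i: "fst i \<in> {1..<N}" "snd i \<in> alg_basis k" using that by (auto simp: mem_Times_iff)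
    show "fst i \<noteq> 0" "0 \<noteq> fst i" "fst i < N" using i(1) by auto
    show "in_alg k (snd i)" using i(2) by (simp add: alg_basis_def)
    show "snd i \<bullet> snd i = 1" by (rule alg_basis_unit[OF i(2)])
  qed
  show ?thesis
    unfolding case_prod_beta
  proof (rule two_point.intro)
    show "finite ({1..<N} \<times> alg_basis k)" by (simp add: finite_alg_basis)
    show "(1, oone) \<in> {1..<N} \<times> alg_basis k" using N oone_alg_basis by simp
    show "finite (({..<N} \<times> {..<N}) \<times> (Basis :: oct set))" by simp
    show "0 < real k" using k by auto
    show "pip N x y = pip N y x" for x y by (rule pip_sym)
    fix i assume i: "i \<in> {1..<N} \<times> alg_basis k"
    note ix = idx[OF i]
    show L: "line 0 (fst i) (snd i) t \<in> proj_set k N" for t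
      by (rule line_in[OF ix(2) N0 ix(3,4,5)])
    show "line 0 (fst i) (snd i) 0 = base_point N" using ix by (intro base_point_line) auto
    show "pip N (line 0 (fst i) (snd i) s) (line 0 (fst i) (snd i) t) = (1 + cos (s - t)) / 2" for s t
      unfolding pip_line[OF ix(2) N0 ix(3) L] line_entries[OF ix(2)]
      using ix(5) by (simp add: ore_inner cos_diff field_simps)
    show "pip N (line 0 (fst i) (snd i) t) V = (pip N (base_point N) V + pip N (line 0 (fst i) (snd i) pi) V) / 2
        + cos t * ((pip N (base_point N) V - pip N (line 0 (fst i) (snd i) pi) V) / 2) + sin t * (snd i \<bullet> V 0 (fst i))"
      if V: "V \<in> proj_set k N" for V t
      unfolding pip0[OF V] pip_line[OF ix(2) N0 ix(3) V] by (simp add: field_simps)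
  next
    fix V assume V: "V \<in> proj_set k N"
    have split: "(\<Sum>j<N. f j) = f 0 + (\<Sum>j\<in>{1..<N}. f j)" for f :: "nat \<Rightarrow> real"
      using N0 by (simp add: lessThan_atLeast0 sum.atLeast_Suc_lessThan)
    have dbl: "(\<Sum>i\<in>{1..<N} \<times> alg_basis k. f (fst i) (snd i)) = (\<Sum>j\<in>{1..<N}. \<Sum>b\<in>alg_basis k. f j b)" for f :: "nat \<Rightarrow> oct \<Rightarrow> real"
      by (simp add: sum.cartesian_product case_prod_beta)
    have "(\<Sum>i\<in>{1..<N} \<times> alg_basis k. (snd i \<bullet> V 0 (fst i))\<^sup>2) = (\<Sum>j\<in>{1..<N}. V 0 j \<bullet> V 0 j)"
      unfolding dbl[of "\<lambda>j b. (b \<bullet> V 0 j)\<^sup>2"] sum_alg_basis[OF proj_in_alg[OF V]] ..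
    also have "\<dots> = ore (V 0 0) - V 0 0 \<bullet> V 0 0"
      using proj_row[OF V, of 0] split[of "\<lambda>j. V 0 j \<bullet> V 0 j"] by simp
    finally show "(\<Sum>i\<in>{1..<N} \<times> alg_basis k. (snd i \<bullet> V 0 (fst i))\<^sup>2) = pip N (base_point N) V * (1 - pip N (base_point N) V)"
      unfolding pip0[OF V] proj_entry_norm[OF V N0 N0] by (simp add: algebra_simps)
    have "(\<Sum>i\<in>{1..<N} \<times> alg_basis k. pip N (line 0 (fst i) (snd i) pi) V) = (\<Sum>i\<in>{1..<N} \<times> alg_basis k. ore (V (fst i) (fst i)))"
      by (rule sum.cong[OF refl]) (subst pip_line[OF idx(2) N0 idx(3) V], auto)
    also have "\<dots> = (\<Sum>j\<in>{1..<N}. real k * ore (V j j))"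
      unfolding dbl[of "\<lambda>j b. ore (V j j)"] by (simp add: card_alg_basis[OF k])
    also have "\<dots> = real k * (1 - ore (V 0 0))"
      using proj_trace[OF V] split[of "\<lambda>j. ore (V j j)"] by (simp add: sum_distrib_left[symmetric])
    finally show "(\<Sum>i\<in>{1..<N} \<times> alg_basis k. pip N (line 0 (fst i) (snd i) pi) V) = real k * (1 - pip N (base_point N) V)"
      unfolding pip0[OF V] .
  next
    fix x y assume xy: "x \<in> proj_set k N" "y \<in> proj_set k N"
    show "\<exists>g\<in>form_autos (proj_set k N) (pip N). \<exists>t\<in>{0..pi}. g x = base_point N \<and> g y = line 0 (fst (1, oone)) (snd (1, oone)) t"
      using proj_hom[OF kN xy] unfolding real_circle_line[OF N, symmetric] fst_conv snd_conv .
    have "pip N x y = (\<Sum>p\<in>{..<N} \<times> {..<N}. x (fst p) (snd p) \<bullet> y (fst p) (snd p))"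
      unfolding pip_def by (simp add: sum.cartesian_product case_prod_beta)
    also have "\<dots> = (\<Sum>p\<in>{..<N} \<times> {..<N}. \<Sum>b\<in>Basis. (b \<bullet> x (fst p) (snd p)) * (b \<bullet> y (fst p) (snd p)))"
      by (intro sum.cong refl, subst euclidean_inner) (simp add: inner_commute)
    also have "\<dots> = (\<Sum>j\<in>({..<N} \<times> {..<N}) \<times> Basis. (snd j \<bullet> x (fst (fst j)) (snd (fst j))) * (snd j \<bullet> y (fst (fst j)) (snd (fst j))))"
      by (simp add: sum.cartesian_product case_prod_beta)
    finally show "pip N x y = (\<Sum>j\<in>({..<N} \<times> {..<N}) \<times> Basis. (snd j \<bullet> x (fst (fst j)) (snd (fst j))) * (snd j \<bullet> y (fst (fst j)) (snd (fst j))))" .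
  next
    fix j :: "(nat \<times> nat) \<times> oct" and M :: "(nat \<Rightarrow> nat \<Rightarrow> oct) measure"
    assume "j \<in> ({..<N} \<times> {..<N}) \<times> Basis" "space M = proj_set k N" "\<And>e. e \<in> proj_set k N \<Longrightarrow> pip N e \<in> borel_measurable M"
    then show "(\<lambda>V. snd j \<bullet> V (fst (fst j)) (snd (fst j))) \<in> borel_measurable M"
      by (intro entry_measurable[OF N]) auto
  qed
qed

section \<open>Spheres\<close>

text \<open>The sphere consists of the rank one idempotents of a spin factor, with trace form
  \<open>(1 + x \<bullet> y) / 2\<close>; it is the member of the family with \<open>kap\<close> equal to the dimension.\<close>

definition sip :: "nat \<Rightarrow> (nat \<Rightarrow> real) \<Rightarrow> (nat \<Rightarrow> real) \<Rightarrow> real" where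
  "sip d x y = (1 + (\<Sum>i\<le>d. x i * y i)) / 2"

definition great_circle :: "nat \<Rightarrow> real \<Rightarrow> nat \<Rightarrow> real" where
  "great_circle j t = (\<lambda>i. if i = 0 then cos t else if i = j then sin t else 0)"

lemma sum_great_circle:
  assumes "0 < j" "j \<le> d"
  shows "(\<Sum>i\<le>d. great_circle j t i * x i) = cos t * x 0 + sin t * x j"
proof -
  have "(\<Sum>i\<le>d. great_circle j t i * x i) = (\<Sum>i\<in>{0, j}. great_circle j t i * x i)"
    using assms by (intro sum.mono_neutral_right) (auto simp: great_circle_def)
  then show ?thesis using assms by (simp add: great_circle_def)
qed

lemma sphere_setD: "x \<in> sphere_set d \<Longrightarrow> (\<Sum>i\<le>d. x i * x i) = 1"
  by (simp add: sphere_set_def power2_eq_square)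

lemma great_circle_in: "0 < j \<Longrightarrow> j \<le> d \<Longrightarrow> great_circle j t \<in> sphere_set d"
  using sum_great_circle[of j d t "great_circle j t"] sin_cos_squared_add3[of t]
  by (auto simp: sphere_set_def power2_eq_square) (auto simp: great_circle_def)

definition amap :: "nat \<Rightarrow> (nat \<Rightarrow> nat \<Rightarrow> real) \<Rightarrow> (nat \<Rightarrow> real) \<Rightarrow> nat \<Rightarrow> real" where
  "amap d A x = (\<lambda>i. \<Sum>p\<le>d. A i p * x p)"

context
  fixes d A assumes A: "sym_involution (Suc d) A"
begin

lemma amap_amap: assumes "\<forall>i>d. x i = 0" shows "amap d A (amap d A x) = x"
proof (rule ext)
  fix i
  have "amap d A (amap d A x) i = (\<Sum>q\<le>d. (\<Sum>p\<le>d. A i p * A p q) * x q)"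
    unfolding amap_def sum_distrib_left sum_distrib_right by (subst sum.swap) (simp add: mult.assoc)
  also have "\<dots> = x i"
  proof (cases "i \<le> d")
    case True
    then have "(\<Sum>q\<le>d. (\<Sum>p\<le>d. A i p * A p q) * x q) = (\<Sum>q\<le>d. if q = i then x i else 0)"
      using A_sq[OF A, of i] by (intro sum.cong refl) (auto simp: lessThan_Suc_atMost)
    then show ?thesis using True by simp
  next
    case False
    then show ?thesis using assms by (simp add: A_zero[OF A])
  qed
  finally show "amap d A (amap d A x) i = x i" .
qed

lemma amap_adjoint: "(\<Sum>i\<le>d. amap d A x i * y i) = (\<Sum>i\<le>d. x i * amap d A y i)"
  unfolding amap_def sum_distrib_left sum_distrib_right
proof (subst sum.swap, intro sum.cong refl)
  fix p i show "A i p * x p * y i = x p * (A p i * y i)"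
    unfolding A_sym[OF A, of i p] by (simp only: ac_simps)
qed

lemma amap_auto: "amap d A \<in> form_autos (sphere_set d) (sip d)"
proof (rule form_autos_involution)
  have supp: "\<forall>i>d. x i = 0" if "x \<in> sphere_set d" for x using that by (simp add: sphere_set_def)
  have inner: "(\<Sum>i\<le>d. amap d A x i * amap d A y i) = (\<Sum>i\<le>d. x i * y i)" if "y \<in> sphere_set d" for x y
    unfolding amap_adjoint amap_amap[OF supp[OF that]] ..
  show "amap d A x \<in> sphere_set d" if x: "x \<in> sphere_set d" for x
    using inner[OF x, of x] sphere_setD[OF x]
    by (simp add: sphere_set_def power2_eq_square) (simp add: amap_def A_zero[OF A])
  show "amap d A (amap d A x) = x" if "x \<in> sphere_set d" for x by (rule amap_amap[OF supp[OF that]])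
  show "sip d (amap d A x) (amap d A y) = sip d x y" if "x \<in> sphere_set d" "y \<in> sphere_set d" for x y
    unfolding sip_def inner[OF that(2)] ..
qed

end

text \<open>One reflection sends x to the pole; a second one fixes the pole and turns the remaining
  part of y onto the next axis.\<close>

lemma sphere_hom:
  assumes d: "d \<ge> 1" and x: "x \<in> sphere_set d" and y: "y \<in> sphere_set d"
  shows "\<exists>g\<in>form_autos (sphere_set d) (sip d). \<exists>t\<in>{0..pi}. g x = great_circle 1 0 \<and> g y = great_circle 1 t"
proof -
  let ?e = "great_circle 1 0"
  have e: "?e \<in> sphere_set d" using d by (intro great_circle_in) auto
  have e_eq: "?e i = (if i = 0 then 1 else 0)" for i by (simp add: great_circle_def)
  have norm1: "(\<Sum>i<Suc d. (z i)\<^sup>2) = 1" if "z \<in> sphere_set d" for z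
    using that by (simp add: sphere_set_def lessThan_Suc_atMost)
  have supp: "z i = 0" if "z \<in> sphere_set d" "\<not> i \<le> d" for z i using that by (simp add: sphere_set_def)
  obtain A where A: "sym_involution (Suc d) A" "\<And>i. i \<le> d \<Longrightarrow> amap d A x i = ?e i"
    using householder[of x "Suc d" ?e] norm1[OF x] norm1[OF e] unfolding amap_def lessThan_Suc_atMost less_Suc_eq_le by auto
  define z where "z = amap d A y"
  have Ain: "amap d A w \<in> sphere_set d" if "w \<in> sphere_set d" for w
    using form_autos_in[OF amap_auto[OF A(1)] that] .
  have Ax: "amap d A x = ?e"
    using A(2) supp[OF Ain[OF x]] supp[OF e] by (metis ext)
  have z: "z \<in> sphere_set d" unfolding z_def by (rule Ain[OF y])
  define v where "v = (\<lambda>i. if i = 0 then 0 else z i)"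
  define r where "r = sqrt (1 - (z 0)\<^sup>2)"
  define w where "w = (\<lambda>i::nat. if i = 0 then 0 else if i = 1 then r else 0)"
  have split: "(\<Sum>i<Suc d. f i) = f 0 + (\<Sum>i<d. f (Suc i))" for f :: "nat \<Rightarrow> real"
    by (rule sum.lessThan_Suc_shift)
  have v2: "(\<Sum>i<Suc d. (v i)\<^sup>2) = 1 - (z 0)\<^sup>2"
    using norm1[OF z] unfolding split by (simp add: v_def)
  have z0: "(z 0)\<^sup>2 \<le> 1" using v2 sum_nonneg[of "{..<Suc d}" "\<lambda>i. (v i)\<^sup>2"] by simp
  have "(\<Sum>i<Suc d. (w i)\<^sup>2) = (\<Sum>i<Suc d. if i = 0 then 0 else if i = 1 then r\<^sup>2 else 0)"
    by (intro sum.cong refl) (simp add: w_def)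
  then have "(\<Sum>i<Suc d. (v i)\<^sup>2) = (\<Sum>i<Suc d. (w i)\<^sup>2)"
    unfolding v2 using sum_first_two[of "Suc d" 0 "r\<^sup>2"] d z0 by (simp add: r_def)
  moreover have "(\<Sum>p<Suc d. ?e p * v p) = 0" "(\<Sum>p<Suc d. ?e p * w p) = 0"
    by (auto intro!: sum.neutral simp: great_circle_def v_def w_def)
  ultimately obtain A' where A': "sym_involution (Suc d) A'" "\<And>i. i < Suc d \<Longrightarrow> (\<Sum>p<Suc d. A' i p * v p) = w i"
    "\<And>i. i < Suc d \<Longrightarrow> (\<Sum>p<Suc d. A' i p * ?e p) = ?e i"
    using householder[of v "Suc d" w] by blast
  have A'in: "amap d A' u \<in> sphere_set d" if "u \<in> sphere_set d" for u
    using form_autos_in[OF amap_auto[OF A'(1)] that] .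
  have A'e: "amap d A' ?e = ?e"
  proof
    fix i show "amap d A' ?e i = ?e i"
      using A'(3)[of i] supp[OF A'in[OF e], of i] supp[OF e, of i]
      by (cases "i \<le> d") (auto simp: amap_def lessThan_Suc_atMost)
  qed
  define t where "t = arccos (z 0)"
  have abs: "\<bar>z 0\<bar> \<le> 1" using z0 by (simp add: abs_square_le_1)
  then have t: "cos t = z 0" "sin t = r" "t \<in> {0..pi}"
    unfolding t_def r_def by (auto simp: sin_arccos arccos_lbound arccos_ubound)
  have "amap d A' z = great_circle 1 t"
  proof
    fix i show "amap d A' z i = great_circle 1 t i"
    proof (cases "i \<le> d")
      case False
      then show ?thesis using supp[OF A'in[OF z]] supp[OF great_circle_in[of 1 d t]] d by simp
    next
      case True
      \<comment> \<open>The vector is split along the pole, which the second reflection fixes, and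
        the complement v, which it sends to w.\<close>
      have "amap d A' z i = (\<Sum>p<Suc d. A' i p * (z 0 * ?e p + v p))"
        unfolding amap_def lessThan_Suc_atMost by (intro sum.cong refl) (simp add: v_def great_circle_def)
      also have "\<dots> = z 0 * (\<Sum>p<Suc d. A' i p * ?e p) + (\<Sum>p<Suc d. A' i p * v p)"
        by (simp only: distrib_left sum.distrib sum_distrib_left mult.left_commute)
      also have "\<dots> = great_circle 1 t i"
        using True by (simp only: A'(2,3) less_Suc_eq_le) (simp add: w_def great_circle_def t)
      finally show ?thesis .
    qed
  qed
  then have "(amap d A' \<circ> amap d A) y = great_circle 1 t" "(amap d A' \<circ> amap d A) x = great_circle 1 0"
    by (simp_all only: o_apply z_def Ax A'e)
  moreover have "amap d A' \<circ> amap d A \<in> form_autos (sphere_set d) (sip d)"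
    by (intro form_autos_comp amap_auto A A')
  ultimately show ?thesis using t(3) by blast
qed

text \<open>All geodesics from the pole meet at the antipode, so \<open>sum_C\<close> has d equal
  terms and \<open>kap\<close> = d. In the expansion of the form the extra index
  \<open>Suc d\<close> carries the constant 1, and each factor takes 1 / sqrt 2 of the half.\<close>

lemma two_point_sphere:
  assumes d: "d \<ge> 1"
  shows "two_point (sphere_set d) (sip d) (real d) (great_circle 1 0) {1..d} 1 great_circle (\<lambda>j V. V j / 2)
    {..Suc d} (\<lambda>j V. (if j \<le> d then V j else 1) / sqrt 2)"
proof -
  have sip_gc: "sip d (great_circle j t) V = (1 + (cos t * V 0 + sin t * V j)) / 2" if "0 < j" "j \<le> d" for j t V
    unfolding sip_def sum_great_circle[OF that] ..
  have sip0: "sip d (great_circle 1 0) V = (1 + V 0) / 2" for V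
    using sip_gc[of 1 0 V] d by simp
  show ?thesis
  proof (rule two_point.intro)
    show "sip d x y = sip d y x" for x y by (simp add: sip_def mult.commute)
    show "1 \<in> {1..d}" "0 < real d" using d by auto
    show "great_circle i 0 = great_circle 1 0" for i by (auto simp: great_circle_def)
    show "great_circle i t \<in> sphere_set d" if "i \<in> {1..d}" for i t using that by (intro great_circle_in) auto
    show "sip d (great_circle i s) (great_circle i t) = (1 + cos (s - t)) / 2" if "i \<in> {1..d}" for i s t
      using that by (subst sip_gc) (auto simp: great_circle_def cos_diff)
    show "sip d (great_circle i t) V = (sip d (great_circle 1 0) V + sip d (great_circle i pi) V) / 2
        + cos t * ((sip d (great_circle 1 0) V - sip d (great_circle i pi) V) / 2) + sin t * (V i / 2)"
      if "i \<in> {1..d}" for i t V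
      using that unfolding sip0 by (subst (1 2 3) sip_gc) (auto simp: field_simps)
    fix V assume V: "V \<in> sphere_set d"
    have "1 = V 0 * V 0 + (\<Sum>i\<in>{1..d}. V i * V i)"
      using sphere_setD[OF V] by (simp add: atMost_atLeast0 sum.atLeast_Suc_atMost)
    then show "(\<Sum>i\<in>{1..d}. (V i / 2)\<^sup>2) = sip d (great_circle 1 0) V * (1 - sip d (great_circle 1 0) V)"
      unfolding sip0 by (simp add: power2_eq_square field_simps flip: sum_divide_distrib)
    have "(\<Sum>i\<in>{1..d}. sip d (great_circle i pi) V) = (\<Sum>i\<in>{1..d}. (1 - V 0) / 2)"
      by (intro sum.cong refl, subst sip_gc) auto
    also have "\<dots> = real d * (1 - (1 + V 0) / 2)" by (simp add: field_simps)
    finally show "(\<Sum>i\<in>{1..d}. sip d (great_circle i pi) V) = real d * (1 - sip d (great_circle 1 0) V)"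
      unfolding sip0 .
  next
    fix x y assume xy: "x \<in> sphere_set d" "y \<in> sphere_set d"
    show "\<exists>g\<in>form_autos (sphere_set d) (sip d). \<exists>t\<in>{0..pi}. g x = great_circle 1 0 \<and> g y = great_circle 1 t"
      by (rule sphere_hom[OF d xy])
    show "sip d x y = (\<Sum>j\<le>Suc d. (if j \<le> d then x j else 1) / sqrt 2 * ((if j \<le> d then y j else 1) / sqrt 2))"
      by (simp add: sip_def add_divide_distrib sum_divide_distrib)
  next
    fix j and N :: "(nat \<Rightarrow> real) measure"
    assume sp: "space N = sphere_set d" and meas: "\<And>e. e \<in> sphere_set d \<Longrightarrow> sip d e \<in> borel_measurable N"
    have "(\<lambda>V. V j) \<in> borel_measurable N" if j: "j \<le> d"
    proof -
      obtain e where e: "e \<in> sphere_set d" "\<And>V. sip d e V = (1 + V j) / 2"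
      proof (cases "j = 0")
        case True
        then show ?thesis using that[of "great_circle 1 0"] sip0 great_circle_in[of 1 d 0] d by simp
      next
        case False
        then show ?thesis using that[of "great_circle j (pi / 2)"] sip_gc[of j "pi / 2"] great_circle_in[of j d "pi / 2"] j by simp
      qed
      have eq: "V j = 2 * sip d e V - 1" for V unfolding e(2) by (simp add: field_simps)
      show ?thesis unfolding eq using meas[OF e(1)] by simp
    qed
    then show "(\<lambda>V. (if j \<le> d then V j else 1) / sqrt 2) \<in> borel_measurable N" by (cases "j \<le> d") simp_all
  qed auto
qed

section \<open>Transfer to the given space\<close>

lemma two_point_pullback:
  fixes M :: "'m set" and f :: "'m \<Rightarrow> 's"
  assumes tp: "two_point S ip kap p0 I i0 C D J h" and f: "bij_betw f M S"
  defines "f' \<equiv> inv_into M f"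
  shows "two_point M (\<lambda>x y. ip (f x) (f y)) kap (f' p0) I i0 (\<lambda>i t. f' (C i t)) (\<lambda>i V. D i (f V)) J (\<lambda>j V. h j (f V))"
proof -
  interpret tp: two_point S ip kap p0 I i0 C D J h by (rule tp)
  have f'M: "f' y \<in> M" and ff': "f (f' y) = y" if "y \<in> S" for y
    using that f unfolding f'_def by (auto simp: bij_betw_def inv_into_into f_inv_into_f)
  have fS: "f x \<in> S" and f'f: "f' (f x) = x" if "x \<in> M" for x
    using that f unfolding f'_def by (auto simp: bij_betw_def)
  show ?thesis
  proof (rule two_point.intro)
    show "finite I" "i0 \<in> I" "finite J" "0 < kap" using tp.fin_I tp.i0 tp.fin_J tp.kap_pos by auto
    show "ip (f x) (f y) = ip (f y) (f x)" if "x \<in> M" "y \<in> M" for x y using that by (intro tp.ip_sym fS)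
    show "f' (C i t) \<in> M" "f' (C i 0) = f' p0" if "i \<in> I" for i t
      using that by (auto intro: f'M tp.C_in simp: tp.C_0)
    show "ip (f (f' (C i s))) (f (f' (C i t))) = (1 + cos (s - t)) / 2" if "i \<in> I" for i s t
      using that by (simp add: ff' tp.C_in tp.ip_CC)
    show "ip (f (f' (C i t))) (f V) = (ip (f (f' p0)) (f V) + ip (f (f' (C i pi))) (f V)) / 2
        + cos t * ((ip (f (f' p0)) (f V) - ip (f (f' (C i pi))) (f V)) / 2) + sin t * D i (f V)"
      if "i \<in> I" "V \<in> M" for i V t
      using tp.ip_C[OF that(1) fS[OF that(2)], of t] by (simp only: ff' tp.C_in[OF that(1)] tp.p0_in)
    show "(\<Sum>i\<in>I. (D i (f V))\<^sup>2) = ip (f (f' p0)) (f V) * (1 - ip (f (f' p0)) (f V))" if "V \<in> M" for V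
      using tp.sum_D[OF fS[OF that]] by (simp add: ff' tp.p0_in)
    show "(\<Sum>i\<in>I. ip (f (f' (C i pi))) (f V)) = kap * (1 - ip (f (f' p0)) (f V))" if "V \<in> M" for V
      using tp.sum_C[OF fS[OF that]] by (simp add: ff' tp.p0_in tp.C_in)
    show "ip (f x) (f y) = (\<Sum>j\<in>J. h j (f x) * h j (f y))" if "x \<in> M" "y \<in> M" for x y
      using that by (intro tp.finite_rank fS)
  next
    fix x y assume xy: "x \<in> M" "y \<in> M"
    obtain g t where g: "g \<in> form_autos S ip" and t: "t \<in> {0..pi}" "g (f x) = p0" "g (f y) = C i0 t"
      using tp.hom[OF fS[OF xy(1)] fS[OF xy(2)]] by blast
    have "bij_betw (f' \<circ> (g \<circ> f)) M M"
      using bij_betw_trans[OF bij_betw_trans[OF f] bij_betw_inv_into[OF f]] g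
      unfolding form_autos_def f'_def by blast
    moreover have "ip (f ((f' \<circ> (g \<circ> f)) x)) (f ((f' \<circ> (g \<circ> f)) y)) = ip (f x) (f y)" if "x \<in> M" "y \<in> M" for x y
      using that by (simp add: ff' form_autos_in[OF g] fS form_autos_ip[OF g])
    ultimately have "f' \<circ> (g \<circ> f) \<in> form_autos M (\<lambda>x y. ip (f x) (f y))"
      by (simp add: form_autos_def)
    then show "\<exists>g\<in>form_autos M (\<lambda>x y. ip (f x) (f y)). \<exists>t\<in>{0..pi}. g x = f' p0 \<and> g y = f' (C i0 t)"
      using t by (intro bexI[of _ "f' \<circ> (g \<circ> f)"] bexI[of _ t]) simp_all
  next
    fix j and N :: "'m measure"
    assume j: "j \<in> J" and sp: "space N = M" and meas: "\<And>e. e \<in> M \<Longrightarrow> (\<lambda>y. ip (f e) (f y)) \<in> borel_measurable N"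
    \<comment> \<open>The coarsest measurable structure on the model for which f' is measurable; f
      is then measurable as well, because f' after f is the identity on M.\<close>
    let ?N = "vimage_algebra S f' N"
    have f'm: "f' \<in> measurable ?N N"
      by (rule measurable_vimage_algebra1) (auto simp: sp f'M)
    have "(\<lambda>x. f' (f x)) \<in> measurable N N \<longleftrightarrow> (\<lambda>x. x) \<in> measurable N N"
      by (rule measurable_cong) (simp add: sp f'f)
    then have fm: "f \<in> measurable N ?N"
      by (intro measurable_vimage_algebra2) (auto simp: sp fS)
    have "h j \<in> borel_measurable ?N"
    proof (rule tp.h_measurable[OF j])
      show "space ?N = S" by simp
      fix e assume e: "e \<in> S"
      have "(\<lambda>y. ip (f (f' e)) (f (f' y))) \<in> borel_measurable ?N"
        using measurable_compose[OF f'm meas[OF f'M[OF e]]] .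
      moreover have "(\<lambda>y. ip (f (f' e)) (f (f' y))) \<in> borel_measurable ?N \<longleftrightarrow> ip e \<in> borel_measurable ?N"
        by (rule measurable_cong) (simp add: ff' e)
      ultimately show "ip e \<in> borel_measurable ?N" by simp
    qed
    then show "(\<lambda>V. h j (f V)) \<in> borel_measurable N"
      using measurable_compose[OF fm] by blast
  qed
qed

text \<open>Everything the random field uses of the geometry. Nonnegativity makes a small
  \<open>rho x y\<close> mean closeness to 0, and positivity of the constants permits division by
  them.\<close>

definition reproducing_kernels :: "'w measure \<Rightarrow> 'p set \<Rightarrow> ('p \<Rightarrow> 'p \<Rightarrow> real) \<Rightarrow> real \<Rightarrow> real \<Rightarrow> ('w \<Rightarrow> 'p) \<Rightarrow> bool" where
  "reproducing_kernels P M rho \<alpha> \<beta> U \<longleftrightarrow>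
     (\<forall>x\<in>M. \<forall>y\<in>M. 0 \<le> rho x y) \<and> (\<forall>x\<in>M. cos (rho x x) = 1) \<and> (\<forall>n. (jacobi_a \<alpha> \<beta> n)\<^sup>2 > 0) \<and>
     (\<forall>n. \<forall>x\<in>M. \<forall>y\<in>M. (\<integral>w. jacobiP n \<alpha> \<beta> (cos (rho x (U w))) * jacobiP n \<alpha> \<beta> (cos (rho y (U w))) \<partial>P)
        = jacobiP n \<alpha> \<beta> (cos (rho x y)) / (jacobi_a \<alpha> \<beta> n)\<^sup>2)"

lemma space_Msig: "space (Msig M rho) = M"
  unfolding Msig_def by (auto intro!: space_measure_of)

lemma rho_measurable: "x \<in> M \<Longrightarrow> rho x \<in> borel_measurable (Msig M rho)"
proof (rule borel_measurableI_less)
  fix r assume "x \<in> M"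
  then have "{y \<in> M. rho x y < r} \<in> {{y \<in> M. rho x y < r} | x r. x \<in> M}" by blast
  then show "{y \<in> space (Msig M rho). rho x y < r} \<in> sets (Msig M rho)"
    unfolding space_Msig unfolding Msig_def by (subst sets_measure_of) auto
qed

text \<open>The map is onto, so the centre of every ball is an image and the preimage of the ball is
  again a ball.\<close>

lemma isometry_measurable:
  assumes g: "isometric_onto M rho M rho g" shows "g \<in> measurable (Msig M rho) (Msig M rho)"
proof -
  have bij: "bij_betw g M M" and iso: "\<And>x y. x \<in> M \<Longrightarrow> y \<in> M \<Longrightarrow> rho (g x) (g y) = rho x y"
    using g by (auto simp: isometric_onto_def)
  have gM: "g y \<in> M" if "y \<in> M" for y using bij that by (auto simp: bij_betw_def)
  have "g \<in> measurable (Msig M rho) (sigma M {{y \<in> M. rho x y < r} | x r. x \<in> M})"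
  proof (rule measurable_measure_of)
    fix A assume "A \<in> {{y \<in> M. rho x y < r} | x r. x \<in> M}"
    then obtain x r where A: "A = {y \<in> M. rho x y < r}" "x \<in> M" by blast
    obtain x' where x': "x' \<in> M" "x = g x'" using A(2) bij_betw_imp_surj_on[OF bij] by blast
    have "g -` A \<inter> space (Msig M rho) = {y \<in> M. g y \<in> M \<and> rho (g x') (g y) < r}"
      unfolding A(1) x'(2) space_Msig by blast
    also have "\<dots> = {y \<in> space (Msig M rho). rho x' y < r}"
      unfolding space_Msig by (intro Collect_cong conj_cong refl) (simp add: gM iso[OF x'(1)])
    also have "\<dots> \<in> sets (Msig M rho)"
      using rho_measurable[OF x'(1), of rho] by measurable
    finally show "g -` A \<inter> space (Msig M rho) \<in> sets (Msig M rho)" .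
  qed (auto simp: space_Msig gM)
  then show ?thesis unfolding Msig_def .
qed

text \<open>The law of U is an invariant probability measure for the form pulled back along f, and
  expectations of functions of U are integrals against it.\<close>

lemma reproducing_kernels_model:
  fixes kap :: real
  assumes P: "prob_space P" and tp: "two_point S ip kap p0 I i0 C D J h"
    and f: "isometric_onto M rho S dst f"
    and dst: "\<And>x y. x \<in> S \<Longrightarrow> y \<in> S \<Longrightarrow> dst x y = arccos (2 * ip x y - 1)"
    and U: "uniform_on P M rho U"
    and dim: "card I + kap > 2" and \<alpha>: "\<alpha> = card I / 2 - 1" and \<beta>: "\<beta> = kap / 2 - 1"
  shows "reproducing_kernels P M rho \<alpha> \<beta> U"
proof -
  define jp where "jp = (\<lambda>x y. ip (f x) (f y))"
  have bij: "bij_betw f M S" and rho_f: "\<And>x y. x \<in> M \<Longrightarrow> y \<in> M \<Longrightarrow> rho x y = dst (f x) (f y)"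
    using f by (auto simp: isometric_onto_def)
  have fS: "f x \<in> S" if "x \<in> M" for x using bij that by (auto simp: bij_betw_def)
  interpret tp: two_point M jp kap "inv_into M f p0" I i0 "\<lambda>i t. inv_into M f (C i t)" "\<lambda>i V. D i (f V)" J "\<lambda>j V. h j (f V)"
    unfolding jp_def by (rule two_point_pullback[OF tp bij])
  have rho: "rho x y = arccos (2 * jp x y - 1)" if "x \<in> M" "y \<in> M" for x y
    unfolding jp_def rho_f[OF that] by (rule dst[OF fS[OF that(1)] fS[OF that(2)]])
  have range: "-1 \<le> 2 * jp x y - 1" "2 * jp x y - 1 \<le> 1" if "x \<in> M" "y \<in> M" for x y
    using tp.ip_range[OF that] by auto
  have cos_rho: "cos (rho x y) = 2 * jp x y - 1" if "x \<in> M" "y \<in> M" for x y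
    unfolding rho[OF that] by (rule cos_arccos[OF range[OF that]])
  have rho_nonneg: "0 \<le> rho x y" if "x \<in> M" "y \<in> M" for x y
    unfolding rho[OF that] by (rule arccos_lbound[OF range[OF that]])
  have jp_xx: "jp x x = 1" if "x \<in> M" for x
    using tp.hom[OF that that] tp.ip_p0_p0 form_autos_ip[OF _ that that] by metis
  have UM: "U \<in> measurable P (Msig M rho)" and inv: "\<And>g. isometric_onto M rho M rho g \<Longrightarrow>
      distr P (Msig M rho) (\<lambda>w. g (U w)) = distr P (Msig M rho) U"
    using U by (auto simp: uniform_on_def)
  define \<mu> where "\<mu> = distr P (Msig M rho) U"
  have sets_mu: "sets \<mu> = sets (Msig M rho)" by (simp add: \<mu>_def)
  have space_mu: "space \<mu> = M" by (simp add: \<mu>_def space_Msig)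
  have jp_meas: "jp x \<in> borel_measurable \<mu>" if x: "x \<in> M" for x
  proof -
    have "(\<lambda>y. (1 + cos (rho x y)) / 2) \<in> borel_measurable \<mu>"
      unfolding measurable_cong_sets[OF sets_mu refl] using rho_measurable[OF x, of rho] by measurable
    moreover have "(\<lambda>y. (1 + cos (rho x y)) / 2) \<in> borel_measurable \<mu> \<longleftrightarrow> jp x \<in> borel_measurable \<mu>"
      by (rule measurable_cong) (simp add: space_mu cos_rho x)
    ultimately show ?thesis by simp
  qed
  \<comment> \<open>The distance is a function of the form, so automorphisms of the form are
    isometries and uniformity applies to them.\<close>
  have iso: "isometric_onto M rho M rho g" if g: "g \<in> form_autos M jp" for g
    unfolding isometric_onto_def
  proof (intro conjI ballI)
    show "bij_betw g M M" using g by (simp add: form_autos_def)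
    show "rho (g x) (g y) = rho x y" if "x \<in> M" "y \<in> M" for x y
      using that by (simp add: rho form_autos_in[OF g] form_autos_ip[OF g])
  qed
  interpret \<mu>: prob_space \<mu> unfolding \<mu>_def by (rule prob_space.prob_space_distr[OF P UM])
  interpret tpp: two_point_prob M jp kap "inv_into M f p0" I i0 "\<lambda>i t. inv_into M f (C i t)" "\<lambda>i V. D i (f V)" J "\<lambda>j V. h j (f V)" \<mu>
  proof
    show "space \<mu> = M" by (rule space_mu)
    show "jp x \<in> borel_measurable \<mu>" if "x \<in> M" for x by (rule jp_meas[OF that])
    fix g assume g: "g \<in> form_autos M jp"
    have gm: "g \<in> measurable (Msig M rho) (Msig M rho)" by (rule isometry_measurable[OF iso[OF g]])
    then show "g \<in> measurable \<mu> \<mu>" unfolding measurable_cong_sets[OF sets_mu sets_mu] .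
    have "distr \<mu> \<mu> g = distr \<mu> (Msig M rho) g" by (rule distr_cong) (auto simp: sets_mu)
    also have "\<dots> = distr P (Msig M rho) (g \<circ> U)" unfolding \<mu>_def by (rule distr_distr[OF gm UM])
    also have "\<dots> = \<mu>" using inv[OF iso[OF g]] by (simp add: \<mu>_def comp_def)
    finally show "distr \<mu> \<mu> g = \<mu>" .
  qed
  have jac: "jacobiP n \<alpha> \<beta> (cos (rho x y)) = poly (jacobi_poly n \<alpha> \<beta>) (jp x y)" if "x \<in> M" "y \<in> M" for n x y
    unfolding poly_jacobi_poly cos_rho[OF that] ..
  have UinM: "U w \<in> M" if "w \<in> space P" for w using measurable_space[OF UM that] by (simp add: space_Msig)
  have "(\<integral>w. jacobiP n \<alpha> \<beta> (cos (rho x (U w))) * jacobiP n \<alpha> \<beta> (cos (rho y (U w))) \<partial>P)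
        = jacobiP n \<alpha> \<beta> (cos (rho x y)) / (jacobi_a \<alpha> \<beta> n)\<^sup>2" if xy: "x \<in> M" "y \<in> M" for n x y
  proof -
    have "(\<integral>w. jacobiP n \<alpha> \<beta> (cos (rho x (U w))) * jacobiP n \<alpha> \<beta> (cos (rho y (U w))) \<partial>P)
       = (\<integral>w. poly (jacobi_poly n \<alpha> \<beta>) (jp x (U w)) * poly (jacobi_poly n \<alpha> \<beta>) (jp y (U w)) \<partial>P)"
      by (intro Bochner_Integration.integral_cong refl) (simp add: jac xy UinM)
    also have "\<dots> = (\<integral>V. poly (jacobi_poly n \<alpha> \<beta>) (jp x V) * poly (jacobi_poly n \<alpha> \<beta>) (jp y V) \<partial>\<mu>)"
      unfolding \<mu>_def
    proof (rule integral_distr[OF UM, symmetric])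
      have "(\<lambda>V. poly (jacobi_poly n \<alpha> \<beta>) (jp x V) * poly (jacobi_poly n \<alpha> \<beta>) (jp y V)) \<in> borel_measurable \<mu>"
        by (intro tpp.bm_measurable tpp.bm_mult tpp.bm_poly tpp.bm_ip xy)
      then show "(\<lambda>V. poly (jacobi_poly n \<alpha> \<beta>) (jp x V) * poly (jacobi_poly n \<alpha> \<beta>) (jp y V)) \<in> borel_measurable (Msig M rho)"
        unfolding measurable_cong_sets[OF sets_mu refl] .
    qed
    also have "\<dots> = jacobiP n \<alpha> \<beta> (cos (rho x y)) / (jacobi_a \<alpha> \<beta> n)\<^sup>2"
      unfolding jac[OF xy] using tpp.jacobi_reproducing[OF dim xy, of n] by (simp only: \<alpha> \<beta>)
    finally show ?thesis .
  qed
  moreover have "(jacobi_a \<alpha> \<beta> n)\<^sup>2 > 0" for n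
    unfolding \<alpha> \<beta> by (rule tpp.jacobi_a_eq(2)) (use dim in simp)
  ultimately show ?thesis
    unfolding reproducing_kernels_def using rho_nonneg cos_rho jp_xx by simp
qed

text \<open>In the projective cases the dimension k of the algebra gives d = (N - 1) k and \<beta> =
  k/2 - 1, that is -1/2, 0, 1 and 3.\<close>

lemma cpths_reproducing_kernels:
  assumes P: "prob_space P" and d: "d \<ge> 2" and M: "cpths d M rho \<alpha> \<beta>" and U: "uniform_on P M rho U"
  shows "reproducing_kernels P M rho \<alpha> \<beta> U"
proof -
  have proj: "reproducing_kernels P M rho \<alpha> \<beta> U"
    if kN: "k \<in> {1, 2, 4} \<and> N \<ge> 2 \<or> k = 8 \<and> N = 3" and dk: "(N - 1) * k = d" and ab: "\<alpha> = real d / 2 - 1" "\<beta> = real k / 2 - 1"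
      and f: "isometric_onto M rho (proj_set k N) (proj_dist N) f" for k N f
  proof (rule reproducing_kernels_model[OF P two_point_proj[OF kN] f _ U])
    have k: "k \<in> {1, 2, 4, 8}" using kN by auto
    have card: "card ({1..<N} \<times> alg_basis k) = d" using dk by (simp add: card_cartesian_product card_alg_basis[OF k])
    show "\<alpha> = card ({1..<N} \<times> alg_basis k) / 2 - 1" "\<beta> = real k / 2 - 1" unfolding card using ab by auto
    show "2 < card ({1..<N} \<times> alg_basis k) + real k" unfolding card using d k by auto
    show "proj_dist N x y = arccos (2 * pip N x y - 1)" if "y \<in> proj_set k N" for x y
      by (rule proj_dist_eq[OF that])
  qed
  consider f where "\<alpha> = (real d - 2) / 2" "\<beta> = (real d - 2) / 2" "isometric_onto M rho (sphere_set d) (sphere_dist d) f"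
    | f where "\<alpha> = (real d - 2) / 2" "\<beta> = - 1 / 2" "isometric_onto M rho (proj_set 1 (d + 1)) (proj_dist (d + 1)) f"
    | f where "even d" "d \<ge> 4" "\<alpha> = (real d - 2) / 2" "\<beta> = 0" "isometric_onto M rho (proj_set 2 (d div 2 + 1)) (proj_dist (d div 2 + 1)) f"
    | f where "4 dvd d" "d \<ge> 8" "\<alpha> = (real d - 2) / 2" "\<beta> = 1" "isometric_onto M rho (proj_set 4 (d div 4 + 1)) (proj_dist (d div 4 + 1)) f"
    | f where "d = 16" "\<alpha> = 7" "\<beta> = 3" "isometric_onto M rho (proj_set 8 3) (proj_dist 3) f"
    using M unfolding cpths_def by blast
  then show ?thesis
  proof cases
    case (1 f)
    have d1: "d \<ge> 1" using d by simp
    show ?thesis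
    proof (rule reproducing_kernels_model[OF P two_point_sphere[OF d1] 1(3) _ U])
      show "sphere_dist d x y = arccos (2 * sip d x y - 1)" for x y by (simp add: sphere_dist_def sip_def add_divide_distrib)
      show "\<alpha> = card {1..d} / 2 - 1" "\<beta> = real d / 2 - 1" using 1 by (simp_all add: diff_divide_distrib)
    qed (use d in simp)
  next
    case (2 f)
    then show ?thesis using d by (intro proj[of 1 "d + 1" f]) (simp_all add: diff_divide_distrib)
  next
    case (3 f)
    then show ?thesis by (intro proj[of 2 "d div 2 + 1" f]) (simp_all add: diff_divide_distrib)
  next
    case (4 f)
    then show ?thesis by (intro proj[of 4 "d div 4 + 1" f]) (simp_all add: diff_divide_distrib)
  next
    case (5 f)
    then show ?thesis by (intro proj[of 8 3 f]) simp_all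
  qed
qed

section \<open>Square integrable functions\<close>

definition sq_int :: "'w measure \<Rightarrow> ('w \<Rightarrow> real) \<Rightarrow> bool" where
  "sq_int P f \<longleftrightarrow> f \<in> borel_measurable P \<and> integrable P (\<lambda>w. (f w)\<^sup>2)"

lemma sq_int_measurable: "sq_int P f \<Longrightarrow> f \<in> borel_measurable P"
  and sq_int_sq: "sq_int P f \<Longrightarrow> integrable P (\<lambda>w. (f w)\<^sup>2)"
  by (auto simp: sq_int_def)

lemma sq_int_mult:
  assumes "sq_int P f" "sq_int P g" shows "integrable P (\<lambda>w. f w * g w)"
proof (rule Bochner_Integration.integrable_bound)
  show "integrable P (\<lambda>w. (f w)\<^sup>2 + (g w)\<^sup>2)" using assms by (auto simp: sq_int_def)
  show "(\<lambda>w. f w * g w) \<in> borel_measurable P" using assms by (auto simp: sq_int_def)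
  have "\<bar>x * y\<bar> \<le> x\<^sup>2 + y\<^sup>2" for x y :: real
  proof -
    have "2 * (\<bar>x\<bar> * \<bar>y\<bar>) \<le> \<bar>x\<bar>\<^sup>2 + \<bar>y\<bar>\<^sup>2"
      using sum_squares_bound[of "\<bar>x\<bar>" "\<bar>y\<bar>"] by simp
    moreover have "0 \<le> \<bar>x\<bar> * \<bar>y\<bar>" by simp
    ultimately have "\<bar>x\<bar> * \<bar>y\<bar> \<le> \<bar>x\<bar>\<^sup>2 + \<bar>y\<bar>\<^sup>2" by linarith
    then show ?thesis by (simp add: abs_mult)
  qed
  then show "AE w in P. norm (f w * g w) \<le> norm ((f w)\<^sup>2 + (g w)\<^sup>2)" by simp
qed

lemma sq_int_add: assumes "sq_int P f" "sq_int P g" shows "sq_int P (\<lambda>w. f w + g w)"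
proof -
  have "(\<lambda>w. (f w + g w)\<^sup>2) = (\<lambda>w. (f w)\<^sup>2 + (g w)\<^sup>2 + 2 * (f w * g w))" by (auto simp: power2_sum)
  then show ?thesis using assms sq_int_mult[OF assms] by (auto simp: sq_int_def)
qed

lemma sq_int_cmult: "sq_int P f \<Longrightarrow> sq_int P (\<lambda>w. c * f w)"
  by (auto simp: sq_int_def power_mult_distrib)

lemma sq_int_diff: "sq_int P f \<Longrightarrow> sq_int P g \<Longrightarrow> sq_int P (\<lambda>w. f w - g w)"
  using sq_int_add[of P f "\<lambda>w. (-1) * g w"] sq_int_cmult[of P g "-1"] by simp

lemma sq_int_zero: "sq_int P (\<lambda>_. 0)" by (simp add: sq_int_def)

lemma sq_int_sum: "(\<And>i. i \<in> A \<Longrightarrow> sq_int P (f i)) \<Longrightarrow> sq_int P (\<lambda>w. \<Sum>i\<in>A. f i w)"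
  by (induction A rule: infinite_finite_induct) (auto intro: sq_int_zero sq_int_add)

lemma Cauchy_Schwarz_integral:
  assumes f: "sq_int P f" and g: "sq_int P g"
  shows "\<bar>\<integral>w. f w * g w \<partial>P\<bar> \<le> sqrt (\<integral>w. (f w)\<^sup>2 \<partial>P) * sqrt (\<integral>w. (g w)\<^sup>2 \<partial>P)"
proof -
  define a b c where "a = (\<integral>w. (f w)\<^sup>2 \<partial>P)" and "b = (\<integral>w. f w * g w \<partial>P)" and "c = (\<integral>w. (g w)\<^sup>2 \<partial>P)"
  have q: "0 \<le> a - 2 * t * b + t\<^sup>2 * c" for t
  proof -
    have "0 \<le> (\<integral>w. (f w - t * g w)\<^sup>2 \<partial>P)" by simp
    also have "\<dots> = (\<integral>w. (f w)\<^sup>2 - 2 * t * (f w * g w) + t\<^sup>2 * (g w)\<^sup>2 \<partial>P)"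
      by (simp add: power2_diff power_mult_distrib algebra_simps)
    also have "\<dots> = a - 2 * t * b + t\<^sup>2 * c"
      unfolding a_def b_def c_def using sq_int_mult[OF f g] sq_int_sq[OF f] sq_int_sq[OF g] by simp
    finally show ?thesis .
  qed
  have ac: "0 \<le> a" "0 \<le> c" by (simp_all add: a_def c_def)
  have "b\<^sup>2 \<le> a * c"
  proof (cases "c = 0")
    case True
    have "b = 0"
    proof (rule ccontr)
      assume "b \<noteq> 0"
      \<comment> \<open>With c = 0 the nonnegative quadratic is affine in t; this t would make it
        equal to -1.\<close>
      then have "a - 2 * ((a + 1) / (2 * b)) * b = -1" by (simp add: field_simps)
      then show False using q[of "(a + 1) / (2 * b)"] True by simp
    qed
    then show ?thesis using ac by simp
  next
    case False
    \<comment> \<open>b / c is the minimiser of the quadratic.\<close>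
    have "0 \<le> a - 2 * (b / c) * b + (b / c)\<^sup>2 * c" by (rule q)
    also have "\<dots> = a - b\<^sup>2 / c" using False by (simp add: power2_eq_square field_simps)
    finally show ?thesis using ac False by (simp add: field_simps)
  qed
  then have "\<bar>b\<bar> \<le> sqrt (a * c)" by (metis real_sqrt_abs real_sqrt_le_iff)
  then show ?thesis by (simp add: a_def b_def c_def real_sqrt_mult)
qed

text \<open>With F = f - df and G = g - dg the difference of the products has three terms, each
  containing an error factor and hence small by Cauchy-Schwarz.\<close>

lemma L2_inner_tendsto:
  assumes F: "\<And>N. sq_int P (F N)" "sq_int P f" "(\<lambda>N. \<integral>w. (f w - F N w)\<^sup>2 \<partial>P) \<longlonglongrightarrow> 0"
    and G: "\<And>N. sq_int P (G N)" "sq_int P g" "(\<lambda>N. \<integral>w. (g w - G N w)\<^sup>2 \<partial>P) \<longlonglongrightarrow> 0"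
  shows "(\<lambda>N. \<integral>w. F N w * G N w \<partial>P) \<longlonglongrightarrow> (\<integral>w. f w * g w \<partial>P)"
proof -
  let ?n = "\<lambda>f. sqrt (\<integral>w. (f w)\<^sup>2 \<partial>P)"
  have zero: "(\<lambda>N. \<integral>w. h N w * k N w \<partial>P) \<longlonglongrightarrow> 0"
    if h: "\<And>N. sq_int P (h N)" and k: "\<And>N. sq_int P (k N)" and lim: "(\<lambda>N. ?n (h N) * ?n (k N)) \<longlonglongrightarrow> 0" for h k :: "nat \<Rightarrow> 'a \<Rightarrow> real"
    by (rule Lim_null_comparison[OF _ lim]) (use Cauchy_Schwarz_integral[OF h k] in simp)
  define df where "df = (\<lambda>N w. f w - F N w)"
  define dg where "dg = (\<lambda>N w. g w - G N w)"
  have d: "sq_int P (df N)" "sq_int P (dg N)" for N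
    unfolding df_def dg_def using F G by (auto intro: sq_int_diff)
  have l: "(\<lambda>N. ?n (df N)) \<longlonglongrightarrow> 0" "(\<lambda>N. ?n (dg N)) \<longlonglongrightarrow> 0"
    unfolding df_def dg_def using tendsto_real_sqrt[OF F(3)] tendsto_real_sqrt[OF G(3)] by simp_all
  have 1: "(\<lambda>N. \<integral>w. df N w * dg N w \<partial>P) \<longlonglongrightarrow> 0"
    using tendsto_mult[OF l] by (intro zero d) simp
  have 2: "(\<lambda>N. \<integral>w. df N w * g w \<partial>P) \<longlonglongrightarrow> 0"
    using tendsto_mult_left_zero[OF l(1), of "?n g"] by (intro zero d G)
  have 3: "(\<lambda>N. \<integral>w. f w * dg N w \<partial>P) \<longlonglongrightarrow> 0"
    using tendsto_mult_right_zero[OF l(2), of "?n f"] by (intro zero d F)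
  have "(\<integral>w. F N w * G N w \<partial>P) = (\<integral>w. f w * g w \<partial>P) + (\<integral>w. df N w * dg N w \<partial>P)
      - (\<integral>w. df N w * g w \<partial>P) - (\<integral>w. f w * dg N w \<partial>P)" for N
  proof -
    have "(\<integral>w. F N w * G N w \<partial>P) = (\<integral>w. f w * g w + df N w * dg N w - df N w * g w - f w * dg N w \<partial>P)"
      by (intro Bochner_Integration.integral_cong refl) (simp add: df_def dg_def algebra_simps)
    then show ?thesis
      using sq_int_mult[OF F(2) G(2)] sq_int_mult[OF d, of N N] sq_int_mult[OF d(1) G(2), of N] sq_int_mult[OF F(2) d(2), of N]
      by simp
  qed
  then show ?thesis using tendsto_diff[OF tendsto_diff[OF tendsto_add[OF tendsto_const 1] 2] 3] by simp
qed

context prob_space begin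

lemma sq_int_const: "sq_int M (\<lambda>_. c)"
  by (simp add: sq_int_def)

lemma sq_int_integrable: "sq_int M f \<Longrightarrow> integrable M f"
  using sq_int_mult[OF _ sq_int_const[of 1], of f] by simp

text \<open>Along a subsequence whose increments have \<open>L^2\<close> norm at most \<open>2 ^ - k\<close> the functions
  converge almost everywhere; Fatou's lemma gives convergence in \<open>L^2\<close> of the whole sequence.\<close>

lemma L2_complete:
  assumes F: "\<And>n. sq_int M (F n)"
    and cauchy: "\<And>e. e > 0 \<Longrightarrow> \<exists>N. \<forall>m\<ge>N. \<forall>n\<ge>N. expectation (\<lambda>w. (F m w - F n w)\<^sup>2) \<le> e"
  shows "\<exists>f. sq_int M f \<and> (\<lambda>n. expectation (\<lambda>w. (f w - F n w)\<^sup>2)) \<longlonglongrightarrow> 0"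
proof -
  have [measurable]: "F n \<in> borel_measurable M" for n using F by (simp add: sq_int_def)
  have D: "sq_int M (\<lambda>w. F m w - F n w)" for m n by (intro sq_int_diff F)
  obtain r where r: "\<And>k m n. m \<ge> r k \<Longrightarrow> n \<ge> r k \<Longrightarrow> expectation (\<lambda>w. (F m w - F n w)\<^sup>2) \<le> (1 / 4) ^ k"
    using cauchy[of "(1 / 4) ^ k" for k] by (metis zero_less_divide_1_iff zero_less_numeral zero_less_power)
  \<comment> \<open>The running maximum keeps the indices monotone. Strict growth is irrelevant:
    what matters is that R k passes r j from k = j on.\<close>
  define R where "R = (\<lambda>k. Max (r ` {..k}))"
  have R: "r k \<le> R k" "R k \<le> R (Suc k)" for k
    unfolding R_def by (auto intro!: Max_ge Max_mono)
  have R_ge: "r j \<le> R k" if "j \<le> k" for j k unfolding R_def using that by (intro Max_ge) auto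
  define T where "T = (\<lambda>k. F (R k))"
  have [measurable]: "T k \<in> borel_measurable M" for k by (simp add: T_def)
  \<comment> \<open>Cauchy-Schwarz against the constant 1 turns the squared bound (1/4)^k into a
    summable bound in mean.\<close>
  have inc: "expectation (\<lambda>w. \<bar>T (Suc k) w - T k w\<bar>) \<le> (1 / 2) ^ k" for k
  proof -
    let ?d = "\<lambda>w. T (Suc k) w - T k w"
    have "\<bar>\<integral>w. \<bar>?d w\<bar> * 1 \<partial>M\<bar> \<le> sqrt (\<integral>w. \<bar>?d w\<bar>\<^sup>2 \<partial>M) * sqrt (\<integral>w. 1\<^sup>2 \<partial>M)"
    proof (rule Cauchy_Schwarz_integral[OF _ sq_int_const])
      show "sq_int M (\<lambda>w. \<bar>?d w\<bar>)" using D unfolding T_def sq_int_def by simp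
    qed
    also have "\<dots> \<le> sqrt ((1 / 4) ^ k)"
      using r[of k "R (Suc k)" "R k"] R[of k] order_trans[OF R] by (simp add: prob_space T_def)
    also have "\<dots> = (1 / 2) ^ k"
      by (intro real_sqrt_unique) (simp_all add: power2_eq_square flip: power_mult_distrib)
    finally show ?thesis by simp
  qed
  have T_int: "integrable M (T k)" for k unfolding T_def by (rule sq_int_integrable[OF F])
  have "(\<integral>\<^sup>+w. (\<Sum>k. ennreal \<bar>T (Suc k) w - T k w\<bar>) \<partial>M) = (\<Sum>k. \<integral>\<^sup>+w. ennreal \<bar>T (Suc k) w - T k w\<bar> \<partial>M)"
    by (intro nn_integral_suminf) simp
  also have "\<dots> \<le> (\<Sum>k. ennreal ((1 / 2) ^ k))"
  proof (intro suminf_le summableI)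
    fix k
    have "(\<integral>\<^sup>+w. ennreal \<bar>T (Suc k) w - T k w\<bar> \<partial>M) = ennreal (expectation (\<lambda>w. \<bar>T (Suc k) w - T k w\<bar>))"
      by (intro nn_integral_eq_integral) (auto intro!: integrable_abs Bochner_Integration.integrable_diff T_int)
    also have "\<dots> \<le> ennreal ((1 / 2) ^ k)" by (intro ennreal_leI inc)
    finally show "(\<integral>\<^sup>+w. ennreal \<bar>T (Suc k) w - T k w\<bar> \<partial>M) \<le> ennreal ((1 / 2) ^ k)" .
  qed
  also have "\<dots> < \<infinity>"
    by (subst suminf_ennreal2) (auto simp: summable_geometric)
  finally have "AE w in M. (\<Sum>k. ennreal \<bar>T (Suc k) w - T k w\<bar>) \<noteq> \<infinity>"
    by (intro nn_integral_PInf_AE) auto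
  then have conv: "AE w in M. convergent (\<lambda>k. T k w)"
  proof eventually_elim
    case (elim w)
    then have "summable (\<lambda>k. \<bar>T (Suc k) w - T k w\<bar>)"
      by (intro summable_suminf_not_top) (auto simp: top_ennreal_def)
    then have "summable (\<lambda>k. T (Suc k) w - T k w)" by (rule summable_rabs_cancel)
    then have "convergent (\<lambda>n. (T n w - T 0 w) + T 0 w)"
      unfolding summable_iff_convergent sum_lessThan_telescope[of "\<lambda>k. T k w"] by (intro convergent_add convergent_const)
    then show ?case by simp
  qed
  define f where "f = (\<lambda>w. lim (\<lambda>k. T k w))"
  have [measurable]: "f \<in> borel_measurable M" unfolding f_def by measurable
  have lim: "AE w in M. (\<lambda>k. T k w) \<longlonglongrightarrow> f w"
    using conv by eventually_elim (simp add: f_def convergent_LIMSEQ_iff)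
  have fatou: "(\<integral>\<^sup>+w. ennreal ((f w - F n w)\<^sup>2) \<partial>M) \<le> ennreal e"
    if e: "\<And>m. m \<ge> N \<Longrightarrow> expectation (\<lambda>w. (F m w - F n w)\<^sup>2) \<le> e" and N: "\<forall>\<^sub>F k in sequentially. N \<le> R k" for e n N
  proof -
    have "(\<integral>\<^sup>+w. ennreal ((f w - F n w)\<^sup>2) \<partial>M) = (\<integral>\<^sup>+w. liminf (\<lambda>k. ennreal ((T k w - F n w)\<^sup>2)) \<partial>M)"
    proof (rule nn_integral_cong_AE)
      show "AE w in M. ennreal ((f w - F n w)\<^sup>2) = liminf (\<lambda>k. ennreal ((T k w - F n w)\<^sup>2))"
        using lim
      proof eventually_elim
        case (elim w)
        then have "(\<lambda>k. ennreal ((T k w - F n w)\<^sup>2)) \<longlonglongrightarrow> ennreal ((f w - F n w)\<^sup>2)"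
          by (intro tendsto_intros)
        then show ?case by (rule lim_imp_Liminf[OF sequentially_bot, symmetric])
      qed
    qed
    also have "\<dots> \<le> liminf (\<lambda>k. \<integral>\<^sup>+w. ennreal ((T k w - F n w)\<^sup>2) \<partial>M)"
      by (intro nn_integral_liminf) simp
    also have "\<dots> \<le> ennreal e"
    proof (rule Liminf_le)
      show "\<forall>\<^sub>F k in sequentially. (\<integral>\<^sup>+w. ennreal ((T k w - F n w)\<^sup>2) \<partial>M) \<le> ennreal e"
        using N
      proof eventually_elim
        case (elim k)
        have "(\<integral>\<^sup>+w. ennreal ((T k w - F n w)\<^sup>2) \<partial>M) = ennreal (expectation (\<lambda>w. (T k w - F n w)\<^sup>2))"
          unfolding T_def by (intro nn_integral_eq_integral sq_int_sq D) simp
        then show ?case using e[OF elim] unfolding T_def by (simp add: ennreal_leI)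
      qed
    qed simp
    finally show ?thesis .
  qed
  have ev: "\<forall>\<^sub>F k in sequentially. r j \<le> R k" for j
    using eventually_ge_at_top[of j] by eventually_elim (rule R_ge)
  have fd: "sq_int M (\<lambda>w. f w - F n w)" "expectation (\<lambda>w. (f w - F n w)\<^sup>2) \<le> (1 / 4) ^ j" if n: "n \<ge> r j" for n j
  proof -
    have le: "(\<integral>\<^sup>+w. ennreal ((f w - F n w)\<^sup>2) \<partial>M) \<le> ennreal ((1 / 4) ^ j)"
      by (rule fatou[OF r ev]) (use n in auto)
    show int: "sq_int M (\<lambda>w. f w - F n w)"
      unfolding sq_int_def by (intro conjI integrableI_bounded) (auto intro: le_less_trans[OF le])
    show "expectation (\<lambda>w. (f w - F n w)\<^sup>2) \<le> (1 / 4) ^ j"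
      using le by (subst (asm) nn_integral_eq_integral) (auto intro: sq_int_sq[OF int])
  qed
  have "sq_int M f"
    using sq_int_add[OF fd(1)[of 0 "r 0"] F[of "r 0"]] by simp
  moreover have "(\<lambda>n. expectation (\<lambda>w. (f w - F n w)\<^sup>2)) \<longlonglongrightarrow> 0"
  proof (rule LIMSEQ_I)
    fix e :: real assume "e > 0"
    then obtain j where j: "(1 / 4) ^ j < e" using real_arch_pow_inv[of e "1 / 4"] by auto
    show "\<exists>N. \<forall>n\<ge>N. norm (expectation (\<lambda>w. (f w - F n w)\<^sup>2) - 0) < e"
      using fd(2)[of j] j by (intro exI[of _ "r j"]) (auto intro: le_less_trans)
  qed
  ultimately show ?thesis by blast
qed

text \<open>By orthogonality the squared norm of a block of terms is the sum of the squared norms,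
  so the partial sums inherit the Cauchy property from the numerical series.\<close>

lemma orthogonal_series_converges:
  assumes W: "\<And>n. sq_int M (W n)" and orth: "\<And>n m. n \<noteq> m \<Longrightarrow> expectation (\<lambda>w. W n w * W m w) = 0"
    and sum: "summable (\<lambda>n. expectation (\<lambda>w. (W n w)\<^sup>2))"
  shows "\<exists>f. sq_int M f \<and> (\<lambda>N. expectation (\<lambda>w. (f w - (\<Sum>n<N. W n w))\<^sup>2)) \<longlonglongrightarrow> 0"
proof (rule L2_complete)
  show "sq_int M (\<lambda>w. \<Sum>n<N. W n w)" for N by (intro sq_int_sum W)
  have sq: "expectation (\<lambda>w. (\<Sum>i\<in>A. W i w)\<^sup>2) = (\<Sum>i\<in>A. expectation (\<lambda>w. (W i w)\<^sup>2))" if "finite A" for A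
    using that
  proof (induction A rule: finite_induct)
    case (insert a A)
    have sA: "sq_int M (\<lambda>w. \<Sum>i\<in>A. W i w)" by (intro sq_int_sum W)
    have "expectation (\<lambda>w. W a w * (\<Sum>i\<in>A. W i w)) = (\<Sum>i\<in>A. expectation (\<lambda>w. W a w * W i w))"
      unfolding sum_distrib_left by (intro Bochner_Integration.integral_sum sq_int_mult W)
    also have "\<dots> = 0" using insert by (intro sum.neutral ballI orth) auto
    finally have c: "expectation (\<lambda>w. W a w * (\<Sum>i\<in>A. W i w)) = 0" .
    have "expectation (\<lambda>w. (\<Sum>i\<in>insert a A. W i w)\<^sup>2)
        = expectation (\<lambda>w. (W a w)\<^sup>2 + (\<Sum>i\<in>A. W i w)\<^sup>2 + 2 * (W a w * (\<Sum>i\<in>A. W i w)))"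
      using insert by (simp add: power2_sum mult.assoc)
    also have "\<dots> = expectation (\<lambda>w. (W a w)\<^sup>2) + expectation (\<lambda>w. (\<Sum>i\<in>A. W i w)\<^sup>2)"
      using sq_int_sq[OF W[of a]] sq_int_sq[OF sA] sq_int_mult[OF W[of a] sA] c by simp
    finally show ?case using insert by simp
  qed simp
  fix e :: real assume e: "e > 0"
  obtain N where N: "\<And>m n. m \<ge> N \<Longrightarrow> norm (\<Sum>i\<in>{m..<n}. expectation (\<lambda>w. (W i w)\<^sup>2)) < e"
    using sum e unfolding summable_Cauchy by blast
  have diff: "expectation (\<lambda>w. ((\<Sum>i<n. W i w) - (\<Sum>i<m. W i w))\<^sup>2) \<le> e" if "m \<ge> N" "m \<le> n" for m n
  proof -
    have "(\<Sum>i<n. W i w) - (\<Sum>i<m. W i w) = (\<Sum>i\<in>{m..<n}. W i w)" for w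
      using that(2) sum_diff_nat_ivl[of 0 m n "\<lambda>i. W i w"] by (simp add: lessThan_atLeast0)
    then have "expectation (\<lambda>w. ((\<Sum>i<n. W i w) - (\<Sum>i<m. W i w))\<^sup>2) = (\<Sum>i\<in>{m..<n}. expectation (\<lambda>w. (W i w)\<^sup>2))"
      using sq[of "{m..<n}"] by simp
    then show ?thesis using N[OF that(1), of n] by simp
  qed
  show "\<exists>N. \<forall>m\<ge>N. \<forall>n\<ge>N. expectation (\<lambda>w. ((\<Sum>i<m. W i w) - (\<Sum>i<n. W i w))\<^sup>2) \<le> e"
  proof (intro exI[of _ N] allI impI)
    fix m n assume mn: "m \<ge> N" "n \<ge> N"
    show "expectation (\<lambda>w. ((\<Sum>i<m. W i w) - (\<Sum>i<n. W i w))\<^sup>2) \<le> e"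
    proof (cases "m \<le> n")
      case True then show ?thesis using diff[OF mn(1) True] by (simp add: power2_commute)
    next
      case False then show ?thesis using diff[OF mn(2)] by simp
    qed
  qed
qed

end

section \<open>The random field\<close>

text \<open>Independence is assumed for families of events, so any function measurable for the i-th
  family may be the i-th factor, for instance a product of two variables of the same
  process.\<close>

lemma (in prob_space) indep_sets_expectation_prod:
  fixes X :: "'i \<Rightarrow> 'a \<Rightarrow> real"
  assumes F: "indep_sets F UNIV" and I: "finite I"
    and X: "\<And>i. i \<in> I \<Longrightarrow> integrable M (X i)"
    and XF: "\<And>i A. i \<in> I \<Longrightarrow> A \<in> sets borel \<Longrightarrow> X i -` A \<inter> space M \<in> F i"
  shows "integrable M (\<lambda>w. \<Prod>i\<in>I. X i w)" "expectation (\<lambda>w. \<Prod>i\<in>I. X i w) = (\<Prod>i\<in>I. expectation (X i))"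
proof -
  have iv: "indep_vars (\<lambda>_. borel) X I"
    unfolding indep_vars_def2
  proof (intro conjI ballI)
    show "X i \<in> borel_measurable M" if "i \<in> I" for i using X[OF that] by simp
    have "indep_sets F I" by (rule indep_sets_mono_index[OF _ F]) simp
    then show "indep_sets (\<lambda>i. {X i -` A \<inter> space M |A. A \<in> sets borel}) I"
      by (rule indep_sets_mono_sets) (use XF in blast)
  qed
  show "integrable M (\<lambda>w. \<Prod>i\<in>I. X i w)" by (rule indep_vars_integrable[OF I iv]) (rule X)
  show "expectation (\<lambda>w. \<Prod>i\<in>I. X i w) = (\<Prod>i\<in>I. expectation (X i))"
    by (rule indep_vars_lebesgue_integral[OF I iv]) (rule X)
qed

lemma continuous_jacobiP: "continuous_on A (jacobiP n a b)"
proof -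
  have "jacobiP n a b = (\<lambda>x. poly (jacobi_poly n a b) ((1 + x) / 2))"
    unfolding poly_jacobi_poly by (simp add: field_simps)
  then show ?thesis by (auto intro!: continuous_intros)
qed

lemma jacobiP_bounded: "\<exists>K. \<forall>x\<in>{-1..1}. \<bar>jacobiP n a b x\<bar> \<le> K"
proof -
  have "compact (jacobiP n a b ` {-1..1})"
    by (intro compact_continuous_image continuous_jacobiP compact_Icc)
  then show ?thesis by (auto dest!: compact_imp_bounded simp: bounded_iff)
qed

lemma summable_tail:
  fixes f :: "nat \<Rightarrow> real"
  assumes f: "summable f" and e: "e > 0" shows "\<exists>N. (\<Sum>n. f (n + N)) < e"
proof -
  obtain N where "norm (\<Sum>i. f (i + N)) < e" using suminf_exist_split[OF e f] by blast
  then have "(\<Sum>n. f (n + N)) < e" by (simp add: abs_less_iff)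
  then show ?thesis ..
qed

text \<open>Orthogonality of the terms comes from independence of the \<open>V n\<close> with
  mean zero; the uniform variable contributes through the reproducing kernels.\<close>

locale kernel_series = prob_space P for P :: "'w measure" +
  fixes M :: "'p set" and rho :: "'p \<Rightarrow> 'p \<Rightarrow> real" and \<alpha> \<beta> :: real
    and U :: "'w \<Rightarrow> 'p" and K :: "'k set" and B :: "nat \<Rightarrow> 'k \<Rightarrow> 'k \<Rightarrow> real" and V :: "nat \<Rightarrow> 'k \<Rightarrow> 'w \<Rightarrow> real"
  assumes U: "U \<in> measurable P (Msig M rho)"
    and kernels: "reproducing_kernels P M rho \<alpha> \<beta> U"
    and V_sq: "k \<in> K \<Longrightarrow> sq_int P (V n k)"
    and V_mean: "k \<in> K \<Longrightarrow> expectation (V n k) = 0"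
    and V_cov: "k \<in> K \<Longrightarrow> l \<in> K \<Longrightarrow> expectation (\<lambda>w. V n k w * V n l w) = (jacobi_a \<alpha> \<beta> n)\<^sup>2 * B n k l"
    and B_sum: "k \<in> K \<Longrightarrow> summable (\<lambda>n. B n k k * jacobiP n \<alpha> \<beta> 1)"
    and indep: "indep_sets (\<lambda>i. case i of
                     None \<Rightarrow> {U -` A \<inter> space P | A. A \<in> sets (Msig M rho)}
                   | Some n \<Rightarrow> sigma_sets (space P) {V n k -` A \<inter> space P | k A. k \<in> K \<and> A \<in> sets borel}) UNIV"
begin

definition p :: "nat \<Rightarrow> 'p \<Rightarrow> 'w \<Rightarrow> real" where
  "p n x w = jacobiP n \<alpha> \<beta> (cos (rho x (U w)))"

definition F :: "nat option \<Rightarrow> 'w set set" where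
  "F i = (case i of
     None \<Rightarrow> {U -` A \<inter> space P | A. A \<in> sets (Msig M rho)}
   | Some n \<Rightarrow> sigma_sets (space P) {V n k -` A \<inter> space P | k A. k \<in> K \<and> A \<in> sets borel})"

lemma indep_F: "indep_sets F UNIV"
  using indep unfolding F_def[abs_def] .

text \<open>The events of the n-th process as a measurable space, so that products of its variables
  are covered by the ordinary measurability rules.\<close>

definition G :: "nat \<Rightarrow> 'w measure" where
  "G n = sigma (space P) {V n k -` A \<inter> space P | k A. k \<in> K \<and> A \<in> sets borel}"

lemma G: "space (G n) = space P" "sets (G n) = F (Some n)"
proof -
  have "{V n k -` A \<inter> space P | k A. k \<in> K \<and> A \<in> sets borel} \<subseteq> Pow (space P)" by auto
  then show "space (G n) = space P" "sets (G n) = F (Some n)"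
    by (simp_all add: G_def F_def)
qed

lemma V_G: "k \<in> K \<Longrightarrow> V n k \<in> borel_measurable (G n)"
proof (rule measurableI)
  fix A :: "real set" assume "k \<in> K" "A \<in> sets borel"
  then have "V n k -` A \<inter> space P \<in> F (Some n)" unfolding F_def by (auto intro!: sigma_sets.Basic)
  then show "V n k -` A \<inter> space (G n) \<in> sets (G n)" by (simp add: G)
qed simp

lemma G_in_F: "f \<in> borel_measurable (G n) \<Longrightarrow> A \<in> sets borel \<Longrightarrow> f -` A \<inter> space P \<in> F (Some n)"
  using measurable_sets[of f "G n" borel A] by (simp add: G)

lemma U_in_F:
  assumes "f \<in> borel_measurable (Msig M rho)" "A \<in> sets borel"
  shows "(\<lambda>w. f (U w)) -` A \<inter> space P \<in> F None"
proof -
  have "(\<lambda>w. f (U w)) -` A \<inter> space P = U -` (f -` A \<inter> space (Msig M rho)) \<inter> space P"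
    using measurable_space[OF U] by auto
  moreover have "f -` A \<inter> space (Msig M rho) \<in> sets (Msig M rho)" using assms by (rule measurable_sets)
  ultimately show ?thesis unfolding F_def option.case by blast
qed

lemma kernel_measurable: "x \<in> M \<Longrightarrow> (\<lambda>v. jacobiP n \<alpha> \<beta> (cos (rho x v))) \<in> borel_measurable (Msig M rho)"
proof -
  assume x: "x \<in> M"
  have "(\<lambda>v. cos (rho x v)) \<in> borel_measurable (Msig M rho)" using rho_measurable[OF x, of rho] by measurable
  then show ?thesis
    by (rule measurable_compose) (intro borel_measurable_continuous_onI continuous_jacobiP)
qed

lemma p_measurable: "x \<in> M \<Longrightarrow> p n x \<in> borel_measurable P"
  using measurable_compose[OF U kernel_measurable] unfolding p_def[abs_def] .

lemma p_bounded: "\<exists>C. \<forall>x w. \<bar>p n x w\<bar> \<le> C"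
proof -
  obtain C where "\<forall>x\<in>{-1..1}. \<bar>jacobiP n \<alpha> \<beta> x\<bar> \<le> C" using jacobiP_bounded by blast
  then have "\<bar>p n x w\<bar> \<le> C" for x w unfolding p_def by simp
  then show ?thesis by blast
qed

lemma pp_integrable:
  assumes "x \<in> M" "y \<in> M" shows "integrable P (\<lambda>w. p n x w * p m y w)"
proof -
  obtain C D where C: "\<And>x w. \<bar>p n x w\<bar> \<le> C" and D: "\<And>x w. \<bar>p m x w\<bar> \<le> D" using p_bounded by metis
  have "\<bar>p n x w * p m y w\<bar> \<le> C * D" for w
    unfolding abs_mult using C D by (intro mult_mono) (auto intro: order_trans[OF abs_ge_zero])
  then show ?thesis
    by (intro integrable_const_bound[of _ "C * D"]) (use p_measurable assms in auto)
qed

lemma p_integrable: "x \<in> M \<Longrightarrow> integrable P (p n x)"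
proof -
  assume x: "x \<in> M"
  obtain C where "\<And>x w. \<bar>p n x w\<bar> \<le> C" using p_bounded by metis
  then show ?thesis by (intro integrable_const_bound[of _ C]) (use p_measurable x in auto)
qed

lemma expectation_pp:
  "x \<in> M \<Longrightarrow> y \<in> M \<Longrightarrow> expectation (\<lambda>w. p n x w * p n y w) = jacobiP n \<alpha> \<beta> (cos (rho x y)) / (jacobi_a \<alpha> \<beta> n)\<^sup>2"
  using kernels unfolding reproducing_kernels_def p_def by blast

lemma jacobi_a_pos: "(jacobi_a \<alpha> \<beta> n)\<^sup>2 > 0"
  and rho_nonneg: "x \<in> M \<Longrightarrow> y \<in> M \<Longrightarrow> 0 \<le> rho x y" and cos_rho_refl: "x \<in> M \<Longrightarrow> cos (rho x x) = 1"
  using kernels unfolding reproducing_kernels_def by blast+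

section \<open>Second moments of the terms and partial sums\<close>

definition W :: "nat \<Rightarrow> 'p \<Rightarrow> 'k \<Rightarrow> 'w \<Rightarrow> real" where
  "W n x k w = V n k w * p n x w"

lemma W_sq: assumes "x \<in> M" "k \<in> K" shows "sq_int P (W n x k)"
proof -
  obtain C where C: "\<And>x w. \<bar>p n x w\<bar> \<le> C" using p_bounded by metis
  have m: "W n x k \<in> borel_measurable P"
    unfolding W_def[abs_def] using sq_int_measurable[OF V_sq[OF assms(2)]] p_measurable[OF assms(1)] by measurable
  have le: "(W n x k w)\<^sup>2 \<le> C\<^sup>2 * (V n k w)\<^sup>2" for w
  proof -
    have "(p n x w)\<^sup>2 \<le> C\<^sup>2" using C[of x w] by (metis abs_ge_zero power2_abs power_mono)
    then have "(p n x w)\<^sup>2 * (V n k w)\<^sup>2 \<le> C\<^sup>2 * (V n k w)\<^sup>2" by (rule mult_right_mono) simp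
    then show ?thesis unfolding W_def power_mult_distrib by (simp add: mult.commute)
  qed
  have "integrable P (\<lambda>w. (W n x k w)\<^sup>2)"
    by (rule Bochner_Integration.integrable_bound[where f = "\<lambda>w. C\<^sup>2 * (V n k w)\<^sup>2"])
       (use sq_int_sq[OF V_sq[OF assms(2)]] m le in auto)
  then show ?thesis using m by (simp add: sq_int_def)
qed

lemma W_mean: assumes "x \<in> M" "k \<in> K" shows "expectation (W n x k) = 0"
proof -
  let ?X = "\<lambda>i. case i of None \<Rightarrow> p n x | Some _ \<Rightarrow> V n k"
  have "expectation (\<lambda>w. \<Prod>i\<in>{None, Some n}. ?X i w) = (\<Prod>i\<in>{None, Some n}. expectation (?X i))"
  proof (rule indep_sets_expectation_prod[OF indep_F])
    show "integrable P (?X i)" if "i \<in> {None, Some n}" for i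
      using that p_integrable assms sq_int_integrable[OF V_sq] by auto
    show "?X i -` A \<inter> space P \<in> F i" if "i \<in> {None, Some n}" "A \<in> sets borel" for i A
      using that U_in_F[OF kernel_measurable[OF assms(1)], of A n] G_in_F[OF V_G[OF assms(2)], of A n]
      by (auto simp: p_def[abs_def])
  qed simp
  then show ?thesis using V_mean[OF assms(2)] by (simp add: W_def[abs_def] mult.commute)
qed

text \<open>There are three independent factors: both kernels together as one function of U, and one
  variable from each process. A single vanishing mean annihilates the product.\<close>

lemma W_orthogonal:
  assumes "n \<noteq> m" "x \<in> M" "y \<in> M" "k \<in> K" "l \<in> K"
  shows "expectation (\<lambda>w. W n x k w * W m y l w) = 0"
proof -
  let ?f = "\<lambda>v. jacobiP n \<alpha> \<beta> (cos (rho x v)) * jacobiP m \<alpha> \<beta> (cos (rho y v))"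
  let ?X = "\<lambda>i. case i of None \<Rightarrow> (\<lambda>w. p n x w * p m y w) | Some j \<Rightarrow> if j = n then V n k else V m l"
  let ?I = "{None, Some n, Some m}"
  have f: "?f \<in> borel_measurable (Msig M rho)" by (intro borel_measurable_times kernel_measurable assms)
  have "expectation (\<lambda>w. \<Prod>i\<in>?I. ?X i w) = (\<Prod>i\<in>?I. expectation (?X i))"
  proof (rule indep_sets_expectation_prod[OF indep_F])
    show "integrable P (?X i)" if "i \<in> ?I" for i
      using that pp_integrable[OF assms(2,3)] assms sq_int_integrable[OF V_sq] by auto
    show "?X i -` A \<inter> space P \<in> F i" if "i \<in> ?I" "A \<in> sets borel" for i A
      using that U_in_F[OF f, of A] G_in_F[OF V_G[OF assms(4)], of A n] G_in_F[OF V_G[OF assms(5)], of A m] assms(1)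
      by (auto simp: p_def[abs_def])
  qed simp
  moreover have "(\<Prod>i\<in>?I. expectation (?X i)) = 0" using assms(1) V_mean[OF assms(4)] by simp
  moreover have "(\<Prod>i\<in>?I. ?X i w) = W n x k w * W m y l w" for w
    using assms(1) by (simp add: W_def)
  ultimately show ?thesis by simp
qed

text \<open>The factor a_n^2 in the covariance of the process cancels the 1 / a_n^2 of the
  reproducing formula.\<close>

lemma W_covariance:
  assumes "x \<in> M" "y \<in> M" "k \<in> K" "l \<in> K"
  shows "expectation (\<lambda>w. W n x k w * W n y l w) = B n k l * jacobiP n \<alpha> \<beta> (cos (rho x y))"
proof -
  let ?f = "\<lambda>v. jacobiP n \<alpha> \<beta> (cos (rho x v)) * jacobiP n \<alpha> \<beta> (cos (rho y v))"
  let ?X = "\<lambda>i. case i of None \<Rightarrow> (\<lambda>w. p n x w * p n y w) | Some _ \<Rightarrow> (\<lambda>w. V n k w * V n l w)"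
  let ?I = "{None, Some n}"
  have f: "?f \<in> borel_measurable (Msig M rho)" by (intro borel_measurable_times kernel_measurable assms)
  have VV: "(\<lambda>w. V n k w * V n l w) \<in> borel_measurable (G n)" by (intro borel_measurable_times V_G assms)
  have "expectation (\<lambda>w. \<Prod>i\<in>?I. ?X i w) = (\<Prod>i\<in>?I. expectation (?X i))"
  proof (rule indep_sets_expectation_prod[OF indep_F])
    show "integrable P (?X i)" if "i \<in> ?I" for i
      using that pp_integrable[OF assms(1,2)] sq_int_mult[OF V_sq[OF assms(3)] V_sq[OF assms(4)]] by auto
    show "?X i -` A \<inter> space P \<in> F i" if "i \<in> ?I" "A \<in> sets borel" for i A
      using that U_in_F[OF f, of A] G_in_F[OF VV, of A] by (auto simp: p_def[abs_def])
  qed simp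
  moreover have "(\<Prod>i\<in>?I. expectation (?X i)) = B n k l * jacobiP n \<alpha> \<beta> (cos (rho x y))"
    using expectation_pp[OF assms(1,2), of n] V_cov[OF assms(3,4), of n] jacobi_a_pos[of n] by simp
  moreover have "(\<Prod>i\<in>?I. ?X i w) = W n x k w * W n y l w" for w
    by (simp add: W_def)
  ultimately show ?thesis by simp
qed

definition partial :: "nat \<Rightarrow> 'p \<Rightarrow> 'k \<Rightarrow> 'w \<Rightarrow> real" where
  "partial N x k w = (\<Sum>n<N. W n x k w)"

lemma partial_sq: "x \<in> M \<Longrightarrow> k \<in> K \<Longrightarrow> sq_int P (partial N x k)"
  unfolding partial_def[abs_def] by (intro sq_int_sum W_sq)

lemma partial_covariance:
  assumes "x \<in> M" "y \<in> M" "k \<in> K" "l \<in> K"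
  shows "expectation (\<lambda>w. partial N x k w * partial N y l w) = (\<Sum>n<N. B n k l * jacobiP n \<alpha> \<beta> (cos (rho x y)))"
proof -
  have "expectation (\<lambda>w. partial N x k w * partial N y l w) = (\<Sum>n<N. \<Sum>m<N. expectation (\<lambda>w. W n x k w * W m y l w))"
    unfolding partial_def sum_product
    by (subst Bochner_Integration.integral_sum, intro Bochner_Integration.integrable_sum sq_int_mult W_sq assms,
        intro sum.cong refl Bochner_Integration.integral_sum sq_int_mult W_sq assms)
  also have "\<dots> = (\<Sum>n<N. \<Sum>m<N. if m = n then B n k l * jacobiP n \<alpha> \<beta> (cos (rho x y)) else 0)"
    by (intro sum.cong refl) (use W_orthogonal W_covariance assms in auto)
  finally show ?thesis by simp
qed

section \<open>The limit field: covariance and continuity\<close>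

lemma limit_exists:
  assumes "x \<in> M" "k \<in> K"
  shows "\<exists>f. sq_int P f \<and> (\<lambda>N. expectation (\<lambda>w. (f w - partial N x k w)\<^sup>2)) \<longlonglongrightarrow> 0"
  unfolding partial_def
proof (rule orthogonal_series_converges)
  show "sq_int P (W n x k)" for n by (rule W_sq[OF assms])
  show "expectation (\<lambda>w. W n x k w * W m x k w) = 0" if "n \<noteq> m" for n m by (rule W_orthogonal) (use that assms in auto)
  show "summable (\<lambda>n. expectation (\<lambda>w. (W n x k w)\<^sup>2))"
    unfolding power2_eq_square W_covariance[OF assms(1,1,2,2)] cos_rho_refl[OF assms(1)] by (rule B_sum[OF assms(2)])
qed

text \<open>Convergence in mean square fixes the limit only almost everywhere, so a representative
  is chosen for each x and k.\<close>

definition Z :: "'p \<Rightarrow> 'k \<Rightarrow> 'w \<Rightarrow> real" where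
  "Z x k = (SOME f. sq_int P f \<and> (\<lambda>N. expectation (\<lambda>w. (f w - partial N x k w)\<^sup>2)) \<longlonglongrightarrow> 0)"

lemma Z_sq: "x \<in> M \<Longrightarrow> k \<in> K \<Longrightarrow> sq_int P (Z x k)"
  and Z_lim: "x \<in> M \<Longrightarrow> k \<in> K \<Longrightarrow> (\<lambda>N. expectation (\<lambda>w. (Z x k w - partial N x k w)\<^sup>2)) \<longlonglongrightarrow> 0"
  using someI_ex[OF limit_exists] unfolding Z_def[symmetric] by blast+

lemma Z_mean: assumes "x \<in> M" "k \<in> K" shows "expectation (Z x k) = 0"
proof -
  have "(\<lambda>N. expectation (\<lambda>w. partial N x k w * 1)) \<longlonglongrightarrow> expectation (\<lambda>w. Z x k w * 1)"
    by (rule L2_inner_tendsto) (auto intro: partial_sq Z_sq Z_lim assms sq_int_const)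
  moreover have "expectation (partial N x k) = 0" for N
    unfolding partial_def[abs_def]
    by (subst Bochner_Integration.integral_sum) (auto intro: sq_int_integrable W_sq assms simp: W_mean assms)
  ultimately show ?thesis by (simp add: LIMSEQ_const_iff)
qed

lemma Z_covariance:
  assumes "x \<in> M" "y \<in> M" "k \<in> K" "l \<in> K"
  shows "(\<lambda>n. B n k l * jacobiP n \<alpha> \<beta> (cos (rho x y))) sums expectation (\<lambda>w. Z x k w * Z y l w)"
proof -
  have "(\<lambda>N. expectation (\<lambda>w. partial N x k w * partial N y l w)) \<longlonglongrightarrow> expectation (\<lambda>w. Z x k w * Z y l w)"
    by (rule L2_inner_tendsto) (auto intro: partial_sq Z_sq Z_lim assms)
  then show ?thesis unfolding partial_covariance[OF assms] sums_def .
qed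

lemma Z_covar: "x \<in> M \<Longrightarrow> y \<in> M \<Longrightarrow> k \<in> K \<Longrightarrow> l \<in> K \<Longrightarrow> covar P (Z x k) (Z y l) = expectation (\<lambda>w. Z x k w * Z y l w)"
  by (simp add: covar_def Z_mean)

text \<open>Positive definiteness of the kernel: the second moment of p_x + s p_y is nonnegative for
  s = 1 and s = -1. This gives the bound at all distances that occur in the space.\<close>

lemma jacobiP_le_1:
  assumes "x \<in> M" "y \<in> M" shows "\<bar>jacobiP n \<alpha> \<beta> (cos (rho x y))\<bar> \<le> jacobiP n \<alpha> \<beta> 1"
proof -
  let ?a = "(jacobi_a \<alpha> \<beta> n)\<^sup>2"
  have sq: "expectation (\<lambda>w. p n z w * p n z w) = jacobiP n \<alpha> \<beta> 1 / ?a" if "z \<in> M" for z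
    using expectation_pp[OF that that, of n] cos_rho_refl[OF that] by simp
  have ge: "0 \<le> 2 * (jacobiP n \<alpha> \<beta> 1 / ?a) + 2 * s * (jacobiP n \<alpha> \<beta> (cos (rho x y)) / ?a)" if "s\<^sup>2 = 1" for s
  proof -
    have "0 \<le> expectation (\<lambda>w. (p n x w + s * p n y w)\<^sup>2)" by simp
    also have "\<dots> = expectation (\<lambda>w. p n x w * p n x w + p n y w * p n y w + 2 * s * (p n x w * p n y w))"
    proof (intro Bochner_Integration.integral_cong refl)
      fix w
      have "(p n x w + s * p n y w)\<^sup>2 = p n x w * p n x w + s\<^sup>2 * (p n y w * p n y w) + 2 * s * (p n x w * p n y w)"
        by (simp add: power2_eq_square algebra_simps)
      then show "(p n x w + s * p n y w)\<^sup>2 = p n x w * p n x w + p n y w * p n y w + 2 * s * (p n x w * p n y w)"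
        using that by simp
    qed
    also have "\<dots> = 2 * (jacobiP n \<alpha> \<beta> 1 / ?a) + 2 * s * (jacobiP n \<alpha> \<beta> (cos (rho x y)) / ?a)"
      by (simp add: pp_integrable assms sq expectation_pp)
    finally show ?thesis .
  qed
  have "jacobiP n \<alpha> \<beta> (cos (rho x y)) / ?a \<le> jacobiP n \<alpha> \<beta> 1 / ?a"
    "- (jacobiP n \<alpha> \<beta> (cos (rho x y)) / ?a) \<le> jacobiP n \<alpha> \<beta> 1 / ?a"
    using ge[of 1] ge[of "-1"] by simp_all
  then have "jacobiP n \<alpha> \<beta> (cos (rho x y)) \<le> jacobiP n \<alpha> \<beta> 1" "- jacobiP n \<alpha> \<beta> (cos (rho x y)) \<le> jacobiP n \<alpha> \<beta> 1"
    unfolding minus_divide_left by (simp_all only: divide_le_cancel) (use jacobi_a_pos[of n] in auto)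
  then show ?thesis by (rule abs_leI)
qed

lemma B_nonneg: "k \<in> K \<Longrightarrow> 0 \<le> B n k k"
proof -
  assume k: "k \<in> K"
  have "0 \<le> expectation (\<lambda>w. V n k w * V n k w)" by simp
  then show ?thesis using V_cov[OF k k, of n] jacobi_a_pos[of n] by (simp add: zero_le_mult_iff)
qed

lemma Z_increment:
  assumes x: "x \<in> M" and y: "y \<in> M" and k: "k \<in> K"
  shows "(\<lambda>n. 2 * (B n k k * (jacobiP n \<alpha> \<beta> 1 - jacobiP n \<alpha> \<beta> (cos (rho x y))))) sums expectation (\<lambda>w. (Z x k w - Z y k w)\<^sup>2)"
proof -
  have "expectation (\<lambda>w. (Z x k w - Z y k w)\<^sup>2)
      = expectation (\<lambda>w. Z x k w * Z x k w + Z y k w * Z y k w - 2 * (Z x k w * Z y k w))"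
    by (simp add: power2_eq_square algebra_simps)
  also have "\<dots> = expectation (\<lambda>w. Z x k w * Z x k w) + expectation (\<lambda>w. Z y k w * Z y k w) - 2 * expectation (\<lambda>w. Z x k w * Z y k w)"
    using sq_int_mult[OF Z_sq[OF x k] Z_sq[OF x k]] sq_int_mult[OF Z_sq[OF y k] Z_sq[OF y k]] sq_int_mult[OF Z_sq[OF x k] Z_sq[OF y k]]
    by simp
  finally have e: "expectation (\<lambda>w. (Z x k w - Z y k w)\<^sup>2) =
     expectation (\<lambda>w. Z x k w * Z x k w) + expectation (\<lambda>w. Z y k w * Z y k w) - 2 * expectation (\<lambda>w. Z x k w * Z y k w)" .
  have "(\<lambda>n. B n k k * jacobiP n \<alpha> \<beta> (cos (rho x x)) + B n k k * jacobiP n \<alpha> \<beta> (cos (rho y y))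
      - 2 * (B n k k * jacobiP n \<alpha> \<beta> (cos (rho x y)))) sums expectation (\<lambda>w. (Z x k w - Z y k w)\<^sup>2)"
    unfolding e by (intro sums_diff sums_add sums_mult Z_covariance x y k)
  then show ?thesis unfolding cos_rho_refl[OF x] cos_rho_refl[OF y] by (simp add: algebra_simps)
qed

text \<open>The increments are a series in the distance whose tail is bounded, uniformly in x and y,
  by four times the tail of the convergent series at 1; the finite head is continuous in the
  distance and vanishes at 0.\<close>

lemma Z_continuous:
  assumes k: "k \<in> K" and e: "e > 0"
  shows "\<exists>\<delta>>0. \<forall>x\<in>M. \<forall>y\<in>M. rho x y < \<delta> \<longrightarrow> expectation (\<lambda>w. (Z x k w - Z y k w)\<^sup>2) < e"
proof -
  let ?J = "jacobiP"
  have sum4: "summable (\<lambda>n. 4 * (B n k k * ?J n \<alpha> \<beta> 1))" by (intro summable_mult B_sum k)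
  obtain N where N: "(\<Sum>n. 4 * (B (n + N) k k * ?J (n + N) \<alpha> \<beta> 1)) < e / 2"
    using summable_tail[OF sum4, of "e / 2"] e by auto
  define q where "q = (\<lambda>r. \<Sum>n<N. 2 * (B n k k * (?J n \<alpha> \<beta> 1 - ?J n \<alpha> \<beta> (cos r))))"
  have "continuous_on UNIV q"
    unfolding q_def by (intro continuous_intros continuous_on_compose2[OF continuous_jacobiP]) auto
  then have "isCont q 0" by (simp add: continuous_on_eq_continuous_at)
  moreover have "e / 2 > 0" using e by simp
  ultimately have "\<exists>\<delta>>0. \<forall>r. \<bar>r - 0\<bar> < \<delta> \<longrightarrow> \<bar>q r - q 0\<bar> < e / 2"
    unfolding continuous_at_eps_delta dist_real_def by blast
  then obtain \<delta> where \<delta>: "\<delta> > 0" "\<And>r. \<bar>r\<bar> < \<delta> \<Longrightarrow> \<bar>q r\<bar> < e / 2" by (auto simp: q_def)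
  have "expectation (\<lambda>w. (Z x k w - Z y k w)\<^sup>2) < e" if xy: "x \<in> M" "y \<in> M" "rho x y < \<delta>" for x y
  proof -
    let ?t = "\<lambda>n. 2 * (B n k k * (?J n \<alpha> \<beta> 1 - ?J n \<alpha> \<beta> (cos (rho x y))))"
    have s: "?t sums expectation (\<lambda>w. (Z x k w - Z y k w)\<^sup>2)" by (rule Z_increment[OF xy(1,2) k])
    have "?t n \<le> 4 * (B n k k * ?J n \<alpha> \<beta> 1)" for n
    proof -
      have "?J n \<alpha> \<beta> 1 - ?J n \<alpha> \<beta> (cos (rho x y)) \<le> 2 * ?J n \<alpha> \<beta> 1"
        using jacobiP_le_1[OF xy(1,2), of n] by linarith
      then have "B n k k * (?J n \<alpha> \<beta> 1 - ?J n \<alpha> \<beta> (cos (rho x y))) \<le> B n k k * (2 * ?J n \<alpha> \<beta> 1)"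
        by (rule mult_left_mono[OF _ B_nonneg[OF k]])
      then show ?thesis by simp
    qed
    then have "(\<Sum>n. ?t (n + N)) \<le> (\<Sum>n. 4 * (B (n + N) k k * ?J (n + N) \<alpha> \<beta> 1))"
      by (intro suminf_le summable_ignore_initial_segment[OF sums_summable[OF s], of N]
          summable_ignore_initial_segment[OF sum4, of N])
    moreover have "expectation (\<lambda>w. (Z x k w - Z y k w)\<^sup>2) = (\<Sum>n. ?t (n + N)) + q (rho x y)"
      using suminf_split_initial_segment[OF sums_summable[OF s], of N] sums_unique[OF s] by (simp add: q_def)
    moreover have "\<bar>q (rho x y)\<bar> < e / 2"
      by (rule \<delta>(2)) (use xy rho_nonneg[OF xy(1,2)] in simp)
    ultimately show ?thesis using N by linarith
  qed
  then show ?thesis using \<delta>(1) by blast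
qed

end

theorem theorem5:
  fixes P :: "'w measure"
    and M :: "'p set" and rho :: "'p \<Rightarrow> 'p \<Rightarrow> real"
    and d m :: nat and alpha beta :: real
    and T :: "real set"
    and B :: "nat \<Rightarrow> real \<Rightarrow> nat \<Rightarrow> nat \<Rightarrow> real"
    and V :: "nat \<Rightarrow> real \<Rightarrow> 'w \<Rightarrow> nat \<Rightarrow> real"
    and U :: "'w \<Rightarrow> 'p"
  assumes P: "prob_space P"
    and d: "d \<ge> 2" and m: "m \<ge> 1"
    and M: "cpths d M rho alpha beta"
    and T: "T = UNIV \<or> T = \<int>"
    and B_cov: "\<And>n. stat_cov_fun T m (B n)"
    and B_sum: "\<And>k l. k < m \<Longrightarrow> l < m \<Longrightarrow>
                  summable (\<lambda>n. B n 0 k l * jacobiP n alpha beta 1)"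
    and V_meas: "\<And>n t k. t \<in> T \<Longrightarrow> k < m \<Longrightarrow>
                  (\<lambda>w. V n t w k) \<in> borel_measurable P \<and> integrable P (\<lambda>w. (V n t w k)^2)"
    and V_mean: "\<And>n t k. t \<in> T \<Longrightarrow> k < m \<Longrightarrow> (\<integral>w. V n t w k \<partial>P) = 0"
    and V_cov: "\<And>n t1 t2 k l. t1 \<in> T \<Longrightarrow> t2 \<in> T \<Longrightarrow> k < m \<Longrightarrow> l < m \<Longrightarrow>
                  covar P (\<lambda>w. V n t1 w k) (\<lambda>w. V n t2 w l)
                    = (jacobi_a alpha beta n)^2 * B n (t1 - t2) k l"
    and U_unif: "uniform_on P M rho U"
    and indep: "prob_space.indep_sets P
                  (\<lambda>i. case i of
                     None \<Rightarrow> {U -` A \<inter> space P | A. A \<in> sets (Msig M rho)}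
                   | Some n \<Rightarrow> sigma_sets (space P)
                       {(\<lambda>w. V n t w k) -` A \<inter> space P | t k A. t \<in> T \<and> k < m \<and> A \<in> sets borel})
                  UNIV"
  shows "\<exists>Z :: 'p \<Rightarrow> real \<Rightarrow> 'w \<Rightarrow> nat \<Rightarrow> real.
     \<comment> \<open>Z is a second-order random field, the mean-square limit of the series\<close>
     (\<forall>x\<in>M. \<forall>t\<in>T. \<forall>k<m.
        (\<lambda>w. Z x t w k) \<in> borel_measurable P \<and> integrable P (\<lambda>w. (Z x t w k)^2) \<and>
        (\<lambda>N. \<integral>w. (Z x t w k - (\<Sum>n<N. V n t w k * jacobiP n alpha beta (cos (rho x (U w)))))^2 \<partial>P)
           \<longlonglongrightarrow> 0)
     \<comment> \<open>mean zero\<close>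
   \<and> (\<forall>x\<in>M. \<forall>t\<in>T. \<forall>k<m. (\<integral>w. Z x t w k \<partial>P) = 0)
     \<comment> \<open>covariance matrix function\<close>
   \<and> (\<forall>x1\<in>M. \<forall>x2\<in>M. \<forall>t1\<in>T. \<forall>t2\<in>T. \<forall>k<m. \<forall>l<m.
        (\<lambda>n. B n (t1 - t2) k l * jacobiP n alpha beta (cos (rho x1 x2)))
          sums covar P (\<lambda>w. Z x1 t1 w k) (\<lambda>w. Z x2 t2 w l))
     \<comment> \<open>isotropic over M and stationary over T\<close>
   \<and> (\<forall>x1\<in>M. \<forall>x2\<in>M. \<forall>y1\<in>M. \<forall>y2\<in>M. \<forall>t1\<in>T. \<forall>t2\<in>T. \<forall>s1\<in>T. \<forall>s2\<in>T. \<forall>k<m. \<forall>l<m.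
        rho x1 x2 = rho y1 y2 \<longrightarrow> t1 - t2 = s1 - s2 \<longrightarrow>
        covar P (\<lambda>w. Z x1 t1 w k) (\<lambda>w. Z x2 t2 w l) = covar P (\<lambda>w. Z y1 s1 w k) (\<lambda>w. Z y2 s2 w l))
     \<comment> \<open>mean square continuous on M\<close>
   \<and> (\<forall>t\<in>T. \<forall>k<m. \<forall>e>0. \<exists>\<delta>>0. \<forall>x1\<in>M. \<forall>x2\<in>M.
        rho x1 x2 < \<delta> \<longrightarrow> (\<integral>w. (Z x1 t w k - Z x2 t w k)^2 \<partial>P) < e)"
proof -
  interpret prob_space P by (rule P)
  \<comment> \<open>Time and component are merged into one index, so that mean, covariance and
    independence are statements about a single family of variables.\<close>
  define K where "K = T \<times> {..<m}"
  define V' where "V' = (\<lambda>n (t, k) w. V n t w k)"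
  define B' where "B' = (\<lambda>n (t1, k) (t2, l). B n (t1 - t2) k l)"
  have gens: "{V' n k -` A \<inter> space P | k A. k \<in> K \<and> A \<in> sets borel}
      = {(\<lambda>w. V n t w k) -` A \<inter> space P | t k A. t \<in> T \<and> k < m \<and> A \<in> sets borel}" for n
    unfolding K_def V'_def by fastforce
  interpret ks: kernel_series P M rho alpha beta U K B' V'
  proof
    show "U \<in> measurable P (Msig M rho)" using U_unif by (simp add: uniform_on_def)
    show "reproducing_kernels P M rho alpha beta U" by (rule cpths_reproducing_kernels[OF P d M U_unif])
    show "indep_sets (\<lambda>i. case i of
                     None \<Rightarrow> {U -` A \<inter> space P | A. A \<in> sets (Msig M rho)}
                   | Some n \<Rightarrow> sigma_sets (space P) {V' n k -` A \<inter> space P | k A. k \<in> K \<and> A \<in> sets borel}) UNIV"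
      unfolding gens by (rule indep)
    fix n k assume k: "k \<in> K"
    show "sq_int P (V' n k)" "expectation (V' n k) = 0"
      using k V_meas V_mean by (auto simp: K_def V'_def sq_int_def)
    show "summable (\<lambda>n. B' n k k * jacobiP n alpha beta 1)"
      using k B_sum by (auto simp: K_def B'_def)
    fix l assume l: "l \<in> K"
    show "expectation (\<lambda>w. V' n k w * V' n l w) = (jacobi_a alpha beta n)\<^sup>2 * B' n k l"
      using k l V_cov[of "fst k" "fst l" "snd k" "snd l" n] V_mean[of "fst k" "snd k" n] V_mean[of "fst l" "snd l" n]
      by (auto simp: K_def V'_def B'_def covar_def)
  qed
  have part: "ks.partial N x (t, k) w = (\<Sum>n<N. V n t w k * jacobiP n alpha beta (cos (rho x (U w))))" for N x t k w
    unfolding ks.partial_def ks.W_def ks.p_def by (simp add: V'_def)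
  have inK: "(t, k) \<in> K" if "t \<in> T" "k < m" for t k using that by (simp add: K_def)
  define Z where "Z = (\<lambda>x t w k. ks.Z x (t, k) w)"
  have covar: "(\<lambda>n. B n (t1 - t2) k l * jacobiP n alpha beta (cos (rho x1 x2)))
          sums covar P (\<lambda>w. Z x1 t1 w k) (\<lambda>w. Z x2 t2 w l)"
    if "x1 \<in> M" "x2 \<in> M" "t1 \<in> T" "t2 \<in> T" "k < m" "l < m" for x1 x2 t1 t2 k l
    using ks.Z_covariance[OF that(1,2) inK[OF that(3,5)] inK[OF that(4,6)]]
      ks.Z_covar[OF that(1,2) inK[OF that(3,5)] inK[OF that(4,6)]]
    by (simp add: Z_def B'_def)
  show ?thesis
  proof (intro exI[of _ Z] conjI ballI allI impI)
    fix x t k assume x: "x \<in> M" and t: "t \<in> T" and k: "k < m"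
    show "(\<lambda>w. Z x t w k) \<in> borel_measurable P" "integrable P (\<lambda>w. (Z x t w k)^2)"
      using ks.Z_sq[OF x inK[OF t k]] by (simp_all add: Z_def sq_int_def)
    show "(\<lambda>N. \<integral>w. (Z x t w k - (\<Sum>n<N. V n t w k * jacobiP n alpha beta (cos (rho x (U w)))))^2 \<partial>P) \<longlonglongrightarrow> 0"
      using ks.Z_lim[OF x inK[OF t k]] by (simp add: Z_def part)
    show "(\<integral>w. Z x t w k \<partial>P) = 0"
      using ks.Z_mean[OF x inK[OF t k]] by (simp add: Z_def)
  next
    fix x1 x2 t1 t2 k l assume "x1 \<in> M" "x2 \<in> M" "t1 \<in> T" "t2 \<in> T" "k < m" "l < m"
    then show "(\<lambda>n. B n (t1 - t2) k l * jacobiP n alpha beta (cos (rho x1 x2)))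
          sums covar P (\<lambda>w. Z x1 t1 w k) (\<lambda>w. Z x2 t2 w l)" by (rule covar)
  next
    fix x1 x2 y1 y2 t1 t2 s1 s2 k l
    assume S: "x1 \<in> M" "x2 \<in> M" "y1 \<in> M" "y2 \<in> M" "t1 \<in> T" "t2 \<in> T" "s1 \<in> T" "s2 \<in> T" "k < m" "l < m"
      and eq: "rho x1 x2 = rho y1 y2" "t1 - t2 = s1 - s2"
    \<comment> \<open>Both covariances are sums of one and the same series, since its terms depend
      only on the distance and the time lag.\<close>
    show "covar P (\<lambda>w. Z x1 t1 w k) (\<lambda>w. Z x2 t2 w l) = covar P (\<lambda>w. Z y1 s1 w k) (\<lambda>w. Z y2 s2 w l)"
      using covar[OF S(1,2,5,6,9,10)] covar[OF S(3,4,7,8,9,10)] unfolding eq by (rule sums_unique2)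
  next
    fix t k and e :: real assume "t \<in> T" "k < m" "e > 0"
    then show "\<exists>\<delta>>0. \<forall>x1\<in>M. \<forall>x2\<in>M. rho x1 x2 < \<delta> \<longrightarrow> (\<integral>w. (Z x1 t w k - Z x2 t w k)^2 \<partial>P) < e"
      using ks.Z_continuous[OF inK] unfolding Z_def by blast
  qed
qed

end
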